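(* Let $\mathbb{K}$ be a field of characteristic $0$, let $S=\mathbb{K}[x_1,\dots,x_l]$ with the standard grading, let $I$ be a homogeneous ideal of $S$ and let $1\le k\le l$. Put $\hat I=I+\langle x_1,\dots,x_l\rangle^{\operatorname{reg}(I)+1}$. Then the following are equivalent: (1) the graded ring $S/I$ has the $k$-WLP; (2) the graded Artinian ring $S/\hat I$ has the $k$-WLP.
   Context: $\operatorname{reg}(I)$ is the Castelnuovo–Mumford regularity of $I$: the maximum of the numbers $d_i-i$, where $d_i=\max\{j\mid\beta_{i,j}(I)\neq0\}$ and $\beta_{i,j}(I)$ are the graded Betti numbers of $I$ as a graded $S$-module (this definition presupposes $I\ne 0$). A linear map is full-rank if it is injective or surjective. A graded ring $R=\bigoplus_{i\ge0}R_i$ over $\mathbb{K}$ with $\dim_{\mathbb{K}}R_i<\infty$ (not necessarily Artinian) has the WLP with Lefschetz element $\ell\in R_1$ if $\times\ell\colon R_i\to R_{i+1}$ is full-rank for all $i\ge 0$. For $k\ge1$, $R$ has the $k$-WLP if there exist $\ell_1,\dots,\ell_k\in R_1$ such that $R$ has the WLP with Lefschetz element $\ell_1$ and, for all $i=2,\dots,k$, $R/\langle\ell_1,\dots,\ell_{i-1}\rangle$ has the WLP with Lefschetz element (the class of) $\ell_i$. *)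

theory Defs
  imports
    "HOL-Library.Poly_Mapping"
    "HOL-Library.Cardinality"
    "HOL-Algebra.QuotRing"
    "HOL-Algebra.Ideal_Product"
    "Jordan_Normal_Form.Matrix_Kernel"
begin

section \<open>The standard graded polynomial ring\<close>

text \<open>The variables are indexed by a finite type \<open>'n\<close>, so that $l$ is \<open>CARD('n)\<close>; a polynomial is
  a finitely supported map from exponent vectors to coefficients.\<close>

type_synonym ('n, 'k) mpoly = "('n \<Rightarrow>\<^sub>0 nat) \<Rightarrow>\<^sub>0 'k"

abbreviation polynomial_ring :: "('n, 'k::comm_ring_1) mpoly ring" where
  "polynomial_ring \<equiv> class_ring"

definition variable :: "'n \<Rightarrow> ('n, 'k::comm_ring_1) mpoly" where
  "variable i = Poly_Mapping.single (Poly_Mapping.single i 1) 1"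

definition mono_degree :: "('n::finite \<Rightarrow>\<^sub>0 nat) \<Rightarrow> nat" where
  "mono_degree m = (\<Sum>i\<in>UNIV. Poly_Mapping.lookup m i)"

text \<open>Degrees are integers because differences of shifts occur as degrees below.
  The zero polynomial is homogeneous of every degree, also of negative ones.\<close>

definition homogeneous :: "int \<Rightarrow> ('n::finite, 'k::comm_ring_1) mpoly \<Rightarrow> bool" where
  "homogeneous e p \<longleftrightarrow> (\<forall>m\<in>Poly_Mapping.keys p. int (mono_degree m) = e)"

definition standard_grading :: "nat \<Rightarrow> ('n::finite, 'k::comm_ring_1) mpoly set" where
  "standard_grading i = {p. homogeneous (int i) p}"

definition homogeneous_ideal :: "('n::finite, 'k::comm_ring_1) mpoly set \<Rightarrow> bool" where
  "homogeneous_ideal I \<longleftrightarrow>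
     (\<exists>H. (\<forall>h\<in>H. \<exists>e. homogeneous e h) \<and> I = genideal polynomial_ring H)"

definition irrelevant_ideal :: "('n, 'k::comm_ring_1) mpoly set" where
  "irrelevant_ideal = genideal polynomial_ring (range variable)"

section \<open>Graded Betti numbers and regularity\<close>

text \<open>A graded free resolution $\cdots \to F_1 \to F_0 \to I \to 0$ is given by its shifts and its
  matrices: $F_i$ is the direct sum of the $S(-e)$ over the entries $e$ of the list \<open>d i\<close>, the
  one-rowed matrix \<open>A 0\<close> is the augmentation $F_0 \to I \subseteq S$, and \<open>A (Suc i)\<close> is the
  differential $F_{i+1} \to F_i$. The maps are homogeneous of degree 0. The last conjunct is
  minimality: $F_{i+1}$ is mapped into $\langle x_1,\dots,x_l\rangle F_i$.\<close>

definition minimal_graded_free_resolution ::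
  "('n::finite, 'k::field) mpoly set \<Rightarrow> (nat \<Rightarrow> int list) \<Rightarrow> (nat \<Rightarrow> ('n, 'k) mpoly mat) \<Rightarrow> bool"
where
  "minimal_graded_free_resolution I d A \<longleftrightarrow>
     A 0 \<in> carrier_mat 1 (length (d 0)) \<and>
     (\<forall>i. A (Suc i) \<in> carrier_mat (length (d i)) (length (d (Suc i)))) \<and>
     (\<forall>b<length (d 0). homogeneous (d 0 ! b) (A 0 $$ (0, b))) \<and>
     (\<forall>i. \<forall>a<length (d i). \<forall>b<length (d (Suc i)).
        homogeneous (d (Suc i) ! b - d i ! a) (A (Suc i) $$ (a, b))) \<and>
     (\<lambda>v. A 0 *\<^sub>v v) ` carrier_vec (length (d 0)) = {w \<in> carrier_vec 1. w $ 0 \<in> I} \<and>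
     (\<forall>i. (\<lambda>v. A (Suc i) *\<^sub>v v) ` carrier_vec (length (d (Suc i))) = mat_kernel (A i)) \<and>
     (\<forall>i. \<forall>a<length (d i). \<forall>b<length (d (Suc i)). A (Suc i) $$ (a, b) \<in> irrelevant_ideal)"

text \<open>Every homogeneous ideal of $S$ has a minimal graded free resolution, and the multisets of
  its shifts do not depend on the choice.\<close>

definition resolution_shifts :: "('n::finite, 'k::field) mpoly set \<Rightarrow> nat \<Rightarrow> int list" where
  "resolution_shifts I = (SOME d. \<exists>A. minimal_graded_free_resolution I d A)"

definition graded_betti :: "('n::finite, 'k::field) mpoly set \<Rightarrow> nat \<Rightarrow> int \<Rightarrow> nat" where
  "graded_betti I i j = count_list (resolution_shifts I i) j"

text \<open>Only indices \<open>i\<close> with a nonzero Betti number contribute; by Hilbert's syzygy theorem they are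
  finitely many, and there is at least one if $I \neq 0$.\<close>

definition regularity :: "('n::finite, 'k::field) mpoly set \<Rightarrow> int" where
  "regularity I =
     Max {Max {j. graded_betti I i j \<noteq> 0} - int i | i. \<exists>j. graded_betti I i j \<noteq> 0}"

section \<open>Lefschetz properties of graded rings\<close>

text \<open>A graded ring is given by a ring \<open>R\<close> and the family \<open>G\<close> of its homogeneous components.\<close>

definition full_rank :: "('a \<Rightarrow> 'b) \<Rightarrow> 'a set \<Rightarrow> 'b set \<Rightarrow> bool" where
  "full_rank f V W \<longleftrightarrow> inj_on f V \<or> f ` V = W"

definition WLP_with :: "('a, 'm) ring_scheme \<Rightarrow> (nat \<Rightarrow> 'a set) \<Rightarrow> 'a \<Rightarrow> bool" where
  "WLP_with R G l \<longleftrightarrow>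
     l \<in> G 1 \<and> (\<forall>i. full_rank (\<lambda>x. l \<otimes>\<^bsub>R\<^esub> x) (G i) (G (i + 1)))"

definition quotient_grading ::
  "('a, 'm) ring_scheme \<Rightarrow> (nat \<Rightarrow> 'a set) \<Rightarrow> 'a set \<Rightarrow> nat \<Rightarrow> 'a set set" where
  "quotient_grading R G J i = (\<lambda>x. J +>\<^bsub>R\<^esub> x) ` G i"

definition k_WLP :: "('a, 'm) ring_scheme \<Rightarrow> (nat \<Rightarrow> 'a set) \<Rightarrow> nat \<Rightarrow> bool" where
  "k_WLP R G k \<longleftrightarrow>
     (\<exists>l. (\<forall>i\<in>{1..k}. l i \<in> G 1) \<and> WLP_with R G (l 1) \<and>
        (\<forall>i\<in>{2..k}. let J = genideal R (l ` {1..i - 1}) in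
           WLP_with (R Quot J) (quotient_grading R G J) (J +>\<^bsub>R\<^esub> l i)))"

text \<open>The case of the graded ring $S/J$ for a homogeneous ideal $J$.\<close>

definition quotient_k_WLP :: "('n::finite, 'k::field) mpoly set \<Rightarrow> nat \<Rightarrow> bool" where
  "quotient_k_WLP J k \<longleftrightarrow>
     k_WLP (polynomial_ring Quot J) (quotient_grading polynomial_ring standard_grading J) k"

definition truncated_ideal :: "('n::finite, 'k::field) mpoly set \<Rightarrow> ('n, 'k) mpoly set" where
  "truncated_ideal I =
     I <+>\<^bsub>polynomial_ring\<^esub>
       irrelevant_ideal [^]\<^bsub>ideals_set polynomial_ring\<^esub> nat (regularity I + 1)"

end

theory Submission
  imports Defs "HOL-Library.Function_Algebras" "HOL-Computational_Algebra.Primes"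
begin

text \<open>Below degree $\mathrm{reg}(I)+1$ the rings $S/I$ and $S/\hat I$ and all their quotients by linear
  forms agree, so only the multiplications starting in degrees at least $r = \mathrm{reg}(I)$ matter.
  They are trivially surjective for $S/\hat I$. For $S/I$ they are injective if the linear forms
  $\ell_1,\dots,\ell_l$ are generic, and the rank conditions in low degrees are open, so a
  sequence that works for $S/\hat I$ may be replaced by a generic one.

  For the injectivity, let $G$ be the minimal resolution of $S/I$ and consider the homology of
  $G/(\ell_1,\dots,\ell_j)G$. For $j = l$ it is $G \otimes \mathbb{K}$, whose degrees are bounded by the regularity.
  The long exact sequences of multiplication by $\ell_{j+1}$ carry this bound down to $j = 0$, because
  genericity makes the positive homology vanish in large degrees. The same sequences, read upwards
  from $j = 0$, give Hilbert's syzygy theorem, without which the maximum defining the regularity could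
  be meaningless.\<close>

subsection \<open>Homogeneous components\<close>

text \<open>Two demands on one sequence of forms compete: full rank in low degrees, inherited from
  the given forms, and injectivity in high degrees, which asks for genericity. They are reconciled
  by changing one form at a time along a line \<open>l j + t b\<close>: each demand excludes
  finitely many values of \<open>t\<close>, and characteristic 0 makes the field infinite. The later
  ideals move along with the forms, so a rank condition is not simply open. What is lower
  semicontinuous is the dimension of the graded pieces of the ideals, and full rank of the given
  sequence means that these dimensions are as large as the preceding ones allow.

  Genericity alone gives injectivity only from some unknown degree on; turning it into the explicit
  degree \<open>r\<close> is the task of the resolution. As many forms as variables are constructed
  although only \<open>k\<close> of them occur in the claim, because the regularity becomes visible
  only modulo all of them. Homology is never formed as a module: two predicates on homogeneous
  elements of a fixed degree replace it.\<close>

abbreviation "lookup \<equiv> Poly_Mapping.lookup"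
abbreviation "keys \<equiv> Poly_Mapping.keys"
abbreviation "single \<equiv> Poly_Mapping.single"

global_interpretation ring_module: module "(*) :: 'a::comm_ring_1 \<Rightarrow> 'a \<Rightarrow> 'a"
  by unfold_locales (auto simp: algebra_simps)

text \<open>This instance of associativity would loop against \<open>mult.assoc\<close>.\<close>

declare ring_module.scale_scale [simp del]

lift_definition hom_comp :: "int \<Rightarrow> ('n::finite, 'k::comm_ring_1) mpoly \<Rightarrow> ('n, 'k) mpoly"
  is "\<lambda>e f m. if int (mono_degree m) = e then f m else 0"
  by (erule finite_subset[rotated]) auto

lemma lookup_hom_comp:
  "lookup (hom_comp e p) m =
     (if int (mono_degree m) = e then lookup p m else 0)"
  by transfer simp

lemma mono_degree_add: "mono_degree (m + m') = mono_degree m + mono_degree m'"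
  by (simp add: mono_degree_def lookup_add sum.distrib)

lemma mono_degree_zero [simp]: "mono_degree 0 = 0"
  by (simp add: mono_degree_def)

lemma mono_degree_eq_0_iff: "mono_degree m = 0 \<longleftrightarrow> m = 0"
  by (simp add: mono_degree_def poly_mapping_eq_iff fun_eq_iff)

lemma homogeneous_iff:
  "homogeneous e p \<longleftrightarrow> (\<forall>m. lookup p m \<noteq> 0 \<longrightarrow> int (mono_degree m) = e)"
  by (auto simp: homogeneous_def in_keys_iff)

lemma homogeneous_iff_hom_comp: "homogeneous e p \<longleftrightarrow> hom_comp e p = p"
  by (auto simp: homogeneous_iff poly_mapping_eq_iff lookup_hom_comp fun_eq_iff)

lemma homogeneous_hom_comp [simp]: "homogeneous e (hom_comp e p)"
  by (auto simp: homogeneous_iff lookup_hom_comp split: if_splits)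

lemma hom_comp_same [simp]: "homogeneous e p \<Longrightarrow> hom_comp e p = p"
  by (simp add: homogeneous_iff_hom_comp)

lemma hom_comp_other: "homogeneous d p \<Longrightarrow> d \<noteq> e \<Longrightarrow> hom_comp e p = 0"
  by (rule poly_mapping_eqI) (auto simp: homogeneous_iff lookup_hom_comp)

lemma hom_comp_0 [simp]: "hom_comp e 0 = 0"
  by (rule poly_mapping_eqI) (simp add: lookup_hom_comp)

lemma hom_comp_add: "hom_comp e (p + q) = hom_comp e p + hom_comp e q"
  by (rule poly_mapping_eqI) (simp add: lookup_hom_comp lookup_add)

lemma hom_comp_diff: "hom_comp e (p - q) = hom_comp e p - hom_comp e q"
  by (rule poly_mapping_eqI) (simp add: lookup_hom_comp lookup_minus)

lemma hom_comp_sum: "hom_comp e (sum f A) = (\<Sum>a\<in>A. hom_comp e (f a))"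
  by (induction A rule: infinite_finite_induct) (simp_all add: hom_comp_add)

lemma homogeneous_0 [simp]: "homogeneous e 0"
  by (simp add: homogeneous_iff)

lemma homogeneous_add: "homogeneous e p \<Longrightarrow> homogeneous e q \<Longrightarrow> homogeneous e (p + q)"
  by (simp add: homogeneous_iff_hom_comp hom_comp_add)

lemma homogeneous_diff: "homogeneous e p \<Longrightarrow> homogeneous e q \<Longrightarrow> homogeneous e (p - q)"
  by (simp add: homogeneous_iff_hom_comp hom_comp_diff)

lemma homogeneous_sum: "(\<And>a. a \<in> A \<Longrightarrow> homogeneous e (f a)) \<Longrightarrow> homogeneous e (sum f A)"
  by (simp add: homogeneous_iff_hom_comp hom_comp_sum)

lemma homogeneous_mult: "homogeneous d p \<Longrightarrow> homogeneous e q \<Longrightarrow> homogeneous (d + e) (p * q)"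
  using keys_mult[of p q] by (fastforce simp: homogeneous_def mono_degree_add)

lemma homogeneous_mult_eq:
  "homogeneous d p \<Longrightarrow> homogeneous e q \<Longrightarrow> c = d + e \<Longrightarrow> homogeneous c (p * q)"
  by (simp add: homogeneous_mult)

lemma homogeneous_single: "int (mono_degree m) = e \<Longrightarrow> homogeneous e (single m c)"
  by (auto simp: homogeneous_iff lookup_single when_def)

lemma homogeneous_const [simp]: "homogeneous 0 (single 0 c)"
  by (simp add: homogeneous_single)

lemma homogeneous_one [simp]: "homogeneous 0 1"
  by (metis homogeneous_const single_one)

lemma homogeneous_const_mult: "homogeneous e p \<Longrightarrow> homogeneous e (single 0 c * p)"
  by (rule homogeneous_mult_eq[OF homogeneous_const]) auto

lemma homogeneous_variable [simp]: "homogeneous 1 (variable i)"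
proof -
  have "mono_degree (single i (Suc 0)) = 1"
    unfolding mono_degree_def lookup_single by (simp add: when_def)
  then show ?thesis by (simp add: variable_def homogeneous_single)
qed

lemma homogeneous_neg_degree: "homogeneous e p \<Longrightarrow> e < 0 \<Longrightarrow> p = 0"
  by (rule poly_mapping_eqI) (auto simp: homogeneous_iff)

lemma sum_hom_comp:
  assumes "finite E" "\<And>m. m \<in> keys p \<Longrightarrow> int (mono_degree m) \<in> E"
  shows "(\<Sum>e\<in>E. hom_comp e p) = p"
proof (rule poly_mapping_eqI)
  fix m
  have "lookup (\<Sum>e\<in>E. hom_comp e p) m =
      (\<Sum>e\<in>E. if int (mono_degree m) = e then lookup p m else 0)"
    by (simp add: lookup_sum lookup_hom_comp)
  also have "\<dots> = lookup p m"
    using assms by (auto simp: in_keys_iff)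
  finally show "lookup (\<Sum>e\<in>E. hom_comp e p) m = lookup p m" .
qed

lemma hom_comp_decomposition:
  obtains E where "finite E" "(\<Sum>e\<in>E. hom_comp e p) = p"
  by (rule that[OF _ sum_hom_comp[of "(\<lambda>m. int (mono_degree m)) ` keys p" p]]) simp_all

lemma hom_comp_mult:
  assumes "homogeneous d h"
  shows "hom_comp e (h * p) = h * hom_comp (e - d) p"
proof -
  obtain E where E: "finite E" "(\<Sum>c\<in>E. hom_comp c p) = p"
    by (rule hom_comp_decomposition)
  have *: "hom_comp e (h * hom_comp c p) = h * hom_comp (e - d) (hom_comp c p)" for c
  proof (cases "c = e - d")
    case True
    then have "homogeneous e (h * hom_comp c p)"
      by (intro homogeneous_mult_eq[OF assms homogeneous_hom_comp]) simp
    then show ?thesis using True by simp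
  next
    case False
    have "hom_comp e (h * hom_comp c p) = 0"
      using False by (intro hom_comp_other[OF homogeneous_mult[OF assms homogeneous_hom_comp]]) auto
    then show ?thesis using False by (simp add: hom_comp_other[of c])
  qed
  have "hom_comp e (h * p) = (\<Sum>c\<in>E. hom_comp e (h * hom_comp c p))"
    by (subst E(2)[symmetric]) (simp add: sum_distrib_left hom_comp_sum)
  also have "\<dots> = h * hom_comp (e - d) (\<Sum>c\<in>E. hom_comp c p)"
    by (simp add: * hom_comp_sum sum_distrib_left)
  finally show ?thesis by (simp only: E(2))
qed

lemma sum_single_keys:
  "(\<Sum>m\<in>keys p. single m (lookup p m)) = p"
proof (rule poly_mapping_eqI)
  fix k
  have "lookup (\<Sum>m\<in>keys p. single m (lookup p m)) k
      = (\<Sum>m\<in>keys p. if m = k then lookup p m else 0)"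
    by (simp add: lookup_sum lookup_single when_def)
  also have "\<dots> = lookup p k"
    by (simp add: in_keys_iff)
  finally show "lookup (\<Sum>m\<in>keys p. single m (lookup p m)) k
      = lookup p k" .
qed

lemma mono_prod_variables:
  fixes m :: "'n::finite \<Rightarrow>\<^sub>0 nat"
  shows "single m (1::'k::comm_ring_1) = (\<Prod>i\<in>UNIV. variable i ^ lookup m i)"
proof -
  have pow: "(variable i :: ('n, 'k) mpoly) ^ n = single (single i n) 1" for i :: 'n and n
    by (induction n) (simp_all add: variable_def mult_single single_add[symmetric])
  have prod: "(\<Prod>i\<in>A. single (f i) (1::'k)) = single (\<Sum>i\<in>A. f i) 1"
    for A and f :: "'n \<Rightarrow> 'n \<Rightarrow>\<^sub>0 nat"
    by (induction A rule: infinite_finite_induct) (simp_all add: mult_single)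
  have "(\<Sum>i\<in>UNIV. single i (lookup m i)) = m"
    by (rule poly_mapping_eqI) (simp add: lookup_sum lookup_single when_def)
  then show ?thesis by (simp add: pow prod)
qed

subsection \<open>Graded ideals\<close>

text \<open>Ideals are subspaces of the ring as a module over itself, so that generated ideals are
  spans and the theory of \<open>module\<close> applies. \<open>genideal_class_ring\<close> links
  this with \<open>genideal\<close>.\<close>

definition graded_ideal :: "('n::finite, 'k::comm_ring_1) mpoly set \<Rightarrow> bool" where
  "graded_ideal J \<longleftrightarrow> ring_module.subspace J \<and> (\<forall>p\<in>J. \<forall>e. hom_comp e p \<in> J)"

lemma graded_idealD:
  assumes "graded_ideal J"
  shows "ring_module.subspace J" "p \<in> J \<Longrightarrow> hom_comp e p \<in> J"
  using assms by (auto simp: graded_ideal_def)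

lemma subspace_mult_right:
  "ring_module.subspace J \<Longrightarrow> x \<in> J \<Longrightarrow> x * c \<in> (J :: 'a::comm_ring_1 set)"
  using ring_module.subspace_scale[of J x c] by (simp add: mult.commute)

lemma graded_ideal_span:
  assumes "\<And>h. h \<in> H \<Longrightarrow> \<exists>e. homogeneous e h"
  shows "graded_ideal (ring_module.span H)"
  unfolding graded_ideal_def
proof (intro conjI ballI allI)
  show "ring_module.subspace (ring_module.span H)" by simp
  fix p e assume "p \<in> ring_module.span H"
  then show "hom_comp e p \<in> ring_module.span H"
  proof (induction rule: ring_module.span_induct_alt)
    case (step c x y)
    obtain d where "homogeneous d x" using assms step by blast
    then have "hom_comp e (c * x) = hom_comp (e - d) c * x"
      using hom_comp_mult[of d x e c] by (simp add: mult.commute)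
    then show ?case
      using step ring_module.span_add[OF ring_module.span_scale[OF ring_module.span_base]]
      by (simp add: hom_comp_add)
  qed (simp add: ring_module.span_zero)
qed

lemma graded_ideal_span_Un:
  assumes "graded_ideal J" "\<And>h. h \<in> H \<Longrightarrow> \<exists>e. homogeneous e h"
  shows "graded_ideal (ring_module.span (J \<union> H))"
proof -
  \<comment> \<open>\<open>J\<close> does not consist of homogeneous elements, so it is replaced by
    its homogeneous members, which generate it.\<close>
  let ?J = "{p\<in>J. \<exists>e. homogeneous e p}"
  have "p \<in> ring_module.span ?J" if "p \<in> J" for p
  proof -
    obtain E where E: "finite E" "(\<Sum>e\<in>E. hom_comp e p) = p" by (rule hom_comp_decomposition)
    have "(\<Sum>e\<in>E. hom_comp e p) \<in> ring_module.span ?J"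
      using graded_idealD(2)[OF assms(1) that] homogeneous_hom_comp
      by (intro ring_module.span_sum ring_module.span_base) blast
    then show ?thesis using E by simp
  qed
  then have "ring_module.span (J \<union> H) = ring_module.span (?J \<union> H)"
    unfolding ring_module.span_eq
    using ring_module.span_mono[of ?J "?J \<union> H"] ring_module.span_superset[of "?J \<union> H"]
      ring_module.span_superset[of "J \<union> H"] by blast
  moreover have "graded_ideal (ring_module.span (?J \<union> H))"
    by (rule graded_ideal_span) (use assms(2) in auto)
  ultimately show ?thesis by simp
qed

text \<open>Any coefficient of \<open>f\<close> may be projected to degree \<open>e - c\<close>,
  since \<open>J\<close> contains the components of its elements.\<close>

lemma homogeneous_span_insert:
  assumes J: "graded_ideal J" and f: "homogeneous c f" and x: "homogeneous e x"
    and "x \<in> ring_module.span (insert f J)"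
  obtains a where "homogeneous (e - c) a" "x - a * f \<in> J"
proof -
  have span: "ring_module.span J = J" using J by (simp add: graded_ideal_def)
  obtain a where a: "x - a * f \<in> J"
    using assms(4) ring_module.span_breakdown_eq[of x f J] span by auto
  have "hom_comp e (a * f) = hom_comp (e - c) a * f"
    using hom_comp_mult[OF f, of e a] by (simp add: mult.commute)
  then have "x - hom_comp (e - c) a * f \<in> J"
    using x graded_idealD(2)[OF J a, of e] by (simp add: hom_comp_diff)
  then show ?thesis by (intro that[of "hom_comp (e - c) a"]) auto
qed

abbreviation variable_span :: "('n, 'k::comm_ring_1) mpoly set" where
  "variable_span \<equiv> ring_module.span (range variable)"

text \<open>Over a field this makes a homogeneous element of degree 0 outside the ideal of the
  variables a unit, which is how redundant generators are recognised later.\<close>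

lemma irrelevant_iff:
  fixes p :: "('n::finite, 'k::comm_ring_1) mpoly"
  shows "p \<in> variable_span \<longleftrightarrow> lookup p 0 = 0"
proof
  \<comment> \<open>Constant coefficients multiply because no component has negative degree: only
    the degree 0 component of \<open>a\<close> contributes to degree 0.\<close>
  have lookup_mult0: "lookup (a * b) 0 = lookup a 0 * lookup b 0"
    for a b :: "('n, 'k) mpoly"
  proof -
    have "hom_comp 0 (hom_comp 0 a * b) = hom_comp 0 a * hom_comp 0 b"
      using hom_comp_mult[of 0 "hom_comp 0 a" 0 b] by simp
    have c: "hom_comp 0 c = single 0 (lookup c 0)" for c :: "('n, 'k) mpoly"
      by (rule poly_mapping_eqI) (auto simp: lookup_hom_comp lookup_single when_def mono_degree_eq_0_iff)
    obtain E where E: "finite E" "(\<Sum>e\<in>E. hom_comp e a) = a" by (rule hom_comp_decomposition)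
    have z: "hom_comp 0 (hom_comp e a * b) = (if e = 0 then hom_comp 0 a * hom_comp 0 b else 0)" for e
    proof (cases "e < 0")
      case True
      then have "hom_comp e a = 0" using homogeneous_neg_degree[OF homogeneous_hom_comp] by blast
      then show ?thesis using True by simp
    next
      case False
      have "e \<noteq> 0 \<Longrightarrow> hom_comp (- e) b = 0"
        using False homogeneous_neg_degree[OF homogeneous_hom_comp, of "- e"] by simp
      then show ?thesis using hom_comp_mult[of e "hom_comp e a" 0 b] by auto
    qed
    have "hom_comp 0 (a * b) = (\<Sum>e\<in>E. hom_comp 0 (hom_comp e a * b))"
      by (subst E(2)[symmetric]) (simp add: sum_distrib_right hom_comp_sum)
    also have "\<dots> = (\<Sum>e\<in>E. hom_comp 0 (hom_comp e a)) * hom_comp 0 b"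
      unfolding sum_distrib_right by (rule sum.cong) (auto simp: z hom_comp_other[OF homogeneous_hom_comp])
    also have "(\<Sum>e\<in>E. hom_comp 0 (hom_comp e a)) = hom_comp 0 a"
      by (subst (2) E(2)[symmetric]) (simp add: hom_comp_sum)
    finally have "hom_comp 0 (a * b) = hom_comp 0 a * hom_comp 0 b" .
    then show ?thesis by (simp add: c mult_single) (metis lookup_single_eq)
  qed
  assume "p \<in> variable_span"
  then show "lookup p 0 = 0"
  proof (induction rule: ring_module.span_induct_alt)
    case (step c x y)
    have "lookup (variable i :: ('n, 'k) mpoly) 0 = 0" for i
      by (simp add: variable_def lookup_single when_def)
        (metis lookup_single_eq lookup_zero zero_neq_one One_nat_def)
    then have "lookup x 0 = 0" using step by auto
    then show ?case using step by (simp add: lookup_add lookup_mult0)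
  qed simp
next
  assume p: "lookup p 0 = 0"
  have "single m c \<in> variable_span"
    if m: "m \<noteq> 0" for m :: "'n \<Rightarrow>\<^sub>0 nat" and c :: 'k
  proof -
    obtain i where i: "lookup m i \<noteq> 0"
      using m by (metis poly_mapping_eqI lookup_zero)
    let ?m = "m - single i 1"
    have "m = ?m + single i 1"
      using i by (intro poly_mapping_eqI) (auto simp: lookup_add lookup_minus lookup_single when_def)
    then have "single m c = single ?m c * variable i"
      by (simp add: variable_def mult_single)
    then show ?thesis
      by (metis ring_module.span_scale ring_module.span_base rangeI)
  qed
  then have "(\<Sum>m\<in>keys p. single m (lookup p m))
      \<in> variable_span"
    using p by (intro ring_module.span_sum) (metis in_keys_iff)
  then show "p \<in> variable_span"
    by (simp only: sum_single_keys)
qed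

lemma homogeneous_irrelevant:
  assumes "homogeneous e p" "e > 0"
  shows "p \<in> variable_span"
  using assms by (force simp: irrelevant_iff homogeneous_iff)

subsection \<open>Leading monomials\<close>

text \<open>Sending the variables to distinct primes embeds the monomials multiplicatively into the
  positive integers, which pulls back a monomial order that is a well-order for free.\<close>

lemma monomial_code_exists:
  "\<exists>code :: ('n::finite \<Rightarrow>\<^sub>0 nat) \<Rightarrow> nat.
     inj code \<and> (\<forall>m m'. code (m + m') = code m * code m') \<and> (\<forall>m. code m > 0)"
proof -
  obtain T :: "nat set" where T: "finite T" "card T = CARD('n)" "T \<subseteq> {p. prime p}"
    using infinite_arbitrarily_large[OF primes_infinite] by blast
  obtain f where f: "bij_betw f (UNIV :: 'n set) T"
    using finite_same_card_bij[of "UNIV :: 'n set" T] T by auto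
  define g where "g = inv_into UNIV f"
  have g: "bij_betw g T UNIV" unfolding g_def by (rule bij_betw_inv_into[OF f])
  have gf: "g (f i) = i" for i
    using f by (simp add: g_def bij_betw_def)
  define code where "code m = (\<Prod>p\<in>T. p ^ lookup m (g p))" for m :: "'n \<Rightarrow>\<^sub>0 nat"
  have "inj code"
  proof (rule injI)
    fix m m' assume eq: "code m = code m'"
    have "multiplicity (f i) (code m) = lookup m i" for m i
    proof -
      have "f i \<in> T" using f by (auto simp: bij_betw_def)
      then have "multiplicity (f i) (code m) = lookup m (g (f i))"
        using T multiplicity_prod_prime_powers[of T "f i" "\<lambda>p. lookup m (g p)"]
        by (auto simp: code_def)
      then show ?thesis by (simp add: gf)
    qed
    then show "m = m'" using eq by (metis poly_mapping_eqI)
  qed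
  moreover have "code m > 0" for m
    unfolding code_def using T by (intro prod_pos) (auto simp: prime_gt_0_nat)
  moreover have "code (m + m') = code m * code m'" for m m'
    by (simp add: code_def lookup_add power_add prod.distrib)
  ultimately show ?thesis by blast
qed

definition mono_code :: "('n::finite \<Rightarrow>\<^sub>0 nat) \<Rightarrow> nat" where
  "mono_code = (SOME code. inj code \<and> (\<forall>m m'. code (m + m') = code m * code m') \<and> (\<forall>m. code m > 0))"

lemma
  shows mono_code_inj: "inj mono_code"
    and mono_code_add: "mono_code (m + m') = mono_code m * mono_code m'"
    and mono_code_pos [simp]: "mono_code m > 0"
  using someI_ex[OF monomial_code_exists] unfolding mono_code_def[symmetric] by auto

definition leading_mono :: "('n::finite, 'k::comm_ring_1) mpoly \<Rightarrow> ('n \<Rightarrow>\<^sub>0 nat) \<Rightarrow> bool" where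
  "leading_mono p m \<longleftrightarrow> m \<in> keys p \<and>
     (\<forall>m'\<in>keys p. m' \<noteq> m \<longrightarrow> mono_code m' < mono_code m)"

lemma lookup_const_mult:
  "lookup (single 0 c * p) k = c * lookup p k"
  by (simp add: mult_map_scale_conv_mult[symmetric] Poly_Mapping.map.rep_eq when_def)

lemma leading_mono_exists:
  assumes "p \<noteq> 0"
  obtains m where "leading_mono p m"
proof -
  have ne: "keys p \<noteq> {}" using assms by simp
  define c where "c = Max (mono_code ` keys p)"
  have "c \<in> mono_code ` keys p" unfolding c_def using ne by (intro Max_in) auto
  then obtain m where m: "m \<in> keys p" "mono_code m = c" by auto
  have "mono_code m' < mono_code m" if "m' \<in> keys p" "m' \<noteq> m" for m'
  proof -
    have "mono_code m' \<le> c" unfolding c_def using that by (intro Max_ge) auto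
    moreover have "mono_code m' \<noteq> mono_code m" using that mono_code_inj by (auto dest: injD)
    ultimately show ?thesis using m by simp
  qed
  then show ?thesis using that m by (auto simp: leading_mono_def)
qed

text \<open>Codes multiply, so every product of two monomials other than \<open>m + n\<close> has a
  strictly smaller code. Splitting off the leading terms therefore leaves one contribution at
  \<open>m + n\<close>.\<close>

lemma lookup_mult_leading:
  assumes "leading_mono p m" "leading_mono q n"
  shows "lookup (p * q) (m + n) = lookup p m * lookup q n"
    and "k \<in> keys (p * q) \<Longrightarrow> k \<noteq> m + n \<Longrightarrow> mono_code k < mono_code (m + n)"
proof -
  have less: "mono_code (m' + n') < mono_code (m + n)"
    if "m' \<in> keys p" "n' \<in> keys q" "m' \<noteq> m \<or> n' \<noteq> n" for m' n'
  proof -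
    have "mono_code m' < mono_code m \<and> mono_code n' \<le> mono_code n \<or>
        mono_code m' \<le> mono_code m \<and> mono_code n' < mono_code n"
      using that assms unfolding leading_mono_def by (metis less_imp_le order_refl)
    then show ?thesis
      by (auto simp: mono_code_add intro: mult_less_le_imp_less mult_le_less_imp_less)
  qed
  let ?a = "single m (lookup p m)"
  let ?b = "single n (lookup q n)"
  have keys_diff: "keys (p - ?a) \<subseteq> keys p - {m}"
    by (auto simp: in_keys_iff lookup_minus lookup_single when_def split: if_splits)
  have keys_diff': "keys (q - ?b) \<subseteq> keys q - {n}"
    by (auto simp: in_keys_iff lookup_minus lookup_single when_def split: if_splits)
  have "lookup ((p - ?a) * q) (m + n) = 0"
  proof (rule ccontr)
    assume "lookup ((p - ?a) * q) (m + n) \<noteq> 0"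
    then obtain m' n' where *: "m + n = m' + n'" "m' \<in> keys (p - ?a)" "n' \<in> keys q"
      using keys_mult[of "p - ?a" q] by (auto simp: in_keys_iff)
    then show False using less[of m' n'] keys_diff by auto
  qed
  moreover have "lookup (?a * (q - ?b)) (m + n) = 0"
  proof (rule ccontr)
    assume "lookup (?a * (q - ?b)) (m + n) \<noteq> 0"
    then obtain m' n' where *: "m + n = m' + n'" "m' \<in> keys ?a" "n' \<in> keys (q - ?b)"
      using keys_mult[of ?a "q - ?b"] by (auto simp: in_keys_iff)
    then have "m' = m" by (auto split: if_splits)
    then have "n' = n" using * by simp
    then show False using * keys_diff' by auto
  qed
  moreover have "p * q = ?a * ?b + ?a * (q - ?b) + (p - ?a) * q"
    by (simp add: algebra_simps)
  ultimately show "lookup (p * q) (m + n) = lookup p m * lookup q n"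
    by (simp add: lookup_add mult_single)
  show "k \<in> keys (p * q) \<Longrightarrow> k \<noteq> m + n \<Longrightarrow> mono_code k < mono_code (m + n)"
    using keys_mult[of p q] less by blast
qed

lemma mpoly_mult_eq_0_iff:
  fixes p q :: "('n::finite, 'k::field) mpoly"
  shows "p * q = 0 \<longleftrightarrow> p = 0 \<or> q = 0"
proof
  assume pq: "p * q = 0"
  show "p = 0 \<or> q = 0"
  proof (rule ccontr)
    assume "\<not> (p = 0 \<or> q = 0)"
    then obtain m n where mn: "leading_mono p m" "leading_mono q n"
      using leading_mono_exists by metis
    then have "lookup p m * lookup q n = 0"
      using lookup_mult_leading(1)[OF mn] pq by simp
    then show False using mn by (simp add: leading_mono_def in_keys_iff)
  qed
qed auto

subsection \<open>Noetherianity\<close>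

lemma incseq_subsequence_nat:
  fixes v :: "nat \<Rightarrow> nat"
  obtains r :: "nat \<Rightarrow> nat" where "strict_mono r" "mono (\<lambda>i. v (r i))"
proof -
  obtain f where f: "strict_mono f" "monoseq (\<lambda>n. v (f n))"
    using seq_monosub[of v] by blast
  show ?thesis
  proof (cases "mono (\<lambda>n. v (f n))")
    case True
    then show ?thesis by (rule that[OF f(1)])
  next
    case False
    then have dec: "\<And>m n. m \<le> n \<Longrightarrow> v (f n) \<le> v (f m)"
      using f(2) by (auto simp: monoseq_def mono_def)
    \<comment> \<open>A nonincreasing sequence of naturals is constant from the place of its minimum
      on.\<close>
    obtain N where N: "\<And>n. v (f N) \<le> v (f n)"
      using ex_has_least_nat[of "\<lambda>_. True" 0 "\<lambda>n. v (f n)"] by auto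
    have eq: "v (f (N + i)) = v (f N)" for i
      using dec[of N "N + i"] N[of "N + i"] by simp
    have "strict_mono (\<lambda>i. f (N + i))"
      using f(1) by (auto simp: strict_mono_def)
    then show ?thesis using that[of "\<lambda>i. f (N + i)"] by (simp add: eq mono_def)
  qed
qed

text \<open>Dickson's lemma: passing to subsequences, one coordinate at a time, makes all
  coordinates nondecreasing; the first two members of the final subsequence are then
  comparable.\<close>

lemma dickson:
  fixes u :: "nat \<Rightarrow> 'n::finite \<Rightarrow> nat"
  obtains i j where "i < j" "u i \<le> u j"
proof -
  have "\<exists>r :: nat \<Rightarrow> nat. strict_mono r \<and> (\<forall>a\<in>A. mono (\<lambda>i. u (r i) a))" for A :: "'n set"
  proof (induction A rule: finite_induct[OF finite])
    case 1
    show ?case by (intro exI[of _ id]) (simp add: strict_mono_def)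
  next
    case (2 a A)
    then obtain r :: "nat \<Rightarrow> nat" where r: "strict_mono r" "\<forall>a\<in>A. mono (\<lambda>i. u (r i) a)" by blast
    obtain s :: "nat \<Rightarrow> nat" where s: "strict_mono s" "mono (\<lambda>i. u (r (s i)) a)"
      by (rule incseq_subsequence_nat)
    have "mono (\<lambda>i. u (r (s i)) b)" if "b \<in> A" for b
      using r(2) that strict_mono_mono[OF s(1)] by (auto simp: mono_def)
    moreover have "strict_mono (\<lambda>i. r (s i))"
      using r s by (auto simp: strict_mono_def)
    ultimately show ?case using s(2) by (intro exI[of _ "\<lambda>i. r (s i)"]) auto
  qed
  from this[of UNIV] obtain r :: "nat \<Rightarrow> nat" where r: "strict_mono r" "\<And>a. mono (\<lambda>i. u (r i) a)" by auto
  have "r 0 < r 1" using r(1) by (simp add: strict_mono_def)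
  moreover have "u (r 0) \<le> u (r 1)"
    using r(2) by (auto simp: mono_def le_fun_def)
  ultimately show ?thesis by (rule that)
qed

text \<open>Division with remainder: subtracting a scalar multiple of an element of \<open>J\<close>
  with the same leading monomial lowers the code, and codes are natural numbers.\<close>

lemma ideal_eq_if_leading_monos:
  fixes J K :: "('n::finite, 'k::field) mpoly set"
  assumes J: "ring_module.subspace J" and K: "ring_module.subspace K" and "J \<subseteq> K"
    and lead: "\<And>q m. q \<in> K \<Longrightarrow> leading_mono q m \<Longrightarrow> \<exists>p\<in>J. leading_mono p m"
  shows "K = J"
proof -
  have "q \<in> J" if "q \<in> K" "leading_mono q m" for q m
    using that
  proof (induction "mono_code m" arbitrary: q m rule: less_induct)
    case less
    obtain p where p: "p \<in> J" "leading_mono p m" using lead less by blast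
    define c where "c = lookup q m / lookup p m"
    define q' where "q' = q - single 0 c * p"
    have q'm: "lookup q' m = 0"
      using p(2) by (simp add: q'_def lookup_minus lookup_const_mult c_def leading_mono_def in_keys_iff)
    have q'K: "q' \<in> K"
      unfolding q'_def using less p \<open>J \<subseteq> K\<close> ring_module.subspace_diff[OF K]
        ring_module.subspace_scale[OF K] by blast
    have "q' \<in> J"
    proof (cases "q' = 0")
      case True
      then show ?thesis using ring_module.subspace_0[OF J] by simp
    next
      case False
      then obtain m' where m': "leading_mono q' m'" by (rule leading_mono_exists)
      have "m' \<noteq> m" using m' q'm by (auto simp: leading_mono_def in_keys_iff)
      moreover have "m' \<in> keys q \<or> m' \<in> keys p"
        using m' by (auto simp: leading_mono_def in_keys_iff q'_def lookup_minus lookup_const_mult)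
      ultimately have "mono_code m' < mono_code m"
        using p(2) less.prems(2) by (auto simp: leading_mono_def)
      then show ?thesis using less.hyps q'K m' by blast
    qed
    then have "q' + single 0 c * p \<in> J"
      using p(1) J by (intro ring_module.subspace_add ring_module.subspace_scale)
    then show ?case by (simp add: q'_def)
  qed
  then have "q \<in> J" if "q \<in> K" for q
    using that leading_mono_exists[of q] ring_module.subspace_0[OF J] by metis
  then show ?thesis using \<open>J \<subseteq> K\<close> by auto
qed

text \<open>The ascending chain condition. Each step of a strict chain contributes a new leading
  monomial \<open>u i\<close>; by Dickson some \<open>u i\<close> divides a later
  \<open>u j\<close>, and then \<open>u j\<close> is already the leading monomial of a multiple of
  an element found earlier.\<close>

lemma ideals_wf:
  "wf {(K, J :: ('n::finite, 'k::field) mpoly set).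
     ring_module.subspace J \<and> ring_module.subspace K \<and> J \<subset> K}" (is "wf ?R")
  unfolding wf_iff_no_infinite_down_chain
proof
  assume "\<exists>J. \<forall>i. (J (Suc i), J i) \<in> ?R"
  then obtain J where "\<forall>i. (J (Suc i), J i) \<in> ?R" by blast
  then have J: "\<And>i. ring_module.subspace (J i)" "\<And>i. J i \<subset> J (Suc i)" by auto
  have "\<exists>m. (\<exists>q\<in>J (Suc i). leading_mono q m) \<and> (\<forall>p\<in>J i. \<not> leading_mono p m)" for i
    using ideal_eq_if_leading_monos[OF J(1) J(1), of i "Suc i"] J(2)[of i] by blast
  then obtain u where u: "\<And>i. \<exists>q\<in>J (Suc i). leading_mono q (u i)"
      "\<And>i p. p \<in> J i \<Longrightarrow> \<not> leading_mono p (u i)" by metis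
  obtain i j where ij: "i < j" "lookup (u i) \<le> lookup (u j)"
    by (rule dickson[of "\<lambda>i. lookup (u i)"])
  obtain q where q: "q \<in> J (Suc i)" "leading_mono q (u i)" using u by blast
  let ?n = "single (u j - u i) (1::'k)"
  have n: "u j - u i + u i = u j"
    using ij(2) by (intro poly_mapping_eqI) (simp add: lookup_add lookup_minus le_fun_def)
  have lead: "leading_mono ?n (u j - u i)" by (simp add: leading_mono_def)
  have "leading_mono (?n * q) (u j)"
    using lookup_mult_leading[OF lead q(2)] q(2) unfolding n
    by (auto simp: leading_mono_def in_keys_iff)
  moreover have "J (Suc i) \<subseteq> J j"
    using lift_Suc_mono_le[of J "Suc i" j] J(2) ij(1) by (simp add: less_imp_le)
  then have "?n * q \<in> J j"
    using q(1) by (intro ring_module.subspace_scale[OF J(1)]) blast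
  ultimately show False using u(2) by blast
qed

lemma maximal_ideal_in_family:
  fixes \<Q> :: "('n::finite, 'k::field) mpoly set set"
  assumes "\<Q> \<noteq> {}" "\<And>J. J \<in> \<Q> \<Longrightarrow> ring_module.subspace J"
  obtains K where "K \<in> \<Q>" "\<And>J. J \<in> \<Q> \<Longrightarrow> \<not> K \<subset> J"
proof -
  let ?R = "{(K, J :: ('n, 'k) mpoly set). ring_module.subspace J \<and> ring_module.subspace K \<and> J \<subset> K}"
  obtain J where "J \<in> \<Q>" using assms(1) by blast
  then have "\<exists>K\<in>\<Q>. \<forall>J. (J, K) \<in> ?R \<longrightarrow> J \<notin> \<Q>"
    using ideals_wf[unfolded wf_eq_minimal, THEN spec, THEN spec, THEN mp] by simp
  then show ?thesis using that assms(2) by auto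
qed

lemma ideal_finitely_generated:
  fixes J :: "('n::finite, 'k::field) mpoly set"
  assumes "ring_module.subspace J"
  obtains B where "finite B" "B \<subseteq> J" "ring_module.span B = J"
proof -
  let ?Q = "{ring_module.span B | B. finite B \<and> B \<subseteq> J}"
  have "?Q \<noteq> {}" by blast
  then obtain K where K: "K \<in> ?Q" "\<And>K'. K' \<in> ?Q \<Longrightarrow> \<not> K \<subset> K'"
    by (rule maximal_ideal_in_family) auto
  then obtain B where B: "finite B" "B \<subseteq> J" "K = ring_module.span B" by blast
  have "x \<in> ring_module.span B" if "x \<in> J" for x
  proof -
    have "ring_module.span (insert x B) \<in> ?Q" using B that by blast
    then have "\<not> ring_module.span B \<subset> ring_module.span (insert x B)"
      using K(2)[of "ring_module.span (insert x B)"] B(3) by auto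
    moreover have "ring_module.span B \<subseteq> ring_module.span (insert x B)"
      by (intro ring_module.span_mono) auto
    ultimately show ?thesis using ring_module.span_base[of x "insert x B"] by blast
  qed
  then have "ring_module.span B = J" using ring_module.span_minimal[OF B(2) assms] by blast
  then show ?thesis by (rule that[OF B(1,2)])
qed

text \<open>Vectors are functions with pointwise addition, so that \<open>module\<close> applies
  without a carrier; the rank is imposed separately, by vanishing from \<open>n\<close> on.\<close>

definition vscale :: "'a::comm_ring_1 \<Rightarrow> ('b \<Rightarrow> 'a) \<Rightarrow> 'b \<Rightarrow> 'a" where
  "vscale c v = (\<lambda>a. c * v a)"

lemma vscale_apply: "vscale c v a = c * v a"
  by (simp add: vscale_def)

global_interpretation vec_module: module "vscale :: 'a::comm_ring_1 \<Rightarrow> ('b \<Rightarrow> 'a) \<Rightarrow> 'b \<Rightarrow> 'a"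
proof
  fix a b :: 'a and x y :: "'b \<Rightarrow> 'a"
  show "vscale a (x + y) = vscale a x + vscale a y"
    by (rule ext) (simp add: vscale_apply distrib_left)
  show "vscale (a + b) x = vscale a x + vscale b x"
    by (rule ext) (simp add: vscale_apply distrib_right)
  show "vscale a (vscale b x) = vscale (a * b) x"
    by (rule ext) (simp only: vscale_apply mult.assoc)
  show "vscale 1 x = x"
    by (rule ext) (simp add: vscale_apply)
qed

text \<open>Induction on the rank. The last coordinates form an ideal; after subtraction of a
  combination of lifts of its generators the last coordinate is zero, and the induction hypothesis
  covers what remains.\<close>

lemma submodule_finitely_generated:
  fixes M :: "(nat \<Rightarrow> ('n::finite, 'k::field) mpoly) set"
  assumes "vec_module.subspace M" "\<And>v a. v \<in> M \<Longrightarrow> a \<ge> n \<Longrightarrow> v a = 0"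
  shows "\<exists>B. finite B \<and> B \<subseteq> M \<and> vec_module.span B = M"
  using assms
proof (induction n arbitrary: M)
  case 0
  then have "M \<subseteq> {0}" by (auto simp: fun_eq_iff)
  then have "M = {0}" using vec_module.subspace_0[OF 0(1)] by auto
  then show ?case by (intro exI[of _ "{}"]) auto
next
  case (Suc n)
  let ?P = "(\<lambda>v. v n) ` M"
  have "ring_module.subspace ?P"
  proof (rule ring_module.subspaceI)
    show "0 \<in> ?P" using vec_module.subspace_0[OF Suc(2)] by (intro image_eqI[of _ _ 0]) auto
    fix x y c assume "x \<in> ?P"
    then obtain v where v: "v \<in> M" "x = v n" by auto
    show "c * x \<in> ?P"
      using vec_module.subspace_scale[OF Suc(2) v(1), of c] v(2)
      by (intro image_eqI[of _ _ "vscale c v"]) (auto simp: vscale_apply)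
    assume "y \<in> ?P"
    then obtain w where w: "w \<in> M" "y = w n" by auto
    show "x + y \<in> ?P"
      using vec_module.subspace_add[OF Suc(2) v(1) w(1)] v(2) w(2)
      by (intro image_eqI[of _ _ "v + w"]) auto
  qed
  then obtain B where B: "finite B" "B \<subseteq> ?P" "ring_module.span B = ?P"
    by (rule ideal_finitely_generated)
  have "\<forall>p\<in>B. \<exists>v. v \<in> M \<and> v n = p" using B(2) by blast
  then obtain g where g: "\<And>p. p \<in> B \<Longrightarrow> g p \<in> M \<and> g p n = p" by metis
  let ?M = "{v\<in>M. v n = 0}"
  have "vec_module.subspace ?M"
    using vec_module.subspace_0[OF Suc(2)] vec_module.subspace_add[OF Suc(2)]
      vec_module.subspace_scale[OF Suc(2)]
    by (intro vec_module.subspaceI) (auto simp: vscale_apply)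
  moreover have "v a = 0" if "v \<in> ?M" "a \<ge> n" for v a
    using that Suc(3)[of v a] by (cases "a = n") auto
  ultimately obtain B' where B': "finite B'" "B' \<subseteq> ?M" "vec_module.span B' = ?M"
    using Suc.IH[of ?M] by blast
  have lift: "\<exists>w\<in>vec_module.span (g ` B). w n = p" if "p \<in> ring_module.span B" for p
    using that
  proof (induction rule: ring_module.span_induct_alt)
    case base
    then show ?case using vec_module.span_zero[of "g ` B"] by (intro bexI[of _ 0]) auto
  next
    case (step c x y)
    then obtain w where w: "w \<in> vec_module.span (g ` B)" "w n = y" by blast
    have "vscale c (g x) + w \<in> vec_module.span (g ` B)"
      using step w
      by (intro vec_module.span_add[OF vec_module.span_scale[OF vec_module.span_base]]) auto
    moreover have "(vscale c (g x) + w) n = c * x + y"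
      using g[of x] step w by (simp add: vscale_apply)
    ultimately show ?case by blast
  qed
  have sub: "g ` B \<union> B' \<subseteq> M" using g B' by auto
  have "v \<in> vec_module.span (g ` B \<union> B')" if v: "v \<in> M" for v
  proof -
    obtain w where w: "w \<in> vec_module.span (g ` B)" "w n = v n"
      using lift[of "v n"] B(3) v by auto
    have "w \<in> M" using w vec_module.span_minimal[of "g ` B" M] Suc(2) sub by auto
    then have "v - w \<in> vec_module.span B'"
      using v w vec_module.subspace_diff[OF Suc(2)] by (simp add: B'(3))
    then have "(v - w) + w \<in> vec_module.span (g ` B \<union> B')"
      using w vec_module.span_mono[of "g ` B" "g ` B \<union> B'"] vec_module.span_mono[of B' "g ` B \<union> B'"]
      by (intro vec_module.span_add) auto
    then show ?thesis by simp
  qed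
  then have "vec_module.span (g ` B \<union> B') = M"
    using vec_module.span_minimal[OF sub Suc(2)] by blast
  then show ?case using B(1) B'(1) sub by (intro exI[of _ "g ` B \<union> B'"]) auto
qed

subsection \<open>Ideals of the polynomial ring as a ring of \<open>HOL-Algebra\<close>\<close>

lemma ideal_class_ring_iff:
  fixes J :: "'a::comm_ring_1 set"
  shows "ideal J (class_ring :: 'a ring) \<longleftrightarrow> ring_module.subspace J"
proof
  assume "ideal J (class_ring :: 'a ring)"
  then interpret ideal J "class_ring :: 'a ring" .
  show "ring_module.subspace J"
    using zero_closed a_closed I_l_closed by (intro ring_module.subspaceI) auto
next
  assume J: "ring_module.subspace J"
  show "ideal J (class_ring :: 'a ring)"
  proof (rule idealI)
    show "ring (class_ring :: 'a ring)" by (rule class_ring.ring_axioms)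
    show "subgroup J (add_monoid (class_ring :: 'a ring))"
    proof (unfold_locales, goal_cases)
      case (4 x)
      have "inv\<^bsub>add_monoid class_ring\<^esub> x = - x"
        using class_ring_simps(8) unfolding a_inv_def by metis
      then show ?case using 4 ring_module.subspace_neg[OF J] by simp
    qed (use ring_module.subspace_0[OF J] ring_module.subspace_add[OF J] in auto)
  qed (use ring_module.subspace_scale[OF J] subspace_mult_right[OF J] in auto)
qed

lemma genideal_class_ring: "genideal (class_ring :: 'a::comm_ring_1 ring) H = ring_module.span H"
  unfolding genideal_def ideal_class_ring_iff
proof
  show "\<Inter> {I. ring_module.subspace I \<and> H \<subseteq> I} \<subseteq> ring_module.span H"
    using ring_module.span_superset[of H] by (intro Inter_lower) auto
  show "ring_module.span H \<subseteq> \<Inter> {I. ring_module.subspace I \<and> H \<subseteq> I}"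
    using ring_module.span_minimal[of H] by blast
qed

lemma graded_ideal_homogeneous_ideal: "homogeneous_ideal I \<Longrightarrow> graded_ideal I"
  unfolding homogeneous_ideal_def genideal_class_ring using graded_ideal_span by blast

subsection \<open>Graded free modules\<close>

definition free_module :: "nat \<Rightarrow> (nat \<Rightarrow> 'a::zero) set" where
  "free_module n = {v. \<forall>a\<ge>n. v a = 0}"

text \<open>The component of degree \<open>e\<close> in the direct sum of the modules
  \<open>S(-r ! a)\<close>.\<close>

definition shift_comp ::
  "int list \<Rightarrow> int \<Rightarrow> (nat \<Rightarrow> ('n::finite, 'k::comm_ring_1) mpoly) \<Rightarrow> nat \<Rightarrow> ('n, 'k) mpoly" where
  "shift_comp r e v = (\<lambda>a. if a < length r then hom_comp (e - r ! a) (v a) else 0)"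

definition shift_homogeneous ::
  "int list \<Rightarrow> int \<Rightarrow> (nat \<Rightarrow> ('n::finite, 'k::comm_ring_1) mpoly) \<Rightarrow> bool" where
  "shift_homogeneous r e v \<longleftrightarrow>
     v \<in> free_module (length r) \<and> (\<forall>a<length r. homogeneous (e - r ! a) (v a))"

definition mat_app :: "'a::comm_ring_1 mat \<Rightarrow> (nat \<Rightarrow> 'a) \<Rightarrow> nat \<Rightarrow> 'a" where
  "mat_app A v = (\<lambda>a. if a < dim_row A then \<Sum>b<dim_col A. A $$ (a, b) * v b else 0)"

definition homogeneous_mat ::
  "int list \<Rightarrow> int list \<Rightarrow> ('n::finite, 'k::comm_ring_1) mpoly mat \<Rightarrow> bool" where
  "homogeneous_mat r c A \<longleftrightarrow> A \<in> carrier_mat (length r) (length c) \<and>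
     (\<forall>a<length r. \<forall>b<length c. homogeneous (c ! b - r ! a) (A $$ (a, b)))"

lemma sum_fun_apply: "(\<Sum>x\<in>A. f x) a = (\<Sum>x\<in>A. f x a)"
  by (induction A rule: infinite_finite_induct) auto

lemma shift_homogeneous_shift_comp [simp]: "shift_homogeneous r e (shift_comp r e v)"
  by (auto simp: shift_homogeneous_def shift_comp_def free_module_def)

lemma shift_comp_same [simp]: "shift_homogeneous r e v \<Longrightarrow> shift_comp r e v = v"
  by (auto simp: shift_homogeneous_def shift_comp_def free_module_def fun_eq_iff)

lemma shift_comp_add: "shift_comp r e (v + w) = shift_comp r e v + shift_comp r e w"
  by (auto simp: shift_comp_def hom_comp_add fun_eq_iff)

lemma shift_comp_diff: "shift_comp r e (v - w) = shift_comp r e v - shift_comp r e w"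
  by (auto simp: shift_comp_def hom_comp_diff fun_eq_iff)

lemma shift_comp_0 [simp]: "shift_comp r e 0 = 0"
  by (auto simp: shift_comp_def fun_eq_iff)

lemma shift_comp_sum: "shift_comp r e (sum f A) = (\<Sum>a\<in>A. shift_comp r e (f a))"
  by (induction A rule: infinite_finite_induct)
    (simp_all add: shift_comp_add del: plus_fun_apply zero_fun_apply)

lemma shift_comp_vscale:
  assumes "shift_homogeneous r d v"
  shows "shift_comp r e (vscale s v) = vscale (hom_comp (e - d) s) v"
proof
  fix a
  show "shift_comp r e (vscale s v) a = vscale (hom_comp (e - d) s) v a"
  proof (cases "a < length r")
    case True
    then have "homogeneous (d - r ! a) (v a)" using assms by (simp add: shift_homogeneous_def)
    then have "hom_comp (e - r ! a) (v a * s) = v a * hom_comp (e - d) s"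
      using hom_comp_mult[of "d - r ! a" "v a" "e - r ! a" s] by simp
    then show ?thesis using True by (simp add: shift_comp_def vscale_apply mult.commute)
  next
    case False
    then show ?thesis
      using assms by (simp add: shift_comp_def vscale_apply shift_homogeneous_def free_module_def)
  qed
qed

lemma shift_comp_decomposition:
  assumes "v \<in> free_module (length r)"
  obtains E where "finite E" "(\<Sum>e\<in>E. shift_comp r e v) = v"
proof -
  define E where "E = (\<Union>a<length r. (\<lambda>m. int (mono_degree m) + r ! a) ` keys (v a))"
  have fin: "finite E" by (simp add: E_def)
  have "(\<Sum>e\<in>E. shift_comp r e v) a = v a" for a
  proof (cases "a < length r")
    case True
    have "(\<Sum>e\<in>E. shift_comp r e v) a = (\<Sum>e\<in>E. hom_comp (e - r ! a) (v a))"
      using True by (induction E rule: infinite_finite_induct) (auto simp: shift_comp_def)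
    also have "\<dots> = (\<Sum>e\<in>(\<lambda>e. e - r ! a) ` E. hom_comp e (v a))"
      by (subst sum.reindex) (auto simp: inj_on_def)
    also have "\<dots> = v a"
      using True fin by (intro sum_hom_comp) (force simp: E_def)+
    finally show ?thesis .
  next
    case False
    have "(\<Sum>e\<in>E. shift_comp r e v) a = 0"
      using False by (induction E rule: infinite_finite_induct) (auto simp: shift_comp_def)
    then show ?thesis using False assms by (simp add: free_module_def)
  qed
  then show ?thesis using that fin by blast
qed

lemma mat_app_add: "mat_app A (v + w) = mat_app A v + mat_app A w"
  by (auto simp: mat_app_def fun_eq_iff distrib_left sum.distrib)

lemma mat_app_diff: "mat_app A (v - w) = mat_app A v - mat_app A w"
  by (auto simp: mat_app_def fun_eq_iff right_diff_distrib sum_subtractf)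

lemma mat_app_vscale: "mat_app A (vscale s v) = vscale s (mat_app A v)"
  by (rule ext) (simp add: mat_app_def vscale_apply sum_distrib_left ac_simps)

lemma mat_app_0 [simp]: "mat_app A 0 = 0"
  by (auto simp: mat_app_def fun_eq_iff)

lemma mat_app_free [simp]: "A \<in> carrier_mat m n \<Longrightarrow> mat_app A v \<in> free_module m"
  by (auto simp: mat_app_def free_module_def)

lemma mat_app_shift_comp:
  assumes "homogeneous_mat r c A"
  shows "mat_app A (shift_comp c e v) = shift_comp r e (mat_app A v)"
proof
  fix a
  have dim: "dim_row A = length r" "dim_col A = length c"
    using assms by (auto simp: homogeneous_mat_def)
  have "A $$ (a, b) * hom_comp (e - c ! b) (v b) = hom_comp (e - r ! a) (A $$ (a, b) * v b)"
    if "a < length r" "b < length c" for b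
    using hom_comp_mult[of "c ! b - r ! a" "A $$ (a, b)" "e - r ! a" "v b"] assms that
    by (simp add: homogeneous_mat_def)
  then show "mat_app A (shift_comp c e v) a = shift_comp r e (mat_app A v) a"
    by (simp add: mat_app_def shift_comp_def dim hom_comp_sum)
qed

lemma free_module_subspace [simp]: "vec_module.subspace (free_module n)"
  by (rule vec_module.subspaceI) (auto simp: free_module_def vscale_apply)

section \<open>Extending vectors of fixed length by zero to functions\<close>

definition fun_of_vec :: "'a::zero vec \<Rightarrow> nat \<Rightarrow> 'a" where
  "fun_of_vec v = (\<lambda>a. if a < dim_vec v then v $ a else 0)"

lemma fun_of_vec_image: "fun_of_vec ` carrier_vec n = free_module n"
proof -
  have "fun_of_vec (vec n v) = v" if "v \<in> free_module n" for v :: "nat \<Rightarrow> 'a"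
    using that by (auto simp: fun_of_vec_def free_module_def fun_eq_iff)
  then have "v \<in> fun_of_vec ` carrier_vec n" if "v \<in> free_module n" for v :: "nat \<Rightarrow> 'a"
    using that by (metis image_eqI vec_carrier)
  moreover have "fun_of_vec v \<in> free_module n" if "v \<in> carrier_vec n" for v :: "'a vec"
    using that by (auto simp: fun_of_vec_def free_module_def)
  ultimately show ?thesis by blast
qed

lemma fun_of_vec_inj: "fun_of_vec v = fun_of_vec w \<Longrightarrow> dim_vec v = dim_vec w \<Longrightarrow> v = w"
  by (rule eq_vecI) (auto simp: fun_of_vec_def fun_eq_iff split: if_splits)

lemma fun_of_vec_mult:
  assumes "A \<in> carrier_mat m n" "v \<in> carrier_vec n"
  shows "fun_of_vec (A *\<^sub>v v) = mat_app A (fun_of_vec v)"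
  using assms by (auto simp: fun_of_vec_def mat_app_def scalar_prod_def fun_eq_iff atLeast0LessThan
      intro!: sum.cong)

lemma image_eq_iff_fun_of_vec:
  assumes "A \<in> carrier_mat m n" "W \<subseteq> carrier_vec m"
  shows "(\<lambda>v. A *\<^sub>v v) ` carrier_vec n = W \<longleftrightarrow> mat_app A ` free_module n = fun_of_vec ` W"
proof -
  have "inj_on fun_of_vec (carrier_vec m)"
    by (rule inj_onI, rule fun_of_vec_inj) auto
  moreover have "(\<lambda>v. A *\<^sub>v v) ` carrier_vec n \<subseteq> carrier_vec m"
    using assms(1) by auto
  ultimately have "(\<lambda>v. A *\<^sub>v v) ` carrier_vec n = W \<longleftrightarrow>
      fun_of_vec ` (\<lambda>v. A *\<^sub>v v) ` carrier_vec n = fun_of_vec ` W"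
    using assms(2) by (intro inj_on_image_eq_iff[symmetric])
  also have "fun_of_vec ` (\<lambda>v. A *\<^sub>v v) ` carrier_vec n = mat_app A ` fun_of_vec ` carrier_vec n"
    using fun_of_vec_mult[OF assms(1)] by (force simp: image_image)
  finally show ?thesis by (simp only: fun_of_vec_image)
qed

lemma fun_of_vec_mat_kernel:
  assumes "A \<in> carrier_mat m n"
  shows "fun_of_vec ` mat_kernel A = {v \<in> free_module n. mat_app A v = 0}"
proof -
  have "A *\<^sub>v v = 0\<^sub>v m \<longleftrightarrow> mat_app A (fun_of_vec v) = 0" if "v \<in> carrier_vec n" for v
  proof -
    have 0: "fun_of_vec (0\<^sub>v m) = 0" by (auto simp: fun_of_vec_def fun_eq_iff)
    have dim: "dim_vec (A *\<^sub>v v) = dim_vec (0\<^sub>v m :: 'a vec)" using assms by simp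
    show ?thesis
      using fun_of_vec_mult[OF assms that] fun_of_vec_inj[OF _ dim] 0 by metis
  qed
  then have "fun_of_vec ` mat_kernel A = {v \<in> fun_of_vec ` carrier_vec n. mat_app A v = 0}"
    using assms by (auto simp: mat_kernel)
  then show ?thesis by (simp only: fun_of_vec_image)
qed

lemma fun_of_vec_singletons:
  "fun_of_vec ` {w \<in> carrier_vec 1. w $ 0 \<in> I} = {v \<in> free_module 1. v 0 \<in> I}"
proof -
  have "fun_of_vec w 0 = w $ 0" if "w \<in> carrier_vec 1" for w :: "'a vec"
    using that by (simp add: fun_of_vec_def)
  then have "fun_of_vec ` {w \<in> carrier_vec 1. w $ 0 \<in> I} = {v \<in> fun_of_vec ` carrier_vec 1. v 0 \<in> I}"
    by auto
  then show ?thesis by (simp only: fun_of_vec_image)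
qed

subsection \<open>Minimal graded free resolutions\<close>

lemma shift_homogeneous_generators:
  fixes M :: "(nat \<Rightarrow> ('n::finite, 'k::field) mpoly) set"
  assumes sub: "vec_module.subspace M" and free: "M \<subseteq> free_module (length r)"
    and graded: "\<forall>v\<in>M. \<forall>e. shift_comp r e v \<in> M"
  shows "\<exists>B. finite B \<and> B \<subseteq> M \<and> (\<forall>b\<in>B. \<exists>e. shift_homogeneous r e b) \<and> vec_module.span B = M"
proof -
  obtain B where B: "finite B" "B \<subseteq> M" "vec_module.span B = M"
    using submodule_finitely_generated[OF sub, of "length r"] free by (auto simp: free_module_def)
  have "\<forall>b\<in>B. \<exists>E. finite E \<and> (\<Sum>e\<in>E. shift_comp r e b) = b"
    using shift_comp_decomposition B free by (metis subsetD)
  then obtain E where E: "\<And>b. b \<in> B \<Longrightarrow> finite (E b)"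
      "\<And>b. b \<in> B \<Longrightarrow> (\<Sum>e\<in>E b. shift_comp r e b) = b"
    by metis
  let ?B = "\<Union>b\<in>B. (\<lambda>e. shift_comp r e b) ` E b"
  have sub': "?B \<subseteq> M" using B graded by auto
  have "b \<in> vec_module.span ?B" if "b \<in> B" for b
  proof -
    have "(\<Sum>e\<in>E b. shift_comp r e b) \<in> vec_module.span ?B"
      using that by (intro vec_module.span_sum vec_module.span_base) auto
    then show ?thesis using E(2) that by simp
  qed
  then have "M \<subseteq> vec_module.span ?B"
    using B(3) vec_module.span_minimal[of B "vec_module.span ?B"] by auto
  moreover have "vec_module.span ?B \<subseteq> M" using vec_module.span_minimal[OF sub' sub] .
  moreover have "\<forall>b\<in>?B. \<exists>e. shift_homogeneous r e b"
    using shift_homogeneous_shift_comp by blast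
  moreover have "finite ?B" using B(1) E(1) by blast
  ultimately show ?thesis using sub' by (intro exI[of _ ?B]) blast
qed

text \<open>Graded Nakayama lemma: in a homogeneous generating set of least cardinality, a relation
  with a coefficient outside the ideal of the variables would make a generator redundant.\<close>

lemma minimal_shift_homogeneous_generators:
  fixes M :: "(nat \<Rightarrow> ('n::finite, 'k::field) mpoly) set"
  assumes sub: "vec_module.subspace M" and free: "M \<subseteq> free_module (length r)"
    and graded: "\<forall>v\<in>M. \<forall>e. shift_comp r e v \<in> M"
  shows "\<exists>B deg. finite B \<and> B \<subseteq> M \<and> (\<forall>b\<in>B. shift_homogeneous r (deg b) b) \<and>
    vec_module.span B = M \<and>
    (\<forall>u. (\<Sum>b\<in>B. vscale (u b) b) = 0 \<longrightarrow> (\<forall>b\<in>B. u b \<in> variable_span))"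
proof -
  let ?P = "\<lambda>B. finite B \<and> B \<subseteq> M \<and> (\<forall>b\<in>B. \<exists>e. shift_homogeneous r e b) \<and> vec_module.span B = M"
  obtain B0 where "?P B0" using shift_homogeneous_generators[OF assms] by blast
  then obtain B where B: "?P B" "\<And>B'. ?P B' \<Longrightarrow> card B \<le> card B'"
    using ex_has_least_nat[of ?P B0 card] by metis
  obtain deg where deg: "\<And>b. b \<in> B \<Longrightarrow> shift_homogeneous r (deg b) b" using B(1) by metis
  have "u x \<in> variable_span" if u: "(\<Sum>b\<in>B. vscale (u b) b) = 0" and x: "x \<in> B" for u x
  proof (rule ccontr)
    assume "u x \<notin> variable_span"
    define k where "k = lookup (u x) 0"
    have k: "k \<noteq> 0" using \<open>u x \<notin> _\<close> by (simp add: irrelevant_iff k_def)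
    \<comment> \<open>These are the coefficients of the component of the relation in degree
      \<open>deg x\<close>. The one at \<open>x\<close> has degree 0 and so is the nonzero constant
      \<open>k\<close>.\<close>
    define u' where "u' b = hom_comp (deg x - deg b) (u b)" for b
    have ux: "u' x = single 0 k"
      by (rule poly_mapping_eqI)
        (auto simp: u'_def k_def lookup_hom_comp lookup_single when_def mono_degree_eq_0_iff)
    have "(\<Sum>b\<in>B. vscale (u' b) b) = shift_comp r (deg x) (\<Sum>b\<in>B. vscale (u b) b)"
      unfolding shift_comp_sum u'_def
      by (rule sum.cong) (simp_all add: shift_comp_vscale[OF deg])
    then have "vscale (u' x) x + (\<Sum>b\<in>B - {x}. vscale (u' b) b) = 0"
      using u x B(1) by (simp add: sum.remove)
    then have "vscale (u' x) x = - (\<Sum>b\<in>B - {x}. vscale (u' b) b)"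
      by (simp add: eq_neg_iff_add_eq_0)
    moreover have "(\<Sum>b\<in>B - {x}. vscale (u' b) b) \<in> vec_module.span (B - {x})"
      by (intro vec_module.span_sum vec_module.span_scale vec_module.span_base) auto
    ultimately have "vscale (u' x) x \<in> vec_module.span (B - {x})"
      by (simp add: vec_module.span_neg)
    then have "vscale (single 0 (inverse k)) (vscale (u' x) x) \<in> vec_module.span (B - {x})"
      by (rule vec_module.span_scale)
    moreover have "vscale (single 0 (inverse k)) (vscale (u' x) x) = x"
      using k by (simp add: ux mult_single)
    ultimately have "x \<in> vec_module.span (B - {x})" by simp
    then have "B \<subseteq> vec_module.span (B - {x})"
      using vec_module.span_superset[of "B - {x}"] by blast
    then have "vec_module.span B \<subseteq> vec_module.span (B - {x})"
      by (intro vec_module.span_minimal) auto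
    then have "vec_module.span (B - {x}) = M"
      using B(1) vec_module.span_mono[of "B - {x}" B] by auto
    then have "card B \<le> card (B - {x})" using B(1) by (intro B(2)) auto
    then show False using x B(1) by (meson card_Diff1_less not_le)
  qed
  then show ?thesis using B(1) deg by (intro exI[of _ B] exI[of _ deg]) blast
qed

text \<open>The members of a minimal generating set become the columns of \<open>A\<close>.
  Minimality is recorded as a property of the kernel because the next differential maps onto this
  kernel, so that its entries lie in the ideal of the variables.\<close>

lemma minimal_presentation:
  fixes M :: "(nat \<Rightarrow> ('n::finite, 'k::field) mpoly) set"
  assumes "vec_module.subspace M" "M \<subseteq> free_module (length r)"
    and "\<forall>v\<in>M. \<forall>e. shift_comp r e v \<in> M"
  shows "\<exists>c A. homogeneous_mat r c A \<and> mat_app A ` free_module (length c) = M \<and>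
    (\<forall>v\<in>free_module (length c). mat_app A v = 0 \<longrightarrow> (\<forall>b. v b \<in> variable_span))"
proof -
  obtain B deg where "finite B \<and> B \<subseteq> M \<and> (\<forall>b\<in>B. shift_homogeneous r (deg b) b) \<and>
      vec_module.span B = M \<and>
      (\<forall>u. (\<Sum>b\<in>B. vscale (u b) b) = 0 \<longrightarrow> (\<forall>b\<in>B. u b \<in> variable_span))"
    using minimal_shift_homogeneous_generators[OF assms] by (elim exE) (rule that)
  then have B: "finite B" "B \<subseteq> M" "\<And>b. b \<in> B \<Longrightarrow> shift_homogeneous r (deg b) b"
    "vec_module.span B = M"
    "\<And>u b. (\<Sum>b\<in>B. vscale (u b) b) = 0 \<Longrightarrow> b \<in> B \<Longrightarrow> u b \<in> variable_span"
    by (simp_all del: vec_module.span_eq_iff)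
  obtain bs where bs: "set bs = B" "distinct bs"
    using finite_distinct_list[OF B(1)] by blast
  define c where "c = map deg bs"
  define A where "A = mat (length r) (length bs) (\<lambda>(a, b). (bs ! b) a)"
  have A: "homogeneous_mat r c A"
    using B(3) bs(1) unfolding homogeneous_mat_def A_def c_def
    by (auto simp: shift_homogeneous_def)
  have bij: "bij_betw ((!) bs) {..<length bs} B"
    using bs by (metis bij_betw_nth)
  have app: "mat_app A v = (\<Sum>b<length bs. vscale (v b) (bs ! b))" for v
  proof
    fix a
    have "(\<Sum>b<length bs. vscale (v b) (bs ! b)) a = (\<Sum>b<length bs. v b * (bs ! b) a)"
      by (simp add: sum_fun_apply vscale_apply)
    moreover have "(bs ! b) a = 0" if "b < length bs" "\<not> a < length r" for b
    proof -
      have "bs ! b \<in> M" using that(1) B(2) bs(1) nth_mem by blast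
      then show ?thesis using that(2) assms(2) by (auto simp: free_module_def)
    qed
    ultimately show "mat_app A v a = (\<Sum>b<length bs. vscale (v b) (bs ! b)) a"
      by (simp add: mat_app_def A_def mult.commute)
  qed
  define idx where "idx = inv_into {..<length bs} ((!) bs)"
  have idx: "idx (bs ! b) = b" if "b < length bs" for b
    unfolding idx_def using bij that by (auto simp: bij_betw_def intro: inv_into_f_f)
  have reindex: "(\<Sum>b\<in>B. vscale (u b) b) = (\<Sum>b<length bs. vscale (u (bs ! b)) (bs ! b))" for u
    by (rule sum.reindex_bij_betw[OF bij, symmetric])
  have app': "mat_app A v = (\<Sum>b\<in>B. vscale (v (idx b)) b)" for v
    unfolding app reindex by (rule sum.cong) (simp_all add: idx)
  have "mat_app A ` free_module (length c) = M"
  proof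
    show "mat_app A ` free_module (length c) \<subseteq> M"
    proof (rule image_subsetI)
      fix v show "mat_app A v \<in> M"
        unfolding app' using B(2)
        by (intro vec_module.subspace_sum[OF assms(1)] vec_module.subspace_scale[OF assms(1)]) auto
    qed
    show "M \<subseteq> mat_app A ` free_module (length c)"
    proof
      fix x assume "x \<in> M"
      then obtain u where u: "x = (\<Sum>b\<in>B. vscale (u b) b)"
        using B(4) vec_module.span_finite[OF B(1)] by auto
      let ?v = "\<lambda>b. if b < length bs then u (bs ! b) else 0"
      have "x = mat_app A ?v" unfolding app u reindex by (rule sum.cong) auto
      moreover have "?v \<in> free_module (length c)" by (simp add: free_module_def c_def)
      ultimately show "x \<in> mat_app A ` free_module (length c)" by blast
    qed
  qed
  moreover have "v b \<in> variable_span"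
    if "v \<in> free_module (length c)" "mat_app A v = 0" for v b
  proof (cases "b < length bs")
    case True
    then have "v (idx (bs ! b)) \<in> variable_span"
      using that(2) bs(1) by (intro B(5)[of "\<lambda>b. v (idx b)"]) (auto simp: app')
    then show ?thesis using True by (simp add: idx)
  next
    case False
    then have "v b = 0" using that(1) by (simp add: free_module_def c_def)
    then show ?thesis by (simp add: ring_module.span_zero)
  qed
  ultimately show ?thesis using A by blast
qed

lemma mat_app_kernel_graded:
  assumes "homogeneous_mat r c A"
  shows "vec_module.subspace {v \<in> free_module (length c). mat_app A v = 0}"
    and "\<forall>v\<in>{v \<in> free_module (length c). mat_app A v = 0}. \<forall>e.
      shift_comp c e v \<in> {v \<in> free_module (length c). mat_app A v = 0}"
proof -
  show "vec_module.subspace {v \<in> free_module (length c). mat_app A v = 0}"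
    using vec_module.subspace_add[OF free_module_subspace]
      vec_module.subspace_scale[OF free_module_subspace]
    by (intro vec_module.subspaceI)
      (auto simp: mat_app_add mat_app_vscale vec_module.subspace_0)
  show "\<forall>v\<in>{v \<in> free_module (length c). mat_app A v = 0}. \<forall>e.
      shift_comp c e v \<in> {v \<in> free_module (length c). mat_app A v = 0}"
    using mat_app_shift_comp[OF assms] shift_homogeneous_shift_comp[of c]
    by (auto simp: shift_homogeneous_def)
qed

lemma column_in_image:
  assumes "A \<in> carrier_mat m n" "b < n"
  shows "(\<lambda>a. if a < m then A $$ (a, b) else 0) \<in> mat_app A ` free_module n"
proof
  let ?v = "(\<lambda>a. if a = b then 1 else 0)"
  show "(\<lambda>a. if a < m then A $$ (a, b) else 0) = mat_app A ?v"
    using assms by (auto simp: mat_app_def fun_eq_iff if_distrib cong: if_cong)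
  show "?v \<in> free_module n" using assms by (auto simp: free_module_def)
qed

text \<open>This gives the choice in \<open>resolution_shifts\<close> its meaning. Triples of row
  shifts, column shifts and matrix are chosen successively, each presenting the kernel of the one
  before; the kernel clause of \<open>?good\<close> yields minimality one step later.\<close>

lemma minimal_graded_free_resolution_exists:
  fixes I :: "('n::finite, 'k::field) mpoly set"
  assumes "graded_ideal I"
  shows "\<exists>d A. minimal_graded_free_resolution I d A"
proof -
  let ?irr = "variable_span :: ('n, 'k) mpoly set"
  let ?good = "\<lambda>(r, c, A :: ('n, 'k) mpoly mat). homogeneous_mat r c A \<and>
      (\<forall>v\<in>free_module (length c). mat_app A v = 0 \<longrightarrow> (\<forall>b. v b \<in> ?irr))"
  let ?I = "{v \<in> free_module 1. v 0 \<in> I}"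
  let ?P = "\<lambda>i (r, c, A). ?good (r, c, A) \<and> (i = (0::nat) \<longrightarrow> r = [0] \<and> mat_app A ` free_module (length c) = ?I)"
  let ?Q = "\<lambda>(i::nat) (r, c, A) (r', c', A'). r' = c \<and>
      mat_app A' ` free_module (length c') = {v \<in> free_module (length c). mat_app A v = 0}"
  have "\<exists>f. \<forall>i. ?P i (f i) \<and> ?Q i (f i) (f (Suc i))"
  proof (rule dependent_nat_choice)
    have sub: "vec_module.subspace ?I"
      using graded_idealD(1)[OF assms]
      by (intro vec_module.subspaceI)
        (auto simp: free_module_def vscale_apply ring_module.subspace_0 ring_module.subspace_add
          ring_module.subspace_scale)
    have "?I \<subseteq> free_module (length [0::int])" by auto
    moreover have "\<forall>v\<in>?I. \<forall>e. shift_comp [0] e v \<in> ?I"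
      using graded_idealD(2)[OF assms] by (auto simp: shift_comp_def free_module_def)
    ultimately obtain c A where "homogeneous_mat [0] c A \<and> mat_app A ` free_module (length c) = ?I \<and>
      (\<forall>v\<in>free_module (length c). mat_app A v = 0 \<longrightarrow> (\<forall>b. v b \<in> ?irr))"
      using minimal_presentation[OF sub, of "[0]"] by blast
    then show "\<exists>x. ?P 0 x" by (intro exI[of _ "([0], c, A)"]) auto
  next
    fix x i assume x: "?P i x"
    obtain r c A where [simp]: "x = (r, c, A)" by (cases x)
    have A: "homogeneous_mat r c A" using x by simp
    have sub: "{v \<in> free_module (length c). mat_app A v = 0} \<subseteq> free_module (length c)" by auto
    obtain c' A' where "homogeneous_mat c c' A' \<and>
      mat_app A' ` free_module (length c') = {v \<in> free_module (length c). mat_app A v = 0} \<and>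
      (\<forall>v\<in>free_module (length c'). mat_app A' v = 0 \<longrightarrow> (\<forall>b. v b \<in> ?irr))"
      using minimal_presentation[OF mat_app_kernel_graded(1)[OF A] sub mat_app_kernel_graded(2)[OF A]]
      by blast
    then show "\<exists>y. ?P (Suc i) y \<and> ?Q i x y" by (intro exI[of _ "(c, c', A')"]) auto
  qed
  then obtain f where f0: "\<forall>i. ?P i (f i) \<and> ?Q i (f i) (f (Suc i))" by (elim exE) (rule that)
  have f: "?P i (f i)" "?Q i (f i) (f (Suc i))" for i
    using spec[OF f0, of i] by (rule conjunct1, rule conjunct2)
  define r where "r i = fst (f i)" for i
  define d where "d i = fst (snd (f i))" for i
  define A where "A i = snd (snd (f i))" for i
  have fi: "f i = (r i, d i, A i)" for i by (simp add: r_def d_def A_def)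
  have r0: "r 0 = [0]" and rS: "r (Suc i) = d i" for i
    using f(1)[of 0] f(2)[of i] by (simp_all add: fi)
  have hom: "homogeneous_mat (r i) (d i) (A i)"
    and irr: "v \<in> free_module (length (d i)) \<Longrightarrow> mat_app (A i) v = 0 \<Longrightarrow> v b \<in> ?irr" for i v b
    using f(1)[of i] by (simp_all add: fi)
  have im0: "mat_app (A 0) ` free_module (length (d 0)) = ?I"
    using f(1)[of 0] by (simp add: fi)
  have imS: "mat_app (A (Suc i)) ` free_module (length (d (Suc i))) =
      {v \<in> free_module (length (d i)). mat_app (A i) v = 0}" for i
    using f(2)[of i] by (simp add: fi)
  have car: "A i \<in> carrier_mat (length (r i)) (length (d i))" for i
    using hom by (simp add: homogeneous_mat_def)
  have "minimal_graded_free_resolution I d A"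
    unfolding minimal_graded_free_resolution_def
  proof (intro conjI allI impI)
    show "A 0 \<in> carrier_mat 1 (length (d 0))" using car[of 0] r0 by simp
    show "A (Suc i) \<in> carrier_mat (length (d i)) (length (d (Suc i)))" for i
      using car[of "Suc i"] by (simp add: rS)
    show "homogeneous (d 0 ! b) (A 0 $$ (0, b))" if "b < length (d 0)" for b
      using hom[of 0, unfolded r0 homogeneous_mat_def, THEN conjunct2, rule_format, of 0 b] that
      by simp
    show "homogeneous (d (Suc i) ! b - d i ! a) (A (Suc i) $$ (a, b))"
      if "a < length (d i)" "b < length (d (Suc i))" for i a b
      using hom[of "Suc i"] that by (auto simp: homogeneous_mat_def rS)
    show "(\<lambda>v. A 0 *\<^sub>v v) ` carrier_vec (length (d 0)) = {w \<in> carrier_vec 1. w $ 0 \<in> I}"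
    proof (subst image_eq_iff_fun_of_vec[of _ 1])
      show "A 0 \<in> carrier_mat 1 (length (d 0))" using car[of 0] r0 by simp
      show "mat_app (A 0) ` free_module (length (d 0)) = fun_of_vec ` {w \<in> carrier_vec 1. w $ 0 \<in> I}"
        unfolding fun_of_vec_singletons by (rule im0)
    qed blast
    show "(\<lambda>v. A (Suc i) *\<^sub>v v) ` carrier_vec (length (d (Suc i))) = mat_kernel (A i)" for i
      using car[of "Suc i"] car[of i] imS[of i] mat_kernel_carrier[OF car[of i]]
      by (subst image_eq_iff_fun_of_vec[of _ "length (d i)"]) (auto simp: rS fun_of_vec_mat_kernel)
    show "A (Suc i) $$ (a, b) \<in> irrelevant_ideal"
      if "a < length (d i)" "b < length (d (Suc i))" for i a b
    proof -
      have "A (Suc i) \<in> carrier_mat (length (d i)) (length (d (Suc i)))"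
        using car[of "Suc i"] by (simp add: rS)
      from column_in_image[OF this that(2)] show ?thesis
        using irr[of _ i a] that(1) unfolding imS irrelevant_ideal_def genideal_class_ring by force
    qed
  qed
  then show ?thesis by blast
qed

subsection \<open>Reducing a resolution modulo linear forms\<close>

lemma span_insert_span:
  "ring_module.span (insert x (ring_module.span H)) = ring_module.span (insert x (H :: 'a::comm_ring_1 set))"
  unfolding ring_module.span_eq
  using ring_module.span_base[of x "insert x H"] ring_module.span_mono[of H "insert x H"]
    ring_module.span_superset[of "insert x (ring_module.span H)"] ring_module.span_superset[of H]
  by auto

text \<open>A locale of its own, because the assumptions of the next one mention
  \<open>J\<close>.\<close>

locale linear_sequence =
  fixes l :: "nat \<Rightarrow> ('n::finite, 'k::field) mpoly" and N :: nat
  assumes linear: "j < N \<Longrightarrow> homogeneous 1 (l j)"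
begin

definition J :: "nat \<Rightarrow> ('n, 'k) mpoly set" where
  "J j = ring_module.span (l ` {..<j})"

lemma J_subspace [simp]: "ring_module.subspace (J j)"
  by (simp add: J_def)

lemma J_graded: "j \<le> N \<Longrightarrow> graded_ideal (J j)"
  unfolding J_def using linear by (intro graded_ideal_span) (auto intro!: exI[of _ 1])

lemma J_Suc: "J (Suc j) = ring_module.span (insert (l j) (J j))"
  by (simp add: J_def lessThan_Suc span_insert_span)

end

text \<open>A resolution of \<open>S/I\<close>: the ring itself stands at place 0, so place
  \<open>Suc i\<close> belongs to the \<open>i\<close>-th module of the resolution of
  \<open>I\<close>. Minimality starts with \<open>A 1\<close>, as the entries of \<open>A 0\<close>
  generate \<open>I\<close> and may be units. The last two assumptions make the linear forms a
  regular sequence that generates the ideal of the variables.\<close>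

locale reduced_resolution = linear_sequence l N
  for l :: "nat \<Rightarrow> ('n::finite, 'k::field) mpoly" and N :: nat +
  fixes I :: "('n, 'k) mpoly set" and G :: "nat \<Rightarrow> int list" and A :: "nat \<Rightarrow> ('n, 'k) mpoly mat"
  assumes graded: "graded_ideal I"
    and hom_mat: "homogeneous_mat (G i) (G (Suc i)) (A i)"
    and G_0: "G 0 = [0]"
    and image_0: "mat_app (A 0) ` free_module (length (G 1)) = {v \<in> free_module 1. v 0 \<in> I}"
    and exact: "mat_app (A (Suc i)) ` free_module (length (G (Suc (Suc i)))) =
      {v \<in> free_module (length (G (Suc i))). mat_app (A i) v = 0}"
    and minimal: "a < length (G (Suc i)) \<Longrightarrow> b < length (G (Suc (Suc i))) \<Longrightarrow>
      A (Suc i) $$ (a, b) \<in> variable_span"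
    and regular: "j < N \<Longrightarrow> l j * x \<in> J j \<Longrightarrow> x \<in> J j"
    and J_N: "J N = variable_span"
begin

abbreviation D :: "nat \<Rightarrow> (nat \<Rightarrow> ('n, 'k) mpoly) \<Rightarrow> nat \<Rightarrow> ('n, 'k) mpoly" where
  "D i \<equiv> mat_app (A i)"

abbreviation F :: "nat \<Rightarrow> int \<Rightarrow> (nat \<Rightarrow> ('n, 'k) mpoly) set" where
  "F i e \<equiv> {v. shift_homogeneous (G i) e v}"

definition JF :: "nat \<Rightarrow> nat \<Rightarrow> (nat \<Rightarrow> ('n, 'k) mpoly) set" where
  "JF j i = {v \<in> free_module (length (G i)). \<forall>a. v a \<in> J j}"

text \<open>Vanishing, in degree \<open>e\<close>, of the homology at \<open>F (Suc i)\<close> of the resolution modulo the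
  first \<open>j\<close> linear forms.\<close>

definition exact_mod :: "nat \<Rightarrow> nat \<Rightarrow> int \<Rightarrow> bool" where
  "exact_mod i j e \<longleftrightarrow> (\<forall>z\<in>F (Suc i) e. D i z \<in> JF j i \<longrightarrow>
     (\<exists>w\<in>F (Suc (Suc i)) e. z - D (Suc i) w \<in> JF j (Suc i)))"

text \<open>Injectivity, from degree \<open>e\<close> to \<open>e + 1\<close>, of the \<open>j\<close>-th linear form on the cokernel of
  \<open>D i\<close> modulo the preceding linear forms.\<close>

definition inj_mod :: "nat \<Rightarrow> nat \<Rightarrow> int \<Rightarrow> bool" where
  "inj_mod i j e \<longleftrightarrow> (\<forall>u\<in>F i e. (\<exists>w\<in>F (Suc i) (e + 1). vscale (l j) u - D i w \<in> JF j i) \<longrightarrow>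
     (\<exists>w\<in>F (Suc i) e. u - D i w \<in> JF j i))"

section \<open>Graded pieces of the free modules and their reductions\<close>

lemma F_free: "v \<in> F i e \<Longrightarrow> v \<in> free_module (length (G i))"
  by (simp add: shift_homogeneous_def)

lemma F_diff: "v \<in> F i e \<Longrightarrow> w \<in> F i e \<Longrightarrow> v - w \<in> F i e"
  using shift_comp_diff[of "G i" e v w] shift_homogeneous_shift_comp[of "G i" e "v - w"] by simp

lemma F_vscale:
  assumes "j < N" "v \<in> F i e"
  shows "vscale (l j) v \<in> F i (e + 1)"
proof -
  have "shift_comp (G i) (e + 1) (vscale (l j) v) = vscale (l j) v"
    using assms linear[OF assms(1)] by (simp add: shift_comp_vscale[of _ e])
  then show ?thesis using shift_homogeneous_shift_comp[of "G i" "e + 1" "vscale (l j) v"] by simp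
qed

lemma F_D: "v \<in> F (Suc i) e \<Longrightarrow> D i v \<in> F i e"
  using mat_app_shift_comp[OF hom_mat, of i e v] shift_homogeneous_shift_comp[of "G i" e "D i v"]
  by simp

lemma D_D: "w \<in> free_module (length (G (Suc (Suc i)))) \<Longrightarrow> D i (D (Suc i) w) = 0"
  using exact[of i] by blast

lemma JF_subspace: "vec_module.subspace (JF j i)"
proof (rule vec_module.subspaceI)
  show "0 \<in> JF j i"
    using vec_module.subspace_0[OF free_module_subspace] ring_module.subspace_0[OF J_subspace]
    by (simp add: JF_def)
  show "x + y \<in> JF j i" if "x \<in> JF j i" "y \<in> JF j i" for x y
    using that ring_module.subspace_add[OF J_subspace, of "x a" j "y a" for a]
      vec_module.subspace_add[OF free_module_subspace[of "length (G i)"], of x y]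
    unfolding JF_def by auto
  show "vscale c x \<in> JF j i" if "x \<in> JF j i" for c x
    using that ring_module.subspace_scale[OF J_subspace, of "x a" j c for a]
      vec_module.subspace_scale[OF free_module_subspace[of "length (G i)"], of x c]
    unfolding JF_def by (auto simp: vscale_apply)
qed

lemmas JF_add = vec_module.subspace_add[OF JF_subspace]
  and JF_diff = vec_module.subspace_diff[OF JF_subspace]
  and JF_scale = vec_module.subspace_scale[OF JF_subspace]
  and JF_neg = vec_module.subspace_neg[OF JF_subspace]

lemma JF_diff_commute: "v - w \<in> JF j i \<Longrightarrow> w - v \<in> JF j i"
  using JF_neg[of "v - w"] by simp

lemma JF_mono: "v \<in> JF j i \<Longrightarrow> v \<in> JF (Suc j) i"
  using ring_module.span_superset[of "insert (l j) (J j)"] unfolding JF_def J_Suc by blast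

lemma mat_car: "A i \<in> carrier_mat (length (G i)) (length (G (Suc i)))"
  using hom_mat by (simp add: homogeneous_mat_def)

lemma D_JF: "v \<in> JF j (Suc i) \<Longrightarrow> D i v \<in> JF j i"
  unfolding JF_def using mat_app_free[OF mat_car, of i v]
  by (auto simp: mat_app_def intro!: ring_module.subspace_sum ring_module.subspace_scale
      intro: ring_module.subspace_0)

lemma vscale_l_JF:
  assumes "v \<in> free_module (length (G i))"
  shows "vscale (l j) v \<in> JF (Suc j) i"
proof -
  have "l j \<in> J (Suc j)" unfolding J_def by (intro ring_module.span_base) auto
  then have "vscale (l j) v a \<in> J (Suc j)" for a
    unfolding vscale_apply by (rule subspace_mult_right[OF J_subspace])
  then show ?thesis
    using vec_module.subspace_scale[OF free_module_subspace assms] by (simp add: JF_def)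
qed

lemma JF_regular:
  "j < N \<Longrightarrow> u \<in> free_module (length (G i)) \<Longrightarrow> vscale (l j) u \<in> JF j i \<Longrightarrow> u \<in> JF j i"
  using regular by (auto simp: JF_def vscale_apply)

lemma JF_Suc_decompose:
  assumes "j < N" "v \<in> JF (Suc j) i" "v \<in> F i e"
  obtains u where "u \<in> F i (e - 1)" "v - vscale (l j) u \<in> JF j i"
proof -
  have "\<exists>x. homogeneous (e - 1 - G i ! a) x \<and> v a - l j * x \<in> J j" if "a < length (G i)" for a
  proof -
    have hom: "homogeneous (e - G i ! a) (v a)" using assms(3) that by (simp add: shift_homogeneous_def)
    have "v a \<in> ring_module.span (insert (l j) (J j))" using assms(2) by (simp add: JF_def J_Suc)
    then obtain x where "homogeneous (e - G i ! a - 1) x" "v a - x * l j \<in> J j"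
      using homogeneous_span_insert[OF J_graded[OF less_imp_le[OF assms(1)]] linear[OF assms(1)] hom]
      by blast
    then show ?thesis by (intro exI[of _ x]) (auto simp: mult.commute algebra_simps)
  qed
  then obtain f where f: "\<And>a. a < length (G i) \<Longrightarrow> homogeneous (e - 1 - G i ! a) (f a)"
      "\<And>a. a < length (G i) \<Longrightarrow> v a - l j * f a \<in> J j" by metis
  let ?u = "\<lambda>a. if a < length (G i) then f a else 0"
  have u: "?u \<in> F i (e - 1)" using f(1) by (auto simp: shift_homogeneous_def free_module_def)
  have vfree: "v \<in> free_module (length (G i))" using assms(2) by (simp add: JF_def)
  have "(v - vscale (l j) ?u) a \<in> J j" for a
    using f(2)[of a] vfree ring_module.subspace_0[OF J_subspace]
    by (cases "a < length (G i)") (auto simp: vscale_apply free_module_def)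
  moreover have "v - vscale (l j) ?u \<in> free_module (length (G i))"
    using vfree F_free[OF u] vec_module.subspace_diff[OF free_module_subspace]
      vec_module.subspace_scale[OF free_module_subspace] by blast
  ultimately have "v - vscale (l j) ?u \<in> JF j i" by (simp add: JF_def)
  then show ?thesis by (rule that[OF u])
qed

text \<open>A stretch of the long exact sequence of multiplication by \<open>l j\<close>: the
  homology modulo \<open>J (Suc j)\<close> at place \<open>Suc i\<close> in degree \<open>e\<close>
  lies between the homology modulo \<open>J j\<close> at the same place and degree and the kernel of
  \<open>l j\<close> at place \<open>i\<close> in degree \<open>e - 1\<close>. Both outer terms
  vanish by assumption.\<close>

lemma exact_mod_Suc:
  assumes j: "j < N" and T: "inj_mod i j (e - 1)" and Z: "exact_mod i j e"
  shows "exact_mod i (Suc j) e"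
  unfolding exact_mod_def
proof (intro ballI impI)
  fix z assume z: "z \<in> F (Suc i) e" "D i z \<in> JF (Suc j) i"
  obtain u where u: "u \<in> F i (e - 1)" "D i z - vscale (l j) u \<in> JF j i"
    using JF_Suc_decompose[OF j z(2) F_D[OF z(1)]] by blast
  have "\<exists>w\<in>F (Suc i) (e - 1 + 1). vscale (l j) u - D i w \<in> JF j i"
    using z(1) JF_diff_commute[OF u(2)] by (intro bexI[of _ z]) auto
  then obtain w where w: "w \<in> F (Suc i) (e - 1)" "u - D i w \<in> JF j i"
    using T u(1) unfolding inj_mod_def by blast
  \<comment> \<open>Subtracting \<open>l j\<close> times \<open>w\<close> cancels the multiple of
    \<open>l j\<close> in \<open>D i z\<close>, so that \<open>?z\<close> is a cycle already modulo
    \<open>J j\<close>.\<close>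
  let ?z = "z - vscale (l j) w"
  have lw: "vscale (l j) w \<in> F (Suc i) e" using F_vscale[OF j w(1)] by simp
  have "D i ?z = (D i z - vscale (l j) u) + vscale (l j) (u - D i w)"
    by (simp add: mat_app_diff mat_app_vscale vec_module.scale_right_diff_distrib)
  also have "\<dots> \<in> JF j i" using u(2) w(2) by (intro JF_add JF_scale)
  finally obtain w' where w': "w' \<in> F (Suc (Suc i)) e" "?z - D (Suc i) w' \<in> JF j (Suc i)"
    using Z F_diff[OF z(1) lw] unfolding exact_mod_def by blast
  have "(?z - D (Suc i) w') + vscale (l j) w \<in> JF (Suc j) (Suc i)"
    using w'(2) F_free[OF w(1)] by (intro JF_add JF_mono vscale_l_JF)
  moreover have "(?z - D (Suc i) w') + vscale (l j) w = z - D (Suc i) w'" by (simp add: algebra_simps)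
  ultimately show "\<exists>w\<in>F (Suc (Suc i)) e. z - D (Suc i) w \<in> JF (Suc j) (Suc i)"
    using w'(1) by auto
qed

text \<open>If \<open>l j\<close> times \<open>u\<close> is a boundary, then \<open>l j\<close>
  kills \<open>D i u\<close>; regularity makes \<open>u\<close> a cycle, and exactness makes it a
  boundary. Hence injectivity has to be assumed only at place 0.\<close>

lemma inj_mod_Suc_if_exact_mod:
  assumes j: "j < N" and Z: "exact_mod i j e"
  shows "inj_mod (Suc i) j e"
  unfolding inj_mod_def
proof (intro ballI impI)
  fix u assume u: "u \<in> F (Suc i) e"
    and "\<exists>w\<in>F (Suc (Suc i)) (e + 1). vscale (l j) u - D (Suc i) w \<in> JF j (Suc i)"
  then obtain w where w: "w \<in> F (Suc (Suc i)) (e + 1)" "vscale (l j) u - D (Suc i) w \<in> JF j (Suc i)"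
    by blast
  have "D i (vscale (l j) u - D (Suc i) w) \<in> JF j i" by (rule D_JF[OF w(2)])
  then have "vscale (l j) (D i u) \<in> JF j i"
    using D_D[OF F_free[OF w(1)]] by (simp only: mat_app_diff mat_app_vscale diff_0_right)
  then have "D i u \<in> JF j i" by (rule JF_regular[OF j F_free[OF F_D[OF u]]])
  then show "\<exists>w\<in>F (Suc (Suc i)) e. u - D (Suc i) w \<in> JF j (Suc i)"
    using Z u unfolding exact_mod_def by blast
qed

text \<open>The connecting homomorphism: the kernel of \<open>l j\<close> on the cokernel of
  \<open>D i\<close> in degree \<open>e\<close> comes from the homology modulo
  \<open>J (Suc j)\<close> at place \<open>Suc i\<close> in degree \<open>e + 1\<close>. For
  \<open>i = 0\<close> this produces the injectivity that is finally wanted.\<close>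

lemma inj_mod_if_exact_mod_Suc:
  assumes j: "j < N" and Z: "exact_mod i (Suc j) (e + 1)"
  shows "inj_mod i j e"
  unfolding inj_mod_def
proof (intro ballI impI)
  fix u assume u: "u \<in> F i e" and "\<exists>w\<in>F (Suc i) (e + 1). vscale (l j) u - D i w \<in> JF j i"
  then obtain w where w: "w \<in> F (Suc i) (e + 1)" "vscale (l j) u - D i w \<in> JF j i" by blast
  have "vscale (l j) u - (vscale (l j) u - D i w) \<in> JF (Suc j) i"
    by (rule JF_diff[OF vscale_l_JF[OF F_free[OF u]] JF_mono[OF w(2)]])
  then have "D i w \<in> JF (Suc j) i" by simp
  then obtain w' where w': "w' \<in> F (Suc (Suc i)) (e + 1)" "w - D (Suc i) w' \<in> JF (Suc j) (Suc i)"
    using Z w(1) unfolding exact_mod_def by blast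
  obtain v where v: "v \<in> F (Suc i) (e + 1 - 1)" "w - D (Suc i) w' - vscale (l j) v \<in> JF j (Suc i)"
    using JF_Suc_decompose[OF j w'(2) F_diff[OF w(1) F_D[OF w'(1)]]] by blast
  have "D i (w - D (Suc i) w' - vscale (l j) v) \<in> JF j i" by (rule D_JF[OF v(2)])
  then have "D i w - vscale (l j) (D i v) \<in> JF j i"
    using D_D[OF F_free[OF w'(1)]] by (simp only: mat_app_diff mat_app_vscale diff_0_right)
  then have "(vscale (l j) u - D i w) + (D i w - vscale (l j) (D i v)) \<in> JF j i"
    using w(2) by (intro JF_add)
  then have "vscale (l j) (u - D i v) \<in> JF j i"
    by (simp add: vec_module.scale_right_diff_distrib)
  moreover have v': "v \<in> F (Suc i) e" using v(1) by simp
  ultimately have "u - D i v \<in> JF j i"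
    using JF_regular[OF j F_free[OF F_diff[OF u F_D[OF v']]]] by blast
  then show "\<exists>w\<in>F (Suc i) e. u - D i w \<in> JF j i" using v' by blast
qed

text \<open>Multiplication by \<open>l j\<close> moves a cycle to degree \<open>e + 1\<close>, where
  it is a boundary, and injectivity brings this back. Vanishing thus descends from large
  degrees.\<close>

lemma exact_mod_lower_degree:
  assumes j: "j < N" and T: "inj_mod (Suc i) j e" and Z: "exact_mod i j (e + 1)"
  shows "exact_mod i j e"
  unfolding exact_mod_def
proof (intro ballI impI)
  fix z assume z: "z \<in> F (Suc i) e" "D i z \<in> JF j i"
  have "D i (vscale (l j) z) \<in> JF j i" using z(2) by (simp add: mat_app_vscale JF_scale)
  then have "\<exists>w\<in>F (Suc (Suc i)) (e + 1). vscale (l j) z - D (Suc i) w \<in> JF j (Suc i)"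
    using Z F_vscale[OF j z(1)] unfolding exact_mod_def by blast
  then show "\<exists>w\<in>F (Suc (Suc i)) e. z - D (Suc i) w \<in> JF j (Suc i)"
    using T z(1) unfolding inj_mod_def by blast
qed

lemma exact_mod_0: "exact_mod i 0 e"
  unfolding exact_mod_def
proof (intro ballI impI)
  fix z assume z: "z \<in> F (Suc i) e" "D i z \<in> JF 0 i"
  have "D i z = 0" using z(2) by (auto simp: JF_def J_def)
  then have "z \<in> mat_app (A (Suc i)) ` free_module (length (G (Suc (Suc i))))"
    using F_free[OF z(1)] by (simp add: exact)
  then obtain w where w: "z = D (Suc i) w" by blast
  then have "z = D (Suc i) (shift_comp (G (Suc (Suc i))) e w)"
    using mat_app_shift_comp[OF hom_mat, of "Suc i" e w] z(1) by simp
  then show "\<exists>w\<in>F (Suc (Suc i)) e. z - D (Suc i) w \<in> JF 0 (Suc i)"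
    using vec_module.subspace_0[OF JF_subspace]
    by (intro bexI[of _ "shift_comp (G (Suc (Suc i))) e w"]) auto
qed

text \<open>The homology in question is Tor of \<open>S/I\<close> and \<open>S/J j\<close>. Every
  further linear form raises the last place where it can be nonzero by at most one.\<close>

lemma exact_mod_above_diagonal: "j \<le> i \<Longrightarrow> j \<le> N \<Longrightarrow> exact_mod i j e"
proof (induction j arbitrary: i e)
  case (Suc j i e)
  then obtain i' where i: "i = Suc i'" "j \<le> i'" by (cases i) auto
  have "inj_mod i j (e - 1)"
    unfolding i(1) using Suc i(2) by (intro inj_mod_Suc_if_exact_mod) auto
  then show ?case using Suc by (intro exact_mod_Suc) auto
qed (rule exact_mod_0)

lemma D_Suc_irrelevant: "w \<in> free_module (length (G (Suc (Suc i)))) \<Longrightarrow> D (Suc i) w \<in> JF N (Suc i)"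
  unfolding JF_def J_N using mat_app_free[OF mat_car, of "Suc i" w] mat_car[of "Suc i"] minimal[of _ i]
  by (auto simp: mat_app_def intro!: ring_module.span_sum subspace_mult_right
      intro: ring_module.span_zero)

text \<open>Modulo all variables the minimal differentials vanish. A basis vector at place
  \<open>Suc i\<close> is then a cycle, hence a boundary, hence zero modulo the variables, although
  one of its coordinates is 1. \<open>0 < i\<close> keeps clear of \<open>A 0\<close>, which may
  have unit entries.\<close>

theorem hilbert_syzygy:
  assumes "N \<le> i" "0 < i"
  shows "G (Suc i) = []"
proof (rule ccontr)
  assume ne: "G (Suc i) \<noteq> []"
  obtain i' where i': "i = Suc i'" using assms by (cases i) auto
  let ?z = "\<lambda>a::nat. if a = 0 then 1 else 0 :: ('n, 'k) mpoly"
  let ?e = "G (Suc i) ! 0"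
  have z: "?z \<in> F (Suc i) ?e"
    using ne by (auto simp: shift_homogeneous_def free_module_def)
  have "D i ?z \<in> JF N i"
    using D_Suc_irrelevant[of ?z i'] F_free[OF z] by (simp add: i')
  then obtain w where w: "w \<in> F (Suc (Suc i)) ?e" "?z - D (Suc i) w \<in> JF N (Suc i)"
    using exact_mod_above_diagonal[OF assms(1) order_refl, of ?e] z unfolding exact_mod_def by blast
  have "(?z - D (Suc i) w) + D (Suc i) w \<in> JF N (Suc i)"
    using w(2) D_Suc_irrelevant[OF F_free[OF w(1)]] by (intro JF_add)
  then have "?z \<in> JF N (Suc i)" by (simp only: diff_add_cancel)
  then have "?z 0 \<in> J N" unfolding JF_def by blast
  then show False by (simp add: J_N irrelevant_iff)
qed

text \<open>The bound \<open>E\<close> depends on \<open>i\<close> and \<open>j\<close>; its size is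
  irrelevant because it serves only as a starting point for descending to the true bound.\<close>

lemma exact_mod_eventually:
  assumes "\<And>j. j < N \<Longrightarrow> \<exists>E. \<forall>e\<ge>E. inj_mod 0 j e"
  shows "j \<le> N \<Longrightarrow> \<exists>E. \<forall>e\<ge>E. exact_mod i j e"
proof (induction j arbitrary: i)
  case 0
  then show ?case by (simp add: exact_mod_0)
next
  case (Suc j)
  obtain E where E: "\<And>e. e \<ge> E \<Longrightarrow> exact_mod i j e" using Suc by (meson Suc_leD)
  have "\<exists>E. \<forall>e\<ge>E. inj_mod i j e"
  proof (cases i)
    case 0
    then show ?thesis using assms Suc by auto
  next
    case (Suc i')
    obtain E' where "\<And>e. e \<ge> E' \<Longrightarrow> exact_mod i' j e" using Suc.IH Suc.prems by (meson Suc_leD)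
    then show ?thesis
      using Suc.prems by (intro exI[of _ E']) (auto simp: Suc intro!: inj_mod_Suc_if_exact_mod)
  qed
  then obtain E' where "\<And>e. e \<ge> E' \<Longrightarrow> inj_mod i j e" by blast
  \<comment> \<open>\<open>E' + 1\<close> because \<open>exact_mod_Suc\<close> uses injectivity in
    degree \<open>e - 1\<close>.\<close>
  then show ?case
    using E Suc.prems by (intro exI[of _ "max E (E' + 1)"]) (auto intro!: exact_mod_Suc)
qed

text \<open>Downward induction on \<open>j\<close>. For \<open>j = N\<close> a module is reduced to
  its generators, whose degrees are at most \<open>r + int i\<close>, so there is nothing left above
  that degree. Each step gains injectivity in the right range, and the known vanishing in large
  degrees is carried down by it.\<close>

lemma exact_mod_regularity:
  assumes ev: "\<And>j. j < N \<Longrightarrow> \<exists>E. \<forall>e\<ge>E. inj_mod 0 j e"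
    and shifts: "\<And>i g. g \<in> set (G (Suc i)) \<Longrightarrow> g \<le> r + int i"
  shows "j \<le> N \<Longrightarrow> e > r + int i \<Longrightarrow> exact_mod i j e"
proof (induction j arbitrary: i e rule: inc_induct)
  case base
  show ?case
    unfolding exact_mod_def
  proof (intro ballI impI)
    fix z assume z: "z \<in> F (Suc i) e"
    have "z a \<in> J N" for a
    proof (cases "a < length (G (Suc i))")
      case True
      then have "G (Suc i) ! a \<le> r + int i" by (intro shifts) auto
      then show ?thesis
        using z True base unfolding J_N
        by (intro homogeneous_irrelevant[of "e - G (Suc i) ! a"]) (auto simp: shift_homogeneous_def)
    next
      case False
      then show ?thesis using F_free[OF z] by (simp add: free_module_def J_N ring_module.span_zero)
    qed
    then have "z \<in> JF N (Suc i)" using F_free[OF z] by (simp add: JF_def)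
    moreover have "0 \<in> F (Suc (Suc i)) e"
      using shift_homogeneous_shift_comp[of _ e 0] by (simp only: shift_comp_0 mem_Collect_eq)
    ultimately show "\<exists>w\<in>F (Suc (Suc i)) e. z - D (Suc i) w \<in> JF N (Suc i)"
      by (intro bexI[of _ 0]) (simp_all only: mat_app_0 diff_0_right)
  qed
next
  case (step j)
  \<comment> \<open>The induction hypothesis is used at place \<open>i + 1\<close> and degree
    \<open>e + 1\<close>; the bound \<open>r + int i\<close> grows by one as well, so the range of
    \<open>e\<close> is preserved.\<close>
  have T: "inj_mod (Suc i) j e" if "e > r + int i" for e
    using that step.hyps by (intro inj_mod_if_exact_mod_Suc step.IH) auto
  obtain E where E: "\<And>e. e \<ge> E \<Longrightarrow> exact_mod i j e"
    using exact_mod_eventually[OF ev, of j i] step.hyps by auto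
  have "exact_mod i j e" if "e > r + int i" for e
    using that
  proof (induction "nat (E - e)" arbitrary: e)
    case 0
    then show ?case by (intro E) auto
  next
    case (Suc n)
    have "exact_mod i j (e + 1)" using Suc by (intro Suc.hyps(1)) auto
    then show ?case using exact_mod_lower_degree[OF step.hyps(2) T[OF Suc.prems]] by blast
  qed
  then show ?case using step.prems .
qed

section \<open>The cokernel at place 0 as a quotient of the polynomial ring\<close>

abbreviation Q :: "nat \<Rightarrow> ('n, 'k) mpoly set" where
  "Q j \<equiv> ring_module.span (I \<union> l ` {..<j})"

text \<open>The image of \<open>D 0\<close> is \<open>I\<close>, so modulo \<open>J j\<close> its
  cokernel is the quotient by \<open>Q j\<close>. As \<open>G 0 = [0]\<close>, coordinate 0 is the
  only one.\<close>

lemma coker_0_iff: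
  assumes j: "j \<le> N" and u: "u \<in> F 0 e"
  shows "(\<exists>w\<in>F 1 e. u - D 0 w \<in> JF j 0) \<longleftrightarrow> u 0 \<in> Q j"
proof
  have span: "Q j = {x + y |x y. x \<in> I \<and> y \<in> J j}"
  proof -
    have "ring_module.span I = I" using graded_idealD(1)[OF graded] by simp
    then show ?thesis by (simp only: J_def ring_module.span_Un)
  qed
  {
    assume "\<exists>w\<in>F 1 e. u - D 0 w \<in> JF j 0"
    then obtain w where w: "w \<in> F 1 e" "u - D 0 w \<in> JF j 0" by blast
    have "D 0 w 0 \<in> I" using image_0 F_free[OF w(1)] by blast
    moreover have "u 0 - D 0 w 0 \<in> J j" using w(2) by (simp add: JF_def)
    ultimately show "u 0 \<in> Q j"
      unfolding span by (intro CollectI exI[of _ "D 0 w 0"] exI[of _ "u 0 - D 0 w 0"]) auto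
  }
  assume "u 0 \<in> Q j"
  then obtain x y where xy: "x \<in> I" "y \<in> J j" "u 0 = x + y" using span by auto
  have u0: "homogeneous e (u 0)" using u by (simp add: shift_homogeneous_def G_0)
  \<comment> \<open>The summands \<open>x\<close> and \<open>y\<close> need not be homogeneous, so
    \<open>x\<close> is replaced by its component of degree \<open>e\<close>.\<close>
  let ?x = "\<lambda>a::nat. if a = 0 then hom_comp e x else 0"
  have "?x \<in> {v \<in> free_module 1. v 0 \<in> I}"
    using graded_idealD(2)[OF graded xy(1)] by (simp add: free_module_def)
  then obtain w where w: "?x = D 0 w" using image_0 by blast
  have "?x \<in> F 0 e" by (auto simp: shift_homogeneous_def G_0 free_module_def)
  then have w': "D 0 (shift_comp (G 1) e w) = ?x"
    using mat_app_shift_comp[OF hom_mat, of 0 e w] w by simp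
  have "u 0 - hom_comp e x = hom_comp e y"
    using xy(3) u0 hom_comp_add[of e x y] by simp
  then have "(u - ?x) a \<in> J j" for a
    using graded_idealD(2)[OF J_graded[OF j] xy(2), of e] F_free[OF u]
      ring_module.subspace_0[OF J_subspace]
    by (cases "a = 0") (simp_all add: free_module_def G_0)
  moreover have "u - ?x \<in> free_module (length (G 0))"
    using F_free[OF u] by (auto simp: free_module_def G_0)
  ultimately have "u - D 0 (shift_comp (G 1) e w) \<in> JF j 0"
    unfolding w' JF_def by blast
  then show "\<exists>w\<in>F 1 e. u - D 0 w \<in> JF j 0" by (intro bexI) auto
qed

lemma inj_mod_0_iff:
  assumes j: "j < N"
  shows "inj_mod 0 j e \<longleftrightarrow> (\<forall>x. homogeneous e x \<longrightarrow> l j * x \<in> Q j \<longrightarrow> x \<in> Q j)"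
proof -
  have "inj_mod 0 j e \<longleftrightarrow> (\<forall>u\<in>F 0 e. l j * u 0 \<in> Q j \<longrightarrow> u 0 \<in> Q j)"
    unfolding inj_mod_def
  proof (rule ball_cong[OF refl])
    fix u assume u: "u \<in> F 0 e"
    have "(\<exists>w\<in>F (Suc 0) (e + 1). vscale (l j) u - D 0 w \<in> JF j 0) \<longleftrightarrow> l j * u 0 \<in> Q j"
      using coker_0_iff[OF _ F_vscale[OF j u]] j by (simp add: vscale_apply)
    moreover have "(\<exists>w\<in>F (Suc 0) e. u - D 0 w \<in> JF j 0) \<longleftrightarrow> u 0 \<in> Q j"
      using coker_0_iff[OF _ u] j by simp
    ultimately show "((\<exists>w\<in>F (Suc 0) (e + 1). vscale (l j) u - D 0 w \<in> JF j 0) \<longrightarrow>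
        (\<exists>w\<in>F (Suc 0) e. u - D 0 w \<in> JF j 0)) = (l j * u 0 \<in> Q j \<longrightarrow> u 0 \<in> Q j)"
      by simp
  qed
  also have "\<dots> \<longleftrightarrow> (\<forall>x. homogeneous e x \<longrightarrow> l j * x \<in> Q j \<longrightarrow> x \<in> Q j)"
  proof (intro iffI allI impI ballI)
    fix x assume *: "\<forall>u\<in>F 0 e. l j * u 0 \<in> Q j \<longrightarrow> u 0 \<in> Q j" "homogeneous e x" "l j * x \<in> Q j"
    let ?x = "\<lambda>a::nat. if a = 0 then x else 0"
    have "?x \<in> F 0 e" using *(2) by (auto simp: shift_homogeneous_def G_0 free_module_def)
    then show "x \<in> Q j" using *(1,3) by fastforce
  next
    fix u assume "\<forall>x. homogeneous e x \<longrightarrow> l j * x \<in> Q j \<longrightarrow> x \<in> Q j" "u \<in> F 0 e" "l j * u 0 \<in> Q j"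
    moreover have "homogeneous e (u 0)" using \<open>u \<in> F 0 e\<close> by (simp add: shift_homogeneous_def G_0)
    ultimately show "u 0 \<in> Q j" by blast
  qed
  finally show ?thesis .
qed

theorem injective_from_regularity:
  assumes ev: "\<And>j. j < N \<Longrightarrow> \<exists>E. \<forall>e\<ge>E. \<forall>x. homogeneous e x \<longrightarrow> l j * x \<in> Q j \<longrightarrow> x \<in> Q j"
    and shifts: "\<And>i g. g \<in> set (G (Suc i)) \<Longrightarrow> g \<le> r + int i"
    and "j < N" "e \<ge> r" "homogeneous e x" "l j * x \<in> Q j"
  shows "x \<in> Q j"
proof -
  have ev': "\<exists>E. \<forall>e\<ge>E. inj_mod 0 j e" if "j < N" for j
    using ev[OF that] inj_mod_0_iff[OF that] by simp
  \<comment> \<open>The connecting homomorphism lowers degrees by one: vanishing in degrees above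
    \<open>r\<close> gives injectivity from degree \<open>r\<close> itself on.\<close>
  have "exact_mod 0 (Suc j) (e + 1)"
    using assms(3,4) by (intro exact_mod_regularity[OF ev' shifts]) auto
  then have "inj_mod 0 j e" by (rule inj_mod_if_exact_mod_Suc[OF assms(3)])
  then show ?thesis using inj_mod_0_iff[OF assms(3)] assms(5,6) by blast
qed

end

subsection \<open>The vector space of polynomials\<close>

definition cscale :: "'k::field \<Rightarrow> ('n, 'k) mpoly \<Rightarrow> ('n, 'k) mpoly" where
  "cscale c p = single 0 c * p"

global_interpretation poly_vs: vector_space cscale
  by unfold_locales
    (simp_all add: cscale_def distrib_left distrib_right single_add mult_single mult.assoc[symmetric])

lemma lookup_cscale [simp]: "lookup (cscale c p) m = c * lookup p m"
  by (simp add: cscale_def lookup_const_mult)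

lemma homogeneous_cscale: "homogeneous e p \<Longrightarrow> homogeneous e (cscale c p)"
  by (simp add: cscale_def homogeneous_const_mult)

lemma ideal_cscale: "ring_module.subspace P \<Longrightarrow> p \<in> P \<Longrightarrow> cscale c p \<in> P"
  unfolding cscale_def by (rule ring_module.subspace_scale)

lemma cscale_mult_left: "cscale c p * q = cscale c (p * q)"
  by (simp add: cscale_def mult.assoc)

lemma cscale_mult_right: "p * cscale c q = cscale c (p * q)"
  by (simp add: cscale_def mult.left_commute)

lemma mono_degree_1_iff: "mono_degree m = 1 \<longleftrightarrow> (\<exists>i. m = single i 1)"
proof
  assume "mono_degree m = 1"
  then obtain i where i: "lookup m i = 1" "\<And>j. j \<noteq> i \<Longrightarrow> lookup m j = 0"
    unfolding mono_degree_def One_nat_def using sum_eq_Suc0_iff[of UNIV "lookup m"] by auto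
  then show "\<exists>i. m = single i 1"
    by (intro exI[of _ i] poly_mapping_eqI) (auto simp: lookup_single when_def)
next
  assume "\<exists>i. m = single i 1"
  then show "mono_degree m = 1" by (auto simp: mono_degree_def lookup_single when_def)
qed

lemma lookup_variable:
  "lookup (variable i :: ('n, 'k::comm_ring_1) mpoly) (single j (Suc 0))
    = (if i = j then 1 else 0)"
proof -
  have "single i (Suc 0) = single j (Suc 0) \<longleftrightarrow> i = j"
    by (metis lookup_single_eq lookup_single_not_eq zero_neq_one One_nat_def)
  then show ?thesis by (simp add: variable_def lookup_single when_def)
qed

lemma linear_form_expansion:
  fixes p :: "('n::finite, 'k::field) mpoly"
  assumes "homogeneous 1 p"
  shows "(\<Sum>i\<in>UNIV. cscale (lookup p (single i 1)) (variable i)) = p"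
    (is "?q = p")
proof (rule poly_mapping_eqI)
  fix m
  have q: "homogeneous 1 ?q" by (intro homogeneous_sum homogeneous_cscale homogeneous_variable)
  show "lookup ?q m = lookup p m"
  proof (cases "mono_degree m = 1")
    case True
    then obtain j where "m = single j (Suc 0)" using mono_degree_1_iff[of m] by auto
    then show ?thesis by (simp add: lookup_sum lookup_variable if_distrib cong: if_cong)
  next
    case False
    then have "lookup ?q m = 0" "lookup p m = 0"
      using q assms unfolding homogeneous_iff by force+
    then show ?thesis by simp
  qed
qed

lemma independent_variables:
  "poly_vs.independent (range variable :: ('n::finite, 'k::field) mpoly set)"
  "card (range variable :: ('n::finite, 'k::field) mpoly set) = CARD('n)"
proof -
  have inj: "inj (variable :: 'n \<Rightarrow> ('n, 'k) mpoly)"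
    by (rule injI) (metis lookup_variable zero_neq_one)
  then show "card (range variable :: ('n, 'k) mpoly set) = CARD('n)" by (rule card_image)
  show "poly_vs.independent (range variable :: ('n, 'k) mpoly set)"
  proof (rule poly_vs.independent_if_scalars_zero)
    fix f :: "('n, 'k) mpoly \<Rightarrow> 'k" and x :: "('n, 'k) mpoly"
    assume sum: "(\<Sum>x\<in>range variable. cscale (f x) x) = 0" and x: "x \<in> range variable"
    then obtain j :: 'n where j: "x = variable j" by blast
    have "(\<Sum>x\<in>range variable. cscale (f x) x) = (\<Sum>i\<in>UNIV. cscale (f (variable i)) (variable i))"
      by (rule sum.reindex_cong[OF inj]) auto
    then have "lookup (\<Sum>i\<in>UNIV. cscale (f (variable i)) (variable i))
        (single j (Suc 0)) = 0"
      using sum by simp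
    then show "f x = 0" by (simp add: j lookup_sum lookup_variable if_distrib cong: if_cong)
  qed simp
qed

subsection \<open>Regular sequences of linear forms\<close>

definition subst_mpoly :: "('n \<Rightarrow> ('n, 'k) mpoly) \<Rightarrow> ('n::finite, 'k::field) mpoly \<Rightarrow> ('n, 'k) mpoly" where
  "subst_mpoly y p = (\<Sum>m\<in>keys p.
     cscale (lookup p m) (\<Prod>i\<in>UNIV. y i ^ lookup m i))"

lemma subst_superset:
  assumes "finite K" "keys p \<subseteq> K"
  shows "subst_mpoly y p = (\<Sum>m\<in>K. cscale (lookup p m) (\<Prod>i\<in>UNIV. y i ^ lookup m i))"
  unfolding subst_mpoly_def using assms
  by (intro sum.mono_neutral_left) (auto simp: in_keys_iff)

lemma subst_add: "subst_mpoly y (p + q) = subst_mpoly y p + subst_mpoly y q"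
proof -
  let ?K = "keys p \<union> keys q"
  have "keys (p + q) \<subseteq> ?K" by (rule keys_add)
  then show ?thesis
    by (simp add: subst_superset[of ?K] lookup_add poly_vs.scale_left_distrib sum.distrib)
qed

lemma subst_0 [simp]: "subst_mpoly y 0 = 0"
  by (simp add: subst_mpoly_def)

lemma subst_sum: "subst_mpoly y (sum f A) = (\<Sum>a\<in>A. subst_mpoly y (f a))"
  by (induction A rule: infinite_finite_induct) (simp_all add: subst_add)

lemma subst_single: "subst_mpoly y (single m c) = cscale c (\<Prod>i\<in>UNIV. y i ^ lookup m i)"
  by (cases "c = 0") (simp_all add: subst_mpoly_def)

lemma subst_single_mult:
  "subst_mpoly y (single m c * single n d) =
     subst_mpoly y (single m c) * subst_mpoly y (single n d)"
  by (simp add: mult_single subst_single cscale_mult_left cscale_mult_right lookup_add power_add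
      prod.distrib)

lemma subst_mult: "subst_mpoly y (p * q) = subst_mpoly y p * subst_mpoly y q"
proof -
  let ?s = "\<lambda>p m. single m (lookup p m)"
  have "subst_mpoly y ((\<Sum>m\<in>keys p. ?s p m) * (\<Sum>n\<in>keys q. ?s q n)) =
      subst_mpoly y (\<Sum>m\<in>keys p. ?s p m) * subst_mpoly y (\<Sum>n\<in>keys q. ?s q n)"
    unfolding sum_product subst_sum subst_single_mult ..
  then show ?thesis by (simp only: sum_single_keys)
qed

lemma subst_cscale: "subst_mpoly y (cscale c p) = cscale c (subst_mpoly y p)"
  by (simp add: cscale_def subst_mult) (simp add: subst_single cscale_def)

lemma subst_variable [simp]: "subst_mpoly y (variable i) = y i"
proof -
  have "(\<Prod>j\<in>UNIV. y j ^ lookup (single i (Suc 0)) j) =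
      (\<Prod>j\<in>UNIV. if j = i then y j else 1)"
    by (rule prod.cong) (auto simp: lookup_single when_def)
  then show ?thesis by (simp add: variable_def subst_single)
qed

text \<open>Modulo \<open>P\<close> the substitution agrees with the identity on the variables, and
  products and sums preserve congruence.\<close>

lemma subst_congruent:
  assumes P: "ring_module.subspace P" and y: "\<And>i. y i - variable i \<in> P"
  shows "subst_mpoly y p - p \<in> P"
proof -
  have mult: "a * b - a' * b' \<in> P" if "a - a' \<in> P" "b - b' \<in> P" for a b a' b'
  proof -
    have "a * (b - b') + (a - a') * b' \<in> P"
      using that P by (intro ring_module.subspace_add ring_module.subspace_scale subspace_mult_right)
    then show ?thesis by (simp add: algebra_simps)
  qed
  have power: "y i ^ n - variable i ^ n \<in> P" for i n
    by (induction n) (use ring_module.subspace_0[OF P] mult y in auto)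
  have prod: "(\<Prod>i\<in>A. y i ^ k i) - (\<Prod>i\<in>A. variable i ^ k i) \<in> P" for A k
    by (induction A rule: infinite_finite_induct) (use ring_module.subspace_0[OF P] mult power in auto)
  have single: "subst_mpoly y (single m c) - single m c \<in> P" for m c
  proof -
    have "single m c = cscale c (single m 1)"
      by (simp add: cscale_def mult_single)
    then have eq: "subst_mpoly y (single m c) - single m c =
        cscale c ((\<Prod>i\<in>UNIV. y i ^ lookup m i) - (\<Prod>i\<in>UNIV. variable i ^ lookup m i))"
      unfolding subst_single mono_prod_variables by (simp only: poly_vs.scale_right_diff_distrib)
    show ?thesis unfolding eq by (rule ideal_cscale[OF P prod])
  qed
  let ?s = "\<lambda>m. single m (lookup p m)"
  have "(\<Sum>m\<in>keys p. subst_mpoly y (?s m) - ?s m) \<in> P"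
    by (intro ring_module.subspace_sum[OF P] single)
  then have "subst_mpoly y (\<Sum>m\<in>keys p. ?s m) - (\<Sum>m\<in>keys p. ?s m) \<in> P"
    by (simp only: sum_subtractf subst_sum)
  then show ?thesis by (simp only: sum_single_keys)
qed

lemma subst_linear:
  assumes "\<And>i. homogeneous 1 (y i)" "homogeneous 1 p"
  shows "homogeneous 1 (subst_mpoly y p)"
proof -
  have "homogeneous 1 (subst_mpoly y (\<Sum>i\<in>UNIV. cscale (lookup p (single i 1)) (variable i)))"
    unfolding subst_sum subst_cscale subst_variable
    by (intro homogeneous_sum homogeneous_cscale assms(1))
  then show ?thesis using linear_form_expansion[OF assms(2)] by simp
qed

text \<open>The quotient by linearly independent linear forms is again a domain, because it is the
  image of an endomorphism that eliminates one variable after the other.\<close>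

lemma elimination_hom_exists:
  fixes l :: "nat \<Rightarrow> ('n::finite, 'k::field) mpoly"
  assumes "\<And>i. i < j \<Longrightarrow> homogeneous 1 (l i)" "\<And>i. i < j \<Longrightarrow> l i \<notin> ring_module.span (l ` {..<i})"
  shows "\<exists>\<phi>. (\<forall>p q. \<phi> (p + q) = \<phi> p + \<phi> q) \<and> (\<forall>p q. \<phi> (p * q) = \<phi> p * \<phi> q) \<and>
    (\<forall>p. \<phi> p - p \<in> ring_module.span (l ` {..<j})) \<and> (\<forall>i<j. \<phi> (l i) = 0) \<and>
    (\<forall>p. homogeneous 1 p \<longrightarrow> homogeneous 1 (\<phi> p))"
  using assms
proof (induction j)
  case 0
  then show ?case by (intro exI[of _ id]) auto
next
  case (Suc j)
  then obtain \<phi> where add: "\<And>p q. \<phi> (p + q) = \<phi> p + \<phi> q"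
    and mult: "\<And>p q. \<phi> (p * q) = \<phi> p * \<phi> q"
    and cong: "\<And>p. \<phi> p - p \<in> ring_module.span (l ` {..<j})"
    and zero: "\<And>i. i < j \<Longrightarrow> \<phi> (l i) = 0"
    and lin: "\<And>p. homogeneous 1 p \<Longrightarrow> homogeneous 1 (\<phi> p)"
    by (metis less_SucI)
  let ?J = "ring_module.span (l ` {..<Suc j})"
  have mono: "p \<in> ring_module.span (l ` {..<j}) \<Longrightarrow> p \<in> ?J" for p
    using ring_module.span_mono[of "l ` {..<j}" "l ` {..<Suc j}"] by (auto simp: lessThan_Suc)
  define l' where "l' = \<phi> (l j)"
  have l'lin: "homogeneous 1 l'" using Suc.prems(1) lin by (simp add: l'_def)
  have "l' \<noteq> 0"
  proof
    assume "l' = 0"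
    then have "- l j \<in> ring_module.span (l ` {..<j})" using cong[of "l j"] by (simp add: l'_def)
    then have "- (- l j) \<in> ring_module.span (l ` {..<j})" by (rule ring_module.span_neg)
    then show False using Suc.prems(2) by simp
  qed
  then obtain i where i: "lookup l' (single i 1) \<noteq> 0"
    using linear_form_expansion[OF l'lin] by (metis (no_types, lifting) poly_vs.scale_zero_left sum.neutral)
  define c where "c = lookup l' (single i 1)"
  \<comment> \<open>This solves \<open>l' = 0\<close> for the variable \<open>i\<close>: since
    \<open>c\<close> is its coefficient in \<open>l'\<close>, substituting \<open>y\<close> into
    \<open>l'\<close> yields \<open>l' - l' = 0\<close>.\<close>
  define y where "y k = variable k - (if k = i then cscale (1 / c) l' else 0)" for k
  have l'J: "l' \<in> ?J"
  proof -
    have "(\<phi> (l j) - l j) + l j \<in> ?J"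
      by (intro ring_module.span_add mono cong ring_module.span_base) auto
    then show ?thesis by (simp add: l'_def)
  qed
  have y_lin: "homogeneous 1 (y k)" for k
    unfolding y_def using homogeneous_cscale[OF l'lin]
    by (intro homogeneous_diff homogeneous_variable) auto
  have y_cong: "y k - variable k \<in> ?J" for k
  proof -
    have "- cscale (1 / c) l' \<in> ?J"
      using l'J by (intro ring_module.span_neg ideal_cscale) auto
    then show ?thesis by (simp add: y_def ring_module.span_zero)
  qed
  have "subst_mpoly y l' = 0"
  proof -
    let ?c = "\<lambda>k. lookup l' (single k 1)"
    have "subst_mpoly y (\<Sum>k\<in>UNIV. cscale (?c k) (variable k)) =
        (\<Sum>k\<in>UNIV. cscale (?c k) (variable k)) -
        (\<Sum>k\<in>UNIV. cscale (?c k) (if k = i then cscale (1 / c) l' else 0))"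
      unfolding subst_sum subst_cscale subst_variable y_def poly_vs.scale_right_diff_distrib
      by (simp only: sum_subtractf)
    also have "(\<Sum>k\<in>UNIV. cscale (?c k) (if k = i then cscale (1 / c) l' else 0)) =
        (\<Sum>k\<in>UNIV. if k = i then cscale (?c k) (cscale (1 / c) l') else 0)"
      by (rule sum.cong) auto
    also have "\<dots> = l'" using i by (simp add: c_def)
    finally show ?thesis by (simp only: linear_form_expansion[OF l'lin]) simp
  qed
  moreover have "subst_mpoly y (\<phi> p) - p \<in> ?J" for p
  proof -
    have "(subst_mpoly y (\<phi> p) - \<phi> p) + (\<phi> p - p) \<in> ?J"
      by (intro ring_module.span_add mono cong subst_congruent y_cong) auto
    then show ?thesis by simp
  qed
  ultimately show ?case
    using add mult zero lin subst_linear[OF y_lin]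
    by (intro exI[of _ "\<lambda>p. subst_mpoly y (\<phi> p)"]) (auto simp: subst_add subst_mult less_Suc_eq l'_def)
qed

lemma linear_forms_regular:
  fixes l :: "nat \<Rightarrow> ('n::finite, 'k::field) mpoly"
  assumes lin: "\<And>i. i \<le> j \<Longrightarrow> homogeneous 1 (l i)"
    and indep: "\<And>i. i \<le> j \<Longrightarrow> l i \<notin> ring_module.span (l ` {..<i})"
    and x: "l j * x \<in> ring_module.span (l ` {..<j})"
  shows "x \<in> ring_module.span (l ` {..<j})"
proof -
  let ?J = "ring_module.span (l ` {..<j})"
  have "\<exists>\<phi>. (\<forall>p q. \<phi> (p + q) = \<phi> p + \<phi> q) \<and> (\<forall>p q. \<phi> (p * q) = \<phi> p * \<phi> q) \<and>
    (\<forall>p. \<phi> p - p \<in> ?J) \<and> (\<forall>i<j. \<phi> (l i) = 0) \<and> (\<forall>p. homogeneous 1 p \<longrightarrow> homogeneous 1 (\<phi> p))"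
    by (rule elimination_hom_exists) (use lin indep in auto)
  then obtain \<phi> where add: "\<And>p q. \<phi> (p + q) = \<phi> p + \<phi> q"
    and mult: "\<And>p q. \<phi> (p * q) = \<phi> p * \<phi> q"
    and cong: "\<And>p. \<phi> p - p \<in> ?J"
    and zero: "\<And>i. i < j \<Longrightarrow> \<phi> (l i) = 0"
    by blast
  have \<phi>0: "\<phi> 0 = 0" using add[of 0 0] by simp
  \<comment> \<open>The kernel of \<open>\<phi>\<close> is exactly \<open>?J\<close>: one inclusion
    comes from the congruence, the other from the vanishing on the generators. The polynomial ring
    being a domain then gives the claim.\<close>
  have ker: "p \<in> ?J" if "\<phi> p = 0" for p
    using cong[of p] that ring_module.span_neg[of "- p"] by fastforce
  have "\<phi> p = 0" if "p \<in> ?J" for p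
    using that
    by (induction rule: ring_module.span_induct_alt) (auto simp: \<phi>0 add mult zero)
  then have "\<phi> (l j) * \<phi> x = 0" using x mult by metis
  moreover have "\<phi> (l j) \<noteq> 0" using ker indep by blast
  ultimately have "\<phi> x = 0" by (simp add: mpoly_mult_eq_0_iff)
  then show ?thesis by (rule ker)
qed

section \<open>Linear dependence of linear forms over the field\<close>

lemma linear_span:
  fixes l :: "nat \<Rightarrow> ('n::finite, 'k::field) mpoly"
  assumes lin: "\<And>i. i < j \<Longrightarrow> homogeneous 1 (l i)"
    and "p \<in> ring_module.span (l ` {..<j})"
  shows "hom_comp 1 p \<in> poly_vs.span (l ` {..<j})"
  using assms(2)
proof (induction rule: ring_module.span_induct_alt)
  case base
  then show ?case by (simp add: poly_vs.span_zero)
next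
  case (step c x y)
  \<comment> \<open>In degree 1 only the constant term of a coefficient survives, so membership of a
    linear form in the ideal is a matter of linear dependence over the field.\<close>
  have const: "hom_comp 0 c = single 0 (lookup c 0)"
    by (rule poly_mapping_eqI) (auto simp: lookup_hom_comp lookup_single when_def mono_degree_eq_0_iff)
  have "homogeneous 1 x" using step(1) lin by auto
  then have "hom_comp 1 (c * x) = cscale (lookup c 0) x"
    using hom_comp_mult[of 1 x 1 c] by (simp add: mult.commute cscale_def const)
  then show ?case
    using step poly_vs.span_add[OF poly_vs.span_scale[OF poly_vs.span_base[OF step(1)]] step(2)]
    by (simp add: hom_comp_add)
qed

lemma linear_forms_independent:
  fixes l :: "nat \<Rightarrow> ('n::finite, 'k::field) mpoly"
  assumes "\<And>i. i < j \<Longrightarrow> homogeneous 1 (l i)" "\<And>i. i < j \<Longrightarrow> l i \<notin> ring_module.span (l ` {..<i})"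
  shows "poly_vs.independent (l ` {..<j}) \<and> card (l ` {..<j}) = j"
  using assms
proof (induction j)
  case (Suc j)
  have sub: "poly_vs.span (l ` {..<j}) \<subseteq> ring_module.span (l ` {..<j})"
    using ring_module.span_superset[of "l ` {..<j}"]
    by (intro poly_vs.span_minimal)
      (auto intro!: poly_vs.subspaceI ring_module.span_zero ring_module.span_add ideal_cscale)
  then have "l j \<notin> poly_vs.span (l ` {..<j})" using Suc.prems(2)[of j] by auto
  moreover have "l j \<notin> l ` {..<j}" using Suc.prems(2)[of j] ring_module.span_base[of "l j" "l ` {..<j}"] by auto
  ultimately show ?case
    using Suc by (auto simp: lessThan_Suc poly_vs.independent_insert)
qed (simp add: poly_vs.independent_empty)

lemma linear_forms_le_card:
  fixes l :: "nat \<Rightarrow> ('n::finite, 'k::field) mpoly"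
  assumes "\<And>i. i < j \<Longrightarrow> homogeneous 1 (l i)" "\<And>i. i < j \<Longrightarrow> l i \<notin> ring_module.span (l ` {..<i})"
  shows "j \<le> CARD('n)"
proof -
  have "l i \<in> poly_vs.span (range variable)" if "i < j" for i
  proof -
    have "(\<Sum>k\<in>UNIV. cscale (lookup (l i) (single k 1)) (variable k))
        \<in> poly_vs.span (range variable)"
      by (intro poly_vs.span_sum poly_vs.span_scale poly_vs.span_base) auto
    then show ?thesis using linear_form_expansion assms(1) that by metis
  qed
  then have "l ` {..<j} \<subseteq> poly_vs.span (range variable)" by auto
  then have "card (l ` {..<j}) \<le> card (range variable :: ('n, 'k) mpoly set)"
    using linear_forms_independent[OF assms] poly_vs.independent_span_bound[of "range variable" "l ` {..<j}"]
    by auto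
  then show ?thesis using linear_forms_independent[OF assms] independent_variables(2) by metis
qed

lemma linear_forms_span_irrelevant:
  fixes l :: "nat \<Rightarrow> ('n::finite, 'k::field) mpoly"
  assumes lin: "\<And>i. i < CARD('n) \<Longrightarrow> homogeneous 1 (l i)"
    and indep: "\<And>i. i < CARD('n) \<Longrightarrow> l i \<notin> ring_module.span (l ` {..<i})"
  shows "ring_module.span (l ` {..<CARD('n)}) = variable_span"
proof
  show "ring_module.span (l ` {..<CARD('n)}) \<subseteq> variable_span"
    using homogeneous_irrelevant[OF lin] by (intro ring_module.span_minimal) auto
  have "variable i \<in> ring_module.span (l ` {..<CARD('n)})" for i
  proof (rule ccontr)
    assume i: "variable i \<notin> ring_module.span (l ` {..<CARD('n)})"
    \<comment> \<open>A missing variable could be appended, which would give more independent linear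
      forms than variables.\<close>
    let ?l = "l(CARD('n) := variable i)"
    have img: "?l ` {..<j} = l ` {..<j}" if "j \<le> CARD('n)" for j
      using that by (intro image_cong) auto
    have "Suc CARD('n) \<le> CARD('n)"
    proof (rule linear_forms_le_card)
      fix j assume j: "j < Suc CARD('n)"
      show "homogeneous 1 (?l j)" using lin j by (cases "j = CARD('n)") auto
      show "?l j \<notin> ring_module.span (?l ` {..<j})"
        using j i indep[of j] img[of j] by (cases "j = CARD('n)") auto
    qed
    then show False by simp
  qed
  then show "variable_span \<subseteq> ring_module.span (l ` {..<CARD('n)})"
    by (intro ring_module.span_minimal) auto
qed

text \<open>This qualifies the ideal of the earlier forms as one of those that a generic linear form
  avoids.\<close>

lemma variable_not_in_linear_span:
  fixes l :: "nat \<Rightarrow> ('n::finite, 'k::field) mpoly"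
  assumes lin: "\<And>i. i < j \<Longrightarrow> homogeneous 1 (l i)" and "j < CARD('n)"
  shows "\<exists>i. variable i \<notin> ring_module.span (l ` {..<j})"
proof (rule ccontr)
  assume "\<not> ?thesis"
  then have "variable i \<in> poly_vs.span (l ` {..<j})" for i
    using linear_span[OF lin, where p = "variable i"] by auto
  then have "card (range variable :: ('n, 'k) mpoly set) \<le> card (l ` {..<j})"
    using independent_variables(1) poly_vs.independent_span_bound[of "l ` {..<j}" "range variable"] by auto
  also have "\<dots> \<le> j" using card_image_le[of "{..<j}" l] by simp
  finally show False using assms(2) by (simp add: independent_variables(2))
qed

subsection \<open>Generic linear forms\<close>

text \<open>A prime filtration of $S/J$: outside the finitely many relevant homogeneous primes that occur
  in it, a linear form is a nonzerodivisor on $S/J$ in all large degrees.\<close>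

lemma filter_regular_linear_forms:
  fixes J :: "('n::finite, 'k::field) mpoly set"
  assumes "graded_ideal J"
  shows "\<exists>\<P>. finite \<P> \<and> (\<forall>P\<in>\<P>. ring_module.subspace P \<and> (\<exists>i. variable i \<notin> P)) \<and>
    (\<forall>h. homogeneous 1 h \<longrightarrow> (\<forall>P\<in>\<P>. h \<notin> P) \<longrightarrow>
      (\<exists>E. \<forall>e\<ge>E. \<forall>x. homogeneous e x \<longrightarrow> h * x \<in> J \<longrightarrow> x \<in> J))"
  using assms
proof (induction J rule: wf_induct_rule[OF ideals_wf])
  case (1 J)
  have J: "ring_module.subspace J" using 1(2) by (rule graded_idealD)
  show ?case
  proof (cases "\<forall>p e. homogeneous e p \<longrightarrow> p \<in> J")
    case True
    then show ?thesis by (intro exI[of _ "{}"]) auto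
  next
    case False
    let ?colon = "\<lambda>f. {a. a * f \<in> J}"
    have colon: "ring_module.subspace (?colon f)" for f
      using ring_module.subspace_0[OF J] ring_module.subspace_add[OF J] ring_module.subspace_scale[OF J]
      by (intro ring_module.subspaceI) (auto simp: distrib_right mult.assoc)
    \<comment> \<open>A maximal member is an associated prime. The argument works with its
      maximality: \<open>P\<close> lies in the colon ideal of every multiple of \<open>f\<close>,
      and equals it for a homogeneous multiple outside \<open>J\<close>.\<close>
    let ?\<Q> = "{?colon f | f e. homogeneous e f \<and> f \<notin> J}"
    have "?\<Q> \<noteq> {}" using False by blast
    then obtain P where P: "P \<in> ?\<Q>" "\<And>P'. P' \<in> ?\<Q> \<Longrightarrow> \<not> P \<subset> P'"
      by (rule maximal_ideal_in_family) (use colon in auto)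
    then obtain f c where f: "P = ?colon f" "homogeneous c f" "f \<notin> J" by blast
    let ?K = "ring_module.span (J \<union> {f})"
    have K: "graded_ideal ?K" using f(2) by (intro graded_ideal_span_Un[OF 1(2)]) auto
    have "J \<subseteq> ?K" "f \<in> ?K" using ring_module.span_superset[of "J \<union> {f}"] by auto
    then have "J \<subset> ?K" using f(3) by blast
    then obtain \<P> where \<P>: "finite \<P>" "\<forall>P\<in>\<P>. ring_module.subspace P \<and> (\<exists>i. variable i \<notin> P)"
      "\<forall>h. homogeneous 1 h \<longrightarrow> (\<forall>P\<in>\<P>. h \<notin> P) \<longrightarrow>
        (\<exists>E. \<forall>e\<ge>E. \<forall>x. homogeneous e x \<longrightarrow> h * x \<in> ?K \<longrightarrow> x \<in> ?K)"
      using 1(1)[of ?K] J K by auto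
    \<comment> \<open>An ideal that contains all variables cannot be avoided by a linear form; it
      affects only one degree and is left to the choice of the bound.\<close>
    define \<P>' where "\<P>' = (if \<exists>i. variable i \<notin> P then insert P \<P> else \<P>)"
    have "\<exists>E. \<forall>e\<ge>E. \<forall>x. homogeneous e x \<longrightarrow> h * x \<in> J \<longrightarrow> x \<in> J"
      if h: "homogeneous 1 h" "\<forall>P\<in>\<P>'. h \<notin> P" for h
    proof -
      have "\<forall>P\<in>\<P>. h \<notin> P" using h(2) by (auto simp: \<P>'_def split: if_splits)
      then have "\<exists>E. \<forall>e\<ge>E. \<forall>x. homogeneous e x \<longrightarrow> h * x \<in> ?K \<longrightarrow> x \<in> ?K"
        by (rule \<P>(3)[THEN spec, THEN mp, THEN mp, OF h(1)])
      then obtain E where E: "\<forall>e\<ge>E. \<forall>x. homogeneous e x \<longrightarrow> h * x \<in> ?K \<longrightarrow> x \<in> ?K"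
        by (elim exE) (rule that)
      \<comment> \<open>\<open>c + 1\<close> makes the degree \<open>e - c\<close> of the cofactor
        \<open>a\<close> positive, so that \<open>a\<close> lies in \<open>P\<close> if
        \<open>P\<close> contains all variables.\<close>
      have "x \<in> J" if e: "e \<ge> max E (c + 1)" and x: "homogeneous e x" "h * x \<in> J" for e x
      proof -
        have "h * x \<in> ?K" using x(2) \<open>J \<subseteq> ?K\<close> by auto
        then have "x \<in> ?K" using E e x(1) by auto
        then have "x \<in> ring_module.span (insert f J)" by simp
        then obtain a where a: "homogeneous (e - c) a" "x - a * f \<in> J"
          by (rule homogeneous_span_insert[OF 1(2) f(2) x(1)])
        have "h * x - h * (x - a * f) \<in> J"
          by (intro ring_module.subspace_diff[OF J] ring_module.subspace_scale[OF J] x(2) a(2))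
        then have haf: "h * (a * f) \<in> J" by (simp add: algebra_simps)
        have "a * f \<in> J"
        proof (cases "\<exists>i. variable i \<notin> P")
          case True
          then have "h \<notin> P" using h(2) by (simp add: \<P>'_def)
          show ?thesis
          proof (rule ccontr)
            assume af: "a * f \<notin> J"
            have "?colon (a * f) \<in> ?\<Q>" using af homogeneous_mult[OF a(1) f(2)] by blast
            then have "\<not> P \<subset> ?colon (a * f)" by (rule P(2))
            moreover have "P \<subseteq> ?colon (a * f)"
            proof
              fix x assume "x \<in> P"
              then have "a * (x * f) \<in> J" using ring_module.subspace_scale[OF J] f(1) by blast
              then show "x \<in> ?colon (a * f)" by (simp add: mult.left_commute[of x])
            qed
            ultimately have "P = ?colon (a * f)" by blast
            then show False using haf \<open>h \<notin> P\<close> by blast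
          qed
        next
          case False
          then have "variable_span \<subseteq> P"
            using colon f(1) by (intro ring_module.span_minimal) auto
          moreover have "a \<in> variable_span"
            using e by (intro homogeneous_irrelevant[OF a(1)]) auto
          ultimately show ?thesis using f(1) by auto
        qed
        then have "(x - a * f) + a * f \<in> J" by (intro ring_module.subspace_add[OF J] a(2))
        then show ?thesis by simp
      qed
      then show ?thesis by blast
    qed
    moreover have "finite \<P>'" "\<forall>P\<in>\<P>'. ring_module.subspace P \<and> (\<exists>i. variable i \<notin> P)"
      using \<P>(1,2) colon f(1) by (auto simp: \<P>'_def)
    ultimately show ?thesis by blast
  qed
qed

text \<open>Two points of the line in \<open>P\<close> would differ by a nonzero scalar multiple of
  \<open>b\<close>, so at most one value of \<open>t\<close> is bad.\<close>

lemma finite_line_meets_ideal: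
  fixes P :: "('n::finite, 'k::field) mpoly set"
  assumes P: "ring_module.subspace P" and "b \<notin> P"
  shows "finite {t. a + cscale t b \<in> P}"
proof -
  have "t = t'" if "a + cscale t b \<in> P" "a + cscale t' b \<in> P" for t t'
  proof (rule ccontr)
    assume "t \<noteq> t'"
    have "(a + cscale t b) - (a + cscale t' b) \<in> P" by (rule ring_module.subspace_diff[OF P that])
    then have "cscale (t - t') b \<in> P" by (simp add: poly_vs.scale_left_diff_distrib)
    then have "cscale (inverse (t - t')) (cscale (t - t') b) \<in> P" by (rule ideal_cscale[OF P])
    then show False using \<open>t \<noteq> t'\<close> \<open>b \<notin> P\<close> by simp
  qed
  then have "\<exists>t0. {t. a + cscale t b \<in> P} \<subseteq> {t0}" by blast
  then show ?thesis using finite_subset by blast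
qed

text \<open>A form that avoids the old ideals is moved in the direction of a variable outside the
  new one. An ideal containing that variable never meets the line; every other one meets it in
  finitely many points.\<close>

lemma linear_form_avoiding:
  fixes \<P> :: "('n::finite, 'k::field_char_0) mpoly set set"
  assumes "finite \<P>" "\<And>P. P \<in> \<P> \<Longrightarrow> ring_module.subspace P \<and> (\<exists>i. variable i \<notin> P)"
  shows "\<exists>b. homogeneous 1 b \<and> (\<forall>P\<in>\<P>. b \<notin> P)"
  using assms
proof (induction \<P> rule: finite_induct)
  case empty
  then show ?case using homogeneous_0 by blast
next
  case (insert P \<P>)
  then obtain b where b: "homogeneous 1 b" "\<And>P. P \<in> \<P> \<Longrightarrow> b \<notin> P" by auto
  obtain i where i: "variable i \<notin> P" using insert by blast
  have "finite {t. b + cscale t (variable i) \<in> P'}" if "P' \<in> insert P \<P>" for P'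
  proof (cases "variable i \<in> P'")
    case True
    then have "P' \<in> \<P>" using that i by auto
    have P': "ring_module.subspace P'" using insert that by blast
    have "b + cscale t (variable i) \<notin> P'" for t
    proof
      assume "b + cscale t (variable i) \<in> P'"
      then have "(b + cscale t (variable i)) - cscale t (variable i) \<in> P'"
        by (intro ring_module.subspace_diff[OF P'] ideal_cscale[OF P' True])
      then show False using b(2) \<open>P' \<in> \<P>\<close> by simp
    qed
    then show ?thesis by simp
  next
    case False
    then show ?thesis using insert that by (intro finite_line_meets_ideal) auto
  qed
  then have "finite (\<Union>P'\<in>insert P \<P>. {t. b + cscale t (variable i) \<in> P'})"
    using insert(1) by blast
  then obtain t where "t \<notin> (\<Union>P'\<in>insert P \<P>. {t. b + cscale t (variable i) \<in> P'})"
    using ex_new_if_finite[OF infinite_UNIV_char_0] by metis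
  then show ?case
    using b(1) homogeneous_add[OF b(1) homogeneous_cscale[OF homogeneous_variable]]
    by (intro exI[of _ "b + cscale t (variable i)"]) auto
qed

subsection \<open>Dimension counts\<close>

context vector_space
begin

text \<open>The polynomial ring is infinite-dimensional, so finiteness enters through a finite set
  \<open>T\<close> spanning the spaces concerned.\<close>

lemma dim_mono_finite:
  assumes "U \<subseteq> span V" "V \<subseteq> span T" "finite T"
  shows "dim U \<le> dim V"
proof -
  obtain C where C: "C \<subseteq> V" "independent C" "V \<subseteq> span C" "card C = dim V" by (rule basis_exists)
  have "finite C" using independent_span_bound[OF assms(3) C(2)] C(1) assms(2) by auto
  moreover have "span V \<subseteq> span C" using C(3) by (intro span_minimal) auto
  ultimately show ?thesis using dim_le_card[of U C] assms(1) C(4) by auto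
qed

lemma independent_card_le_dim_finite:
  assumes "B \<subseteq> V" "independent B" "V \<subseteq> span T" "finite T"
  shows "finite B" "card B \<le> dim V"
proof -
  show "finite B" using independent_span_bound[OF assms(4,2)] assms(1,3) by auto
  have "dim B \<le> dim V" using assms by (intro dim_mono_finite) (auto intro: span_base)
  then show "card B \<le> dim V" using dim_eq_card_independent[OF assms(2)] by simp
qed

lemma subspace_eq_if_dim_le:
  assumes "subspace U" "U \<subseteq> V" "dim V \<le> dim U" "V \<subseteq> span T" "finite T"
  shows "U = V"
proof (rule ccontr)
  assume "U \<noteq> V"
  then obtain x where x: "x \<in> V" "x \<notin> U" using assms(2) by auto
  obtain B where B: "B \<subseteq> U" "independent B" "U \<subseteq> span B" "card B = dim U" by (rule basis_exists)
  have "x \<notin> span B" using x(2) span_minimal[OF B(1) assms(1)] by auto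
  then have "independent (insert x B)" "x \<notin> B" using B(2) by (auto simp: independent_insert span_base)
  then have "card (insert x B) \<le> dim V" "finite (insert x B)"
    using independent_card_le_dim_finite[of "insert x B" V T] x(1) B(1) assms(2,4,5) by auto
  then show False using \<open>x \<notin> B\<close> B(4) assms(3) by simp
qed

text \<open>Rank-nullity for the map from \<open>V\<close> to the quotient by \<open>A\<close>: a
  basis of its kernel is extended to \<open>V\<close>, and the images of the added vectors complete
  a basis of \<open>A\<close> to one of the sum.\<close>

lemma dim_add_image:
  assumes f: "Vector_Spaces.linear scale scale f" and A: "subspace A" "A \<subseteq> span S" "finite S"
    and V: "subspace V" "V \<subseteq> span T" "finite T"
  shows "dim {a + f v | a v. a \<in> A \<and> v \<in> V} + dim {v \<in> V. f v \<in> A} = dim A + dim V"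
proof -
  interpret f: Vector_Spaces.linear scale scale f by (rule f)
  define K where "K = {v \<in> V. f v \<in> A}"
  obtain k where k: "k \<subseteq> K" "independent k" "K \<subseteq> span k" "card k = dim K" by (rule basis_exists)
  have "k \<subseteq> V" using k(1) by (auto simp: K_def)
  then obtain B where B: "k \<subseteq> B" "B \<subseteq> V" "independent B" "V \<subseteq> span B"
    using maximal_independent_subset_extend k(2) by blast
  have finB: "finite B" using independent_card_le_dim_finite(1)[OF B(2,3) V(2,3)] .
  have cardB: "card B = dim V" using basis_card_eq_dim[OF B(2,4,3)] .
  obtain C where C: "C \<subseteq> A" "independent C" "A \<subseteq> span C" "card C = dim A" by (rule basis_exists)
  have finC: "finite C" using independent_card_le_dim_finite(1)[OF C(1,2) A(2,3)] .
  have indep: "independent (C \<union> f ` E) \<and> card (C \<union> f ` E) = card C + card E"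
    if "finite E" "E \<subseteq> B - k" for E
    using that
  proof (induction E rule: finite_induct)
    case empty
    then show ?case using C(2) by simp
  next
    case (insert x E)
    have "f x \<notin> span (C \<union> f ` E)"
    proof
      assume "f x \<in> span (C \<union> f ` E)"
      then obtain a b where ab: "f x = a + b" "a \<in> span C" "b \<in> span (f ` E)"
        by (auto simp: span_Un)
      then obtain y where y: "y \<in> span E" "b = f y" by (auto simp: f.span_image)
      have "f (x - y) = a" using ab(1) y(2) by (simp add: f.diff)
      then have "f (x - y) \<in> A" using ab(2) span_minimal[OF C(1) A(1)] by auto
      moreover have "E \<subseteq> V" using insert.prems B(2) by blast
      then have "y \<in> V" using y(1) span_minimal[OF _ V(1)] by blast
      moreover have "x \<in> V" using insert.prems B(2) by blast
      ultimately have "x - y \<in> span k" using k(3) subspace_diff[OF V(1)] by (auto simp: K_def)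
      then have "(x - y) + y \<in> span (B - {x})"
        using y(1) insert.prems insert.hyps(2) B(1) span_mono[of k "B - {x}"] span_mono[of E "B - {x}"]
        by (intro span_add) blast+
      then have "x \<in> span (B - {x})" by simp
      then show False using B(3) insert.prems by (auto simp: dependent_def)
    qed
    moreover have "f x \<notin> C \<union> f ` E" using calculation span_base[of "f x" "C \<union> f ` E"] by auto
    ultimately show ?case
      using insert finC by (auto simp: independent_insert)
  qed
  define T' where "T' = {a + f v | a v. a \<in> A \<and> v \<in> V}"
  let ?E = "C \<union> f ` (B - k)"
  have E: "independent ?E" "card ?E = card C + card (B - k)"
    using indep[of "B - k"] finB by auto
  have A0: "0 \<in> A" and V0: "0 \<in> V" using A(1) V(1) by (auto simp: subspace_0)
  have "?E \<subseteq> T'"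
  proof
    fix x assume "x \<in> ?E"
    then consider "x \<in> C" | y where "y \<in> B" "x = f y" by blast
    then show "x \<in> T'"
    proof cases
      case 1
      then have "x = x + f 0" "x \<in> A" using C(1) by auto
      then show ?thesis unfolding T'_def using V0 by blast
    next
      case 2
      then have "x = 0 + f y" "y \<in> V" using B(2) by auto
      then show ?thesis unfolding T'_def using A0 by blast
    qed
  qed
  moreover have "T' \<subseteq> span ?E"
  proof
    fix x assume "x \<in> T'"
    then obtain a v where av: "x = a + f v" "a \<in> A" "v \<in> V" unfolding T'_def by blast
    have sub: "subspace {v. f v \<in> span ?E}" by (rule f.subspace_linear_preimage) simp
    have Ain: "a \<in> span ?E" if "a \<in> A" for a using that C(3) span_mono[of C ?E] by blast
    have "f b \<in> span ?E" if "b \<in> B" for b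
    proof (cases "b \<in> k")
      case True
      then show ?thesis using k(1) Ain by (auto simp: K_def)
    next
      case False
      then show ?thesis using that by (intro span_base) auto
    qed
    then have "span B \<subseteq> {v. f v \<in> span ?E}" using sub by (intro span_minimal) auto
    then show "x \<in> span ?E" using av B(4) Ain by (auto intro!: span_add)
  qed
  ultimately have "dim T' = card C + card (B - k)"
    using basis_card_eq_dim[OF _ _ E(1), of T'] E(2) by simp
  moreover have "card (B - k) + card k = card B"
    using B(1) finB by (metis card_Diff_subset card_mono finite_subset le_add_diff_inverse2)
  ultimately have "dim T' + card k = card C + card B" by simp
  then show ?thesis using k(4) C(4) cardB unfolding T'_def K_def by simp
qed

text \<open>The determinant of the coordinate matrix of the perturbed family is a polynomial in \<open>t\<close>
  that does not vanish at \<open>t = 0\<close>.\<close>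

lemma independent_perturbation:
  assumes B: "finite B" "independent B"
  shows "finite {t. \<exists>u. (\<Sum>w\<in>B. u w *s (w + t *s h w)) = 0 \<and> (\<exists>w\<in>B. u w \<noteq> 0)}"
proof -
  \<comment> \<open>Coordinates in a basis of the whole space. Only those at members of
    \<open>B\<close> enter the matrix, so \<open>h w\<close> may leave the span of
    \<open>B\<close>.\<close>
  let ?R = "representation (extend_basis B)"
  have E: "independent (extend_basis B)" "x \<in> span (extend_basis B)" for x
    using independent_extend_basis[OF B(2)] span_extend_basis[OF B(2)] by auto
  have RB: "?R w = (\<lambda>v. if v = w then 1 else 0)" if "w \<in> B" for w
    using that extend_basis_superset[OF B(2)] by (intro representation_basis[OF E(1)]) auto
  obtain bs where bs: "set bs = B" "distinct bs" using finite_distinct_list[OF B(1)] by blast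
  define n where "n = length bs"
  define M where "M = mat n n (\<lambda>(i, j). [:if i = j then 1 else 0, ?R (h (bs ! j)) (bs ! i):])"
  define Mt where "Mt t = mat n n (\<lambda>(i, j). (if i = j then 1 else 0) + t * ?R (h (bs ! j)) (bs ! i))" for t
  have eval: "poly (det M) t = det (Mt t)" for t
  proof -
    interpret ev: comm_ring_hom "\<lambda>p. poly p t" by unfold_locales auto
    have "map_mat (\<lambda>p. poly p t) M = Mt t"
      by (rule eq_matI) (auto simp: M_def Mt_def)
    then show ?thesis using ev.hom_det[of M] by simp
  qed
  have "Mt 0 = 1\<^sub>m n" by (rule eq_matI) (auto simp: Mt_def)
  then have "poly (det M) 0 = 1" unfolding eval by simp
  then have "det M \<noteq> 0" by auto
  then have fin: "finite {t. poly (det M) t = 0}" by (rule poly_roots_finite)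
  have "det (Mt t) = 0" if u: "(\<Sum>w\<in>B. u w *s (w + t *s h w)) = 0" "w \<in> B" "u w \<noteq> 0" for t u w
  proof -
    let ?v = "vec n (\<lambda>j. u (bs ! j))"
    have bij: "bij_betw ((!) bs) {..<n} B"
      using bs unfolding n_def by (metis bij_betw_nth)
    have nth: "bs ! i \<in> B" if "i < n" for i using that bs(1) unfolding n_def by auto
    have "(Mt t *\<^sub>v ?v) $ i = 0" if i: "i < n" for i
    proof -
      have "?R (\<Sum>w\<in>B. u w *s (w + t *s h w)) (bs ! i) =
          (\<Sum>w\<in>B. u w * (?R w (bs ! i) + t * ?R (h w) (bs ! i)))"
        by (simp add: representation_sum[OF E] representation_scale[OF E] representation_add[OF E(1) E(2) E(2)])
      also have "\<dots> = (\<Sum>j<n. u (bs ! j) * (?R (bs ! j) (bs ! i) + t * ?R (h (bs ! j)) (bs ! i)))"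
        by (rule sum.reindex_bij_betw[OF bij, symmetric])
      also have "\<dots> = (\<Sum>j<n. ((if i = j then 1 else 0) + t * ?R (h (bs ! j)) (bs ! i)) * u (bs ! j))"
      proof (rule sum.cong[OF refl])
        fix j assume "j \<in> {..<n}"
        then have "?R (bs ! j) (bs ! i) = (if i = j then 1 else 0)"
          using RB[OF nth[of j]] i bs(2) by (auto simp: n_def nth_eq_iff_index_eq)
        then show "u (bs ! j) * (?R (bs ! j) (bs ! i) + t * ?R (h (bs ! j)) (bs ! i)) =
            ((if i = j then 1 else 0) + t * ?R (h (bs ! j)) (bs ! i)) * u (bs ! j)" by simp
      qed
      also have "\<dots> = (Mt t *\<^sub>v ?v) $ i"
        using i by (simp add: Mt_def scalar_prod_def atLeast0LessThan)
      finally show ?thesis using u(1) by (simp add: representation_zero)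
    qed
    then have "Mt t *\<^sub>v ?v = 0\<^sub>v n" by (intro eq_vecI) (auto simp: Mt_def)
    moreover obtain j where "j < n" "bs ! j = w" using u(2) bs(1) unfolding n_def by (metis in_set_conv_nth)
    then have "?v \<noteq> 0\<^sub>v n" using u(3) by (metis index_vec index_zero_vec(1))
    moreover have "Mt t \<in> carrier_mat n n" by (simp add: Mt_def)
    ultimately show ?thesis using det_0_iff_vec_prod_zero_field[of "Mt t" n] by (metis vec_carrier)
  qed
  then have "{t. \<exists>u. (\<Sum>w\<in>B. u w *s (w + t *s h w)) = 0 \<and> (\<exists>w\<in>B. u w \<noteq> 0)} \<subseteq> {t. poly (det M) t = 0}"
    unfolding eval by blast
  then show ?thesis using fin finite_subset by blast
qed

text \<open>Independence is meant for the family indexed by \<open>B\<close>, the form in which the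
  perturbed basis arises; it forces \<open>g\<close> to be injective.\<close>

lemma card_le_dim_if_family_independent:
  assumes B: "finite B" and u: "\<And>u. (\<Sum>w\<in>B. u w *s g w) = 0 \<Longrightarrow> (\<forall>w\<in>B. u w = 0)"
    and V: "g ` B \<subseteq> V" "V \<subseteq> span T" "finite T"
  shows "card B \<le> dim V"
proof -
  have inj: "inj_on g B"
  proof (rule inj_onI, rule ccontr)
    fix x y assume xy: "x \<in> B" "y \<in> B" "g x = g y" "x \<noteq> y"
    let ?u = "\<lambda>w. if w = x then 1 else if w = y then - 1 else 0"
    have "(\<Sum>w\<in>B. ?u w *s g w) = (\<Sum>w\<in>{x, y}. ?u w *s g w)"
      using B xy(1,2) by (intro sum.mono_neutral_right) auto
    also have "\<dots> = 0" using xy(3,4) by simp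
    finally have sum: "(\<Sum>w\<in>B. ?u w *s g w) = 0" .
    show False using bspec[OF u[OF sum] xy(1)] by simp
  qed
  have "independent (g ` B)"
  proof (rule independent_if_scalars_zero)
    show "finite (g ` B)" using B by simp
    fix f x assume sum: "(\<Sum>x\<in>g ` B. f x *s x) = 0" and x: "x \<in> g ` B"
    have "(\<Sum>w\<in>B. f (g w) *s g w) = 0" using sum by (simp add: sum.reindex[OF inj])
    then show "f x = 0" using u[of "\<lambda>w. f (g w)"] x by auto
  qed
  then have "card (g ` B) \<le> dim V" by (rule independent_card_le_dim_finite(2)[OF V(1) _ V(2,3)])
  then show ?thesis by (simp add: card_image[OF inj])
qed

end

subsection \<open>The Lefschetz property as a rank condition\<close>

text \<open>Full rank on the quotient by \<open>J\<close>, read on representatives. Integer degrees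
  allow the shift to \<open>e - 1\<close> without a case distinction.\<close>

definition lefschetz :: "('n::finite, 'k::field) mpoly set \<Rightarrow> ('n, 'k) mpoly \<Rightarrow> int \<Rightarrow> bool" where
  "lefschetz J h e \<longleftrightarrow>
     (\<forall>x. homogeneous e x \<longrightarrow> h * x \<in> J \<longrightarrow> x \<in> J) \<or>
     (\<forall>y. homogeneous (e + 1) y \<longrightarrow> (\<exists>x. homogeneous e x \<and> y - h * x \<in> J))"

abbreviation hom_part :: "int \<Rightarrow> ('n::finite, 'k::field) mpoly set" where
  "hom_part e \<equiv> {p. homogeneous e p}"

text \<open>For an ideal this complements the Hilbert function of the quotient; dimensions are
  counted inside the polynomial ring so that no quotient spaces occur.\<close>

definition hom_dim :: "('n::finite, 'k::field) mpoly set \<Rightarrow> int \<Rightarrow> nat" where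
  "hom_dim J e = poly_vs.dim (J \<inter> hom_part e)"

lemma hom_part_subspace: "poly_vs.subspace (hom_part e)"
  by (rule poly_vs.subspaceI) (auto intro: homogeneous_add homogeneous_cscale)

lemma ideal_poly_subspace: "ring_module.subspace J \<Longrightarrow> poly_vs.subspace J"
  by (rule poly_vs.subspaceI)
    (auto intro: ring_module.subspace_0 ring_module.subspace_add ideal_cscale)

lemma finite_mono_degree: "finite {m :: 'n::finite \<Rightarrow>\<^sub>0 nat. int (mono_degree m) = e}"
proof -
  let ?M = "{m :: 'n \<Rightarrow>\<^sub>0 nat. int (mono_degree m) = e}"
  have "lookup m i \<le> nat e" if "m \<in> ?M" for m i
  proof -
    have "mono_degree m = nat e" using that by auto
    then show ?thesis using member_le_sum[of i UNIV "lookup m"] by (simp add: mono_degree_def)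
  qed
  then have "lookup ` ?M \<subseteq> Pi\<^sub>E UNIV (\<lambda>_. {..nat e})" by (auto simp: PiE_def)
  moreover have "finite (Pi\<^sub>E (UNIV :: 'n set) (\<lambda>_. {..nat e}))" by (rule finite_PiE) auto
  ultimately have "finite (lookup ` ?M)" using finite_subset by blast
  moreover have "inj_on lookup ?M" by (rule inj_onI) (rule poly_mapping_eqI, simp)
  ultimately show ?thesis using finite_imageD by blast
qed

lemma hom_part_finite_span:
  obtains T :: "('n::finite, 'k::field) mpoly set" where "finite T" "hom_part e \<subseteq> poly_vs.span T"
proof -
  let ?T = "(\<lambda>m. single m (1::'k)) ` {m :: 'n \<Rightarrow>\<^sub>0 nat. int (mono_degree m) = e}"
  have "p \<in> poly_vs.span ?T" if "homogeneous e p" for p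
  proof -
    have "single m (lookup p m) \<in> poly_vs.span ?T"
      if "m \<in> keys p" for m
    proof -
      have "int (mono_degree m) = e" using that \<open>homogeneous e p\<close> by (simp add: homogeneous_def)
      then have "cscale (lookup p m) (single m 1) \<in> poly_vs.span ?T"
        by (intro poly_vs.span_scale poly_vs.span_base) auto
      then show ?thesis by (simp add: cscale_def mult_single)
    qed
    then have "(\<Sum>m\<in>keys p. single m (lookup p m)) \<in> poly_vs.span ?T"
      by (rule poly_vs.span_sum)
    then show ?thesis by (simp only: sum_single_keys)
  qed
  moreover have "finite ?T" by (intro finite_imageI finite_mono_degree)
  ultimately show ?thesis by (intro that[of ?T]) auto
qed

text \<open>In degree \<open>e + 1\<close> the ideal generated by \<open>h\<close> and
  \<open>J\<close> is the sum of \<open>J\<close> and \<open>h\<close> times all forms of degree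
  \<open>e\<close>. By rank-nullity its dimension is governed by the space \<open>K\<close> of those
  \<open>v\<close> with \<open>h * v \<in> J\<close>, which contains \<open>J\<close> in degree
  \<open>e\<close>. Equality in the first bound means injectivity; filling all of degree
  \<open>e + 1\<close> means surjectivity.\<close>

lemma
  fixes J :: "('n::finite, 'k::field) mpoly set"
  assumes J: "graded_ideal J" and h: "homogeneous 1 h"
  shows hom_dim_insert_le_sum:
      "hom_dim (ring_module.span (insert h J)) (e + 1) + hom_dim J e
        \<le> hom_dim J (e + 1) + poly_vs.dim (hom_part e :: ('n, 'k) mpoly set)" (is ?A)
    and hom_dim_le: "hom_dim J e \<le> poly_vs.dim (hom_part e :: ('n, 'k) mpoly set)" (is ?B)
    and lefschetz_iff_hom_dim: "lefschetz J h e \<longleftrightarrow>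
      hom_dim (ring_module.span (insert h J)) (e + 1) + hom_dim J e
        = hom_dim J (e + 1) + poly_vs.dim (hom_part e :: ('n, 'k) mpoly set) \<or>
      hom_dim (ring_module.span (insert h J)) (e + 1) = poly_vs.dim (hom_part (e + 1) :: ('n, 'k) mpoly set)"
      (is ?C)
proof -
  obtain S :: "('n, 'k) mpoly set" where S: "finite S" "hom_part (e + 1) \<subseteq> poly_vs.span S"
    by (rule hom_part_finite_span)
  obtain T :: "('n, 'k) mpoly set" where T: "finite T" "hom_part e \<subseteq> poly_vs.span T"
    by (rule hom_part_finite_span)
  have Jr: "ring_module.subspace J" using J by (rule graded_idealD)
  have sub: "poly_vs.subspace (J \<inter> hom_part d)" for d
    by (intro poly_vs.subspace_inter ideal_poly_subspace Jr hom_part_subspace)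
  show ?B unfolding hom_dim_def using T by (intro poly_vs.dim_mono_finite) (auto intro: poly_vs.span_base)
  let ?J = "ring_module.span (insert h J)"
  have T': "?J \<inter> hom_part (e + 1) = {a + h * v | a v. a \<in> J \<inter> hom_part (e + 1) \<and> v \<in> hom_part e}" (is "?L = ?R")
  proof
    show "?L \<subseteq> ?R"
    proof
      fix x assume x: "x \<in> ?L"
      then obtain v where v: "homogeneous (e + 1 - 1) v" "x - v * h \<in> J"
        using homogeneous_span_insert[OF J h, of "e + 1" x] by auto
      have "homogeneous (e + 1) (x - h * v)"
        using x v(1) h by (intro homogeneous_diff homogeneous_mult_eq[of 1 h e v]) auto
      moreover have "x = (x - h * v) + h * v" by simp
      moreover have "x - h * v \<in> J" using v(2) by (simp add: mult.commute)
      ultimately show "x \<in> ?R"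
        using v(1) by (intro CollectI exI[of _ "x - h * v"] exI[of _ v]) auto
    qed
    show "?R \<subseteq> ?L"
    proof
      fix x assume "x \<in> ?R"
      then obtain a v where av: "x = a + h * v" "a \<in> J" "homogeneous (e + 1) a" "homogeneous e v" by blast
      have "h * v \<in> ?J"
        by (intro subspace_mult_right ring_module.span_base) auto
      then have "x \<in> ?J" unfolding av(1) using av(2) by (intro ring_module.span_add) (auto intro: ring_module.span_base)
      moreover have "homogeneous (e + 1) x"
        unfolding av(1) using av h by (intro homogeneous_add homogeneous_mult_eq[of 1 h e v]) auto
      ultimately show "x \<in> ?L" by simp
    qed
  qed
  have lin: "Vector_Spaces.linear cscale cscale ((*) h)"
    unfolding Vector_Spaces.linear_iff by (auto simp: distrib_left cscale_mult_right poly_vs.vector_space_axioms)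
  define K where "K = {v \<in> hom_part e. h * v \<in> J \<inter> hom_part (e + 1)}"
  have K: "K = {v. homogeneous e v \<and> h * v \<in> J}"
    unfolding K_def using homogeneous_mult_eq[OF h, of e _ "e + 1"] by auto
  have rank: "hom_dim ?J (e + 1) + poly_vs.dim K = hom_dim J (e + 1) + poly_vs.dim (hom_part e :: ('n, 'k) mpoly set)"
    unfolding hom_dim_def T' K_def
    using S(2) by (intro poly_vs.dim_add_image[OF lin sub _ S(1) hom_part_subspace T(2,1)]) auto
  have JK: "J \<inter> hom_part e \<subseteq> K" unfolding K using ring_module.subspace_scale[OF Jr] by auto
  have KT: "K \<subseteq> poly_vs.span T" using T(2) by (auto simp: K)
  have le: "hom_dim J e \<le> poly_vs.dim K"
    unfolding hom_dim_def using JK KT T(1)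
    by (intro poly_vs.dim_mono_finite) (auto intro: poly_vs.span_base)
  then show ?A using rank by simp
  have "(\<forall>x. homogeneous e x \<longrightarrow> h * x \<in> J \<longrightarrow> x \<in> J) \<longleftrightarrow> J \<inter> hom_part e = K"
    using JK unfolding K by auto
  also have "\<dots> \<longleftrightarrow> poly_vs.dim K = hom_dim J e"
    using poly_vs.subspace_eq_if_dim_le[OF sub JK _ KT T(1)] unfolding hom_dim_def by auto
  finally have inj: "(\<forall>x. homogeneous e x \<longrightarrow> h * x \<in> J \<longrightarrow> x \<in> J) \<longleftrightarrow>
      hom_dim ?J (e + 1) + hom_dim J e = hom_dim J (e + 1) + poly_vs.dim (hom_part e :: ('n, 'k) mpoly set)"
    using rank by auto
  have "graded_ideal ?J" using graded_ideal_span_Un[OF J, of "{h}"] h by auto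
  then have sub': "poly_vs.subspace (?J \<inter> hom_part (e + 1))"
    by (intro poly_vs.subspace_inter ideal_poly_subspace hom_part_subspace) auto
  have "(\<forall>y. homogeneous (e + 1) y \<longrightarrow> (\<exists>x. homogeneous e x \<and> y - h * x \<in> J)) \<longleftrightarrow>
      ?J \<inter> hom_part (e + 1) = hom_part (e + 1)"
  proof
    assume *: "\<forall>y. homogeneous (e + 1) y \<longrightarrow> (\<exists>x. homogeneous e x \<and> y - h * x \<in> J)"
    have "y \<in> ?J" if y: "homogeneous (e + 1) y" for y
    proof -
      obtain x where "y - h * x \<in> J" using * y by blast
      then have "(y - h * x) + h * x \<in> ?J"
        by (intro ring_module.span_add subspace_mult_right) (auto intro: ring_module.span_base)
      then show ?thesis by simp
    qed
    then show "?J \<inter> hom_part (e + 1) = hom_part (e + 1)" by auto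
  next
    assume *: "?J \<inter> hom_part (e + 1) = hom_part (e + 1)"
    show "\<forall>y. homogeneous (e + 1) y \<longrightarrow> (\<exists>x. homogeneous e x \<and> y - h * x \<in> J)"
    proof (intro allI impI)
      fix y :: "('n, 'k) mpoly" assume y: "homogeneous (e + 1) y"
      then have "y \<in> ?J" using * by auto
      then obtain x where "homogeneous (e + 1 - 1) x" "y - x * h \<in> J"
        by (rule homogeneous_span_insert[OF J h y])
      then show "\<exists>x. homogeneous e x \<and> y - h * x \<in> J" by (auto simp: mult.commute)
    qed
  qed
  also have "\<dots> \<longleftrightarrow> hom_dim ?J (e + 1) = poly_vs.dim (hom_part (e + 1) :: ('n, 'k) mpoly set)"
    using poly_vs.subspace_eq_if_dim_le[OF sub' _ _ S(2,1)] unfolding hom_dim_def by auto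
  finally show ?C unfolding lefschetz_def inj by simp
qed

lemma lefschetz_negative: "ring_module.subspace J \<Longrightarrow> e < 0 \<Longrightarrow> lefschetz J h e"
  unfolding lefschetz_def using homogeneous_neg_degree ring_module.subspace_0 by metis

section \<open>Semicontinuity of dimensions under a change of one linear form\<close>

definition partial_ideal ::
  "('n::finite, 'k::field) mpoly set \<Rightarrow> (nat \<Rightarrow> ('n, 'k) mpoly) \<Rightarrow> nat \<Rightarrow> ('n, 'k) mpoly set" where
  "partial_ideal I l i = ring_module.span (I \<union> l ` {..<i})"

lemma partial_ideal_0: "ring_module.subspace I \<Longrightarrow> partial_ideal I l 0 = I"
  by (simp add: partial_ideal_def)

lemma partial_ideal_Suc:
  "partial_ideal I l (Suc i) = ring_module.span (insert (l i) (partial_ideal I l i))"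
  unfolding partial_ideal_def span_insert_span by (simp add: lessThan_Suc)

lemma partial_ideal_graded:
  assumes "graded_ideal I" "\<And>j. j < i \<Longrightarrow> homogeneous 1 (l j)"
  shows "graded_ideal (partial_ideal I l i)"
  unfolding partial_ideal_def using assms by (intro graded_ideal_span_Un) (auto intro!: exI[of _ 1])

text \<open>Full rank for \<open>l\<close> makes each dimension as large as the preceding ones
  allow. By induction on \<open>i\<close> a sequence whose dimensions are at least as large has the
  same dimensions, and these determine whether the rank is full.\<close>

lemma lefschetz_hom_dim_ge:
  fixes I :: "('n::finite, 'k::field) mpoly set"
  assumes I: "graded_ideal I"
    and l: "\<And>i. homogeneous 1 (l i)" "\<And>i e. i < k \<Longrightarrow> e + 1 < N \<Longrightarrow> lefschetz (partial_ideal I l i) (l i) e"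
    and l': "\<And>i. homogeneous 1 (l' i)"
    and ge: "\<And>i e. i \<le> k \<Longrightarrow> e < N \<Longrightarrow> hom_dim (partial_ideal I l i) e \<le> hom_dim (partial_ideal I l' i) e"
    and "i < k" "e + 1 < N"
  shows "lefschetz (partial_ideal I l' i) (l' i) e"
proof -
  let ?h = "\<lambda>e. poly_vs.dim (hom_part e :: ('n, 'k) mpoly set)"
  have gr: "graded_ideal (partial_ideal I l i)" "graded_ideal (partial_ideal I l' i)" for i
    using I l(1) l'(1) by (auto intro: partial_ideal_graded)
  have le_sum: "hom_dim (partial_ideal I l' (Suc i)) (e + 1) + hom_dim (partial_ideal I l' i) e
      \<le> hom_dim (partial_ideal I l' i) (e + 1) + ?h e" for i e
    using hom_dim_insert_le_sum[OF gr(2) l'] by (simp only: partial_ideal_Suc)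
  have iff: "lefschetz (partial_ideal I l i) (l i) e \<longleftrightarrow>
      hom_dim (partial_ideal I l (Suc i)) (e + 1) + hom_dim (partial_ideal I l i) e
        = hom_dim (partial_ideal I l i) (e + 1) + ?h e \<or>
      hom_dim (partial_ideal I l (Suc i)) (e + 1) = ?h (e + 1)" for i e
    using lefschetz_iff_hom_dim[OF gr(1) l(1)] by (simp only: partial_ideal_Suc)
  have iff': "lefschetz (partial_ideal I l' i) (l' i) e \<longleftrightarrow>
      hom_dim (partial_ideal I l' (Suc i)) (e + 1) + hom_dim (partial_ideal I l' i) e
        = hom_dim (partial_ideal I l' i) (e + 1) + ?h e \<or>
      hom_dim (partial_ideal I l' (Suc i)) (e + 1) = ?h (e + 1)" for i e
    using lefschetz_iff_hom_dim[OF gr(2) l'] by (simp only: partial_ideal_Suc)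
  have eq: "hom_dim (partial_ideal I l' i) e = hom_dim (partial_ideal I l i) e" if "i \<le> k" "e < N" for i e
    using that
  proof (induction i arbitrary: e)
    case 0
    then show ?case using graded_idealD(1)[OF I] by (simp add: partial_ideal_0)
  next
    case (Suc i)
    have "lefschetz (partial_ideal I l i) (l i) (e - 1)" using Suc.prems by (intro l(2)) auto
    moreover have "hom_dim (partial_ideal I l' i) d = hom_dim (partial_ideal I l i) d" if "d \<le> e" for d
      using Suc that by auto
    moreover have "hom_dim (partial_ideal I l' (Suc i)) e \<le> ?h e" by (rule hom_dim_le[OF gr(2) l'])
    ultimately have "hom_dim (partial_ideal I l' (Suc i)) e \<le> hom_dim (partial_ideal I l (Suc i)) e"
      using iff[of i "e - 1"] le_sum[of i "e - 1"] by auto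
    then show ?case using ge[OF Suc.prems] by simp
  qed
  have "lefschetz (partial_ideal I l i) (l i) e" using assms(6,7) by (rule l(2))
  then show ?thesis
    unfolding iff iff' using eq[of i e] eq[of i "e + 1"] eq[of "Suc i" "e + 1"] assms(6,7) by simp
qed

text \<open>In an expression of \<open>w\<close> by generators, \<open>l j\<close> is replaced by
  its perturbation, and \<open>g\<close> is its coefficient. That \<open>g\<close> does not depend
  on \<open>t\<close> makes the lift affine in \<open>t\<close>, as
  \<open>independent_perturbation\<close> requires.\<close>

lemma partial_ideal_perturbation:
  assumes "w \<in> partial_ideal I l i" "j < i"
  shows "\<exists>g. \<forall>t. w + cscale t (g * b) \<in> partial_ideal I (l(j := l j + cscale t b)) i"
proof -
  let ?l = "\<lambda>t. l(j := l j + cscale t b)"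
  have sub: "ring_module.subspace (partial_ideal I (?l t) i)" for t by (simp add: partial_ideal_def)
  have gen: "x \<in> I \<union> ?l t ` {..<i} \<Longrightarrow> x \<in> partial_ideal I (?l t) i" for x t
    unfolding partial_ideal_def by (rule ring_module.span_base)
  show ?thesis
    using assms(1) unfolding partial_ideal_def[of I l i]
  proof (induction rule: ring_module.span_induct_alt)
    case base
    have "0 + cscale t (0 * b) \<in> partial_ideal I (?l t) i" for t
      using ring_module.subspace_0[OF sub, of t] by simp
    then show ?case by blast
  next
    case (step c x y)
    obtain g where g: "\<And>t. y + cscale t (g * b) \<in> partial_ideal I (?l t) i" using step by blast
    have "\<exists>g'. \<forall>t. x + cscale t (g' * b) \<in> partial_ideal I (?l t) i"
    proof (cases "x = l j")
      case True
      have "?l t j \<in> ?l t ` {..<i}" for t using assms(2) by blast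
      then have "x + cscale t (1 * b) \<in> partial_ideal I (?l t) i" for t
        using True by (intro gen) auto
      then show ?thesis by blast
    next
      case False
      have "x \<in> I \<union> ?l t ` {..<i}" for t using step(1) False by auto
      then have "x + cscale t (0 * b) \<in> partial_ideal I (?l t) i" for t
        using gen[of x t] by simp
      then show ?thesis by blast
    qed
    then obtain g' where g': "\<And>t. x + cscale t (g' * b) \<in> partial_ideal I (?l t) i" by blast
    have in_t: "c * (x + cscale t (g' * b)) + (y + cscale t (g * b)) \<in> partial_ideal I (?l t) i" for t
      by (intro ring_module.subspace_add[OF sub] ring_module.subspace_scale[OF sub] g g')
    have eq: "c * (x + cscale t (g' * b)) + (y + cscale t (g * b)) = c * x + y + cscale t ((c * g' + g) * b)" for t
      by (simp add: cscale_def algebra_simps)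
    show ?case using in_t unfolding eq by blast
  qed
qed

text \<open>A basis for \<open>t = 0\<close> lifts to elements of the perturbed ideals that are
  affine in \<open>t\<close> and remain independent for all but finitely many
  \<open>t\<close>.\<close>

lemma hom_dim_perturbation:
  fixes I :: "('n::finite, 'k::field) mpoly set"
  assumes I: "graded_ideal I" and l: "\<And>i. homogeneous 1 (l i)" and b: "homogeneous 1 b"
  shows "finite {t. hom_dim (partial_ideal I (l(j := l j + cscale t b)) i) e < hom_dim (partial_ideal I l i) e}"
proof (cases "j < i")
  case False
  then have "(l(j := l j + cscale t b)) ` {..<i} = l ` {..<i}" for t by (intro image_cong) auto
  then show ?thesis by (simp add: partial_ideal_def)
next
  case True
  let ?l = "\<lambda>t. l(j := l j + cscale t b)"
  have lin: "homogeneous 1 (?l t i)" for t i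
    using l b homogeneous_add[OF l homogeneous_cscale[OF b]] by simp
  have gr: "graded_ideal (partial_ideal I (?l t) i)" for t
    using I lin by (rule partial_ideal_graded)
  obtain T :: "('n, 'k) mpoly set" where T: "finite T" "hom_part e \<subseteq> poly_vs.span T"
    by (rule hom_part_finite_span)
  let ?U = "partial_ideal I l i \<inter> hom_part e"
  obtain B where B: "B \<subseteq> ?U" "poly_vs.independent B" "?U \<subseteq> poly_vs.span B" "card B = poly_vs.dim ?U"
    by (rule poly_vs.basis_exists)
  have "?U \<subseteq> poly_vs.span T" using T(2) by auto
  then have finB: "finite B" by (rule poly_vs.independent_card_le_dim_finite(1)[OF B(1,2) _ T(1)])
  have "\<exists>h. \<forall>t. w + cscale t h \<in> partial_ideal I (?l t) i \<inter> hom_part e" if w: "w \<in> B" for w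
  proof -
    have "w \<in> partial_ideal I l i" and homw: "homogeneous e w" using B(1) w by auto
    then obtain g where g: "\<And>t. w + cscale t (g * b) \<in> partial_ideal I (?l t) i"
      using partial_ideal_perturbation[OF _ True, of w I l b] by blast
    have comp: "hom_comp e (w + cscale t (g * b)) = w + cscale t (hom_comp (e - 1) g * b)" for t
      using hom_comp_mult[of 0 "single 0 t" e "g * b"] hom_comp_mult[OF b, of e g] homw
      by (simp add: hom_comp_add cscale_def mult.commute)
    have "hom_comp e (w + cscale t (g * b)) \<in> partial_ideal I (?l t) i \<inter> hom_part e" for t
      using graded_idealD(2)[OF gr g] by simp
    then show ?thesis unfolding comp by blast
  qed
  then obtain h where h: "\<And>w t. w \<in> B \<Longrightarrow> w + cscale t (h w) \<in> partial_ideal I (?l t) i \<inter> hom_part e"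
    by metis
  let ?bad = "{t. \<exists>u. (\<Sum>w\<in>B. cscale (u w) (w + cscale t (h w))) = 0 \<and> (\<exists>w\<in>B. u w \<noteq> 0)}"
  have le: "hom_dim (partial_ideal I l i) e \<le> hom_dim (partial_ideal I (?l t) i) e" if "t \<notin> ?bad" for t
  proof -
    have "card B \<le> poly_vs.dim (partial_ideal I (?l t) i \<inter> hom_part e)"
      using that h T
      by (intro poly_vs.card_le_dim_if_family_independent[OF finB, of "\<lambda>w. w + cscale t (h w)" _ T]) auto
    then show ?thesis by (simp add: hom_dim_def B(4))
  qed
  have "{t. hom_dim (partial_ideal I (?l t) i) e < hom_dim (partial_ideal I l i) e} \<subseteq> ?bad"
  proof (rule subsetI, rule ccontr)
    fix t assume t: "t \<in> {t. hom_dim (partial_ideal I (?l t) i) e < hom_dim (partial_ideal I l i) e}"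
      and "t \<notin> ?bad"
    show False using le[OF \<open>t \<notin> ?bad\<close>] t by simp
  qed
  moreover have "finite ?bad" by (rule poly_vs.independent_perturbation[OF finB B(2)])
  ultimately show ?thesis using finite_subset by blast
qed

text \<open>The forms are changed one after the other. A change of \<open>l j\<close> leaves the
  ideals up to index \<open>j\<close> alone, so what was achieved for earlier forms survives, and it
  costs finitely many values of \<open>t\<close> to keep the low-degree dimensions.\<close>

lemma generic_linear_forms:
  fixes I :: "('n::finite, 'k::field_char_0) mpoly set"
  assumes I: "graded_ideal I" and "j \<le> CARD('n)"
    and l0: "\<And>i. homogeneous 1 (l0 i)"
      "\<And>i e. i < k \<Longrightarrow> e + 1 < N \<Longrightarrow> lefschetz (partial_ideal I l0 i) (l0 i) e"
  shows "\<exists>l. (\<forall>i. homogeneous 1 (l i)) \<and>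
    (\<forall>i<j. l i \<notin> ring_module.span (l ` {..<i}) \<and>
      (\<exists>E. \<forall>e\<ge>E. \<forall>x. homogeneous e x \<longrightarrow> l i * x \<in> partial_ideal I l i \<longrightarrow> x \<in> partial_ideal I l i)) \<and>
    (\<forall>i<k. \<forall>e. e + 1 < N \<longrightarrow> lefschetz (partial_ideal I l i) (l i) e)"
  using assms(2)
proof (induction j)
  case 0
  then show ?case using l0 by blast
next
  case (Suc j)
  let ?good = "\<lambda>l i. l i \<notin> ring_module.span (l ` {..<i}) \<and>
      (\<exists>E. \<forall>e\<ge>E. \<forall>x. homogeneous e x \<longrightarrow> l i * x \<in> partial_ideal I l i \<longrightarrow> x \<in> partial_ideal I l i)"
  have "j \<le> CARD('n)" using Suc.prems by simp
  from Suc.IH[OF this] obtain l where l: "\<forall>i. homogeneous 1 (l i)" "\<forall>i<j. ?good l i"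
    "\<forall>i<k. \<forall>e. e + 1 < N \<longrightarrow> lefschetz (partial_ideal I l i) (l i) e" by (elim exE conjE) (rule that)
  have gr: "graded_ideal (partial_ideal I l j)" using I l(1) by (intro partial_ideal_graded) auto
  obtain \<P> where \<P>: "finite \<P>" "\<forall>P\<in>\<P>. ring_module.subspace P \<and> (\<exists>i. variable i \<notin> P)"
    "\<forall>h. homogeneous 1 h \<longrightarrow> (\<forall>P\<in>\<P>. h \<notin> P) \<longrightarrow> (\<exists>E. \<forall>e\<ge>E. \<forall>x. homogeneous e x \<longrightarrow>
      h * x \<in> partial_ideal I l j \<longrightarrow> x \<in> partial_ideal I l j)"
    using filter_regular_linear_forms[OF gr] by (elim exE conjE) (rule that)
  \<comment> \<open>Avoiding the ideal of the earlier forms makes the new form independent of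
    them.\<close>
  define \<P>' where "\<P>' = insert (ring_module.span (l ` {..<j})) \<P>"
  have \<P>': "finite \<P>'" "\<And>P. P \<in> \<P>' \<Longrightarrow> ring_module.subspace P \<and> (\<exists>i. variable i \<notin> P)"
    using \<P>(1,2) variable_not_in_linear_span[of j l] l(1) Suc.prems by (auto simp: \<P>'_def)
  obtain b where b: "homogeneous 1 b" "\<And>P. P \<in> \<P>' \<Longrightarrow> b \<notin> P"
    using linear_form_avoiding[OF \<P>'] by blast
  let ?l = "\<lambda>t. l(j := l j + cscale t b)"
  have lin: "homogeneous 1 (?l t i)" for t i
    using l(1) homogeneous_add[OF _ homogeneous_cscale[OF b(1)]] by simp
  let ?bad1 = "\<Union>P\<in>\<P>'. {t. l j + cscale t b \<in> P}"
  \<comment> \<open>The index \<open>k\<close> is included because the rank of the last form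
    involves the ideal that contains it. Negative degrees are empty, which leaves finitely many
    conditions.\<close>
  let ?bad2 = "\<Union>i\<in>{..k}. \<Union>e\<in>{0..<N}. {t. hom_dim (partial_ideal I (?l t) i) e < hom_dim (partial_ideal I l i) e}"
  have "finite ?bad1" using \<P>' b(2) by (intro finite_UN_I finite_line_meets_ideal) auto
  moreover have "finite ?bad2"
    using I l(1) b(1) by (intro finite_UN_I hom_dim_perturbation) auto
  ultimately have "finite (?bad1 \<union> ?bad2)" by blast
  then have "\<exists>t. t \<notin> ?bad1 \<union> ?bad2" by (rule ex_new_if_finite[OF infinite_UNIV_char_0])
  then obtain t where t: "t \<notin> ?bad1 \<union> ?bad2" by (elim exE) (rule that)
  have img: "?l t ` {..<i} = l ` {..<i}" if "i \<le> j" for i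
    using that by (intro image_cong) auto
  then have part: "partial_ideal I (?l t) i = partial_ideal I l i" if "i \<le> j" for i
    using that by (simp add: partial_ideal_def)
  have "?good (?l t) i" if "i < Suc j" for i
  proof (cases "i = j")
    case True
    have avoid: "l j + cscale t b \<notin> P" if "P \<in> \<P>'" for P using t that by blast
    then have "\<exists>E. \<forall>e\<ge>E. \<forall>x. homogeneous e x \<longrightarrow>
        (l j + cscale t b) * x \<in> partial_ideal I l j \<longrightarrow> x \<in> partial_ideal I l j"
      using lin[of t j] by (intro \<P>(3)[THEN spec, THEN mp, THEN mp]) (auto simp: \<P>'_def)
    moreover have "l j + cscale t b \<notin> ring_module.span (l ` {..<j})" by (rule avoid) (simp add: \<P>'_def)
    ultimately show ?thesis using True img[of j] part[of j] by simp
  next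
    case False
    then have "i < j" using that by simp
    then have "?good l i" using l(2) by blast
    then show ?thesis using \<open>i < j\<close> img[of i] part[of i] by simp
  qed
  moreover have "lefschetz (partial_ideal I (?l t) i) (?l t i) e" if "i < k" "e + 1 < N" for i e
  proof (rule lefschetz_hom_dim_ge[OF I, of l k N "?l t"])
    fix i e assume ie: "i \<le> k" "e < N"
    show "hom_dim (partial_ideal I l i) e \<le> hom_dim (partial_ideal I (?l t) i) e"
    proof (cases "e < 0")
      case True
      then have "hom_part e = ({0} :: ('n, 'k) mpoly set)" using homogeneous_neg_degree by auto
      moreover have "0 \<in> partial_ideal I l i" "0 \<in> partial_ideal I (?l t) i"
        by (simp_all add: partial_ideal_def ring_module.span_zero)
      ultimately have "partial_ideal I l i \<inter> hom_part e = partial_ideal I (?l t) i \<inter> hom_part e" by auto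
      then show ?thesis by (simp add: hom_dim_def)
    next
      case False
      show ?thesis
      proof (rule ccontr)
        assume "\<not> ?thesis"
        then have "t \<in> ?bad2" using ie False by (intro UN_I[of i] UN_I[of e]) auto
        then show False using t by blast
      qed
    qed
  qed (use l lin that in auto)
  ultimately show ?case using lin by (intro exI[of _ "?l t"]) blast
qed

subsection \<open>Quotient rings\<close>

text \<open>Following a homomorphism by a further quotient map gives again a homomorphism from the
  polynomial ring, so the nested quotients in \<open>k_WLP\<close> can be read on
  polynomials.\<close>

lemma quotient_hom:
  fixes \<pi> :: "'a::comm_ring_1 \<Rightarrow> 'b" and R :: "'b ring"
  assumes R: "ring R" and K: "ideal K R" and \<pi>: "\<pi> \<in> Ring.ring_hom class_ring R"
  shows "(\<lambda>x. K +>\<^bsub>R\<^esub> \<pi> x) \<in> Ring.ring_hom class_ring (R Quot K)"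
    and "K +>\<^bsub>R\<^esub> \<pi> x = K +>\<^bsub>R\<^esub> \<pi> y \<longleftrightarrow> \<pi> (x - y) \<in> K"
proof -
  interpret R: ring R by (rule R)
  show "(\<lambda>x. K +>\<^bsub>R\<^esub> \<pi> x) \<in> Ring.ring_hom class_ring (R Quot K)"
    using ring_hom_trans[OF \<pi> ideal.rcos_ring_hom[OF K]] by (simp add: comp_def)
  have car: "\<pi> z \<in> carrier R" for z using ring_hom_closed[OF \<pi>] by simp
  have "\<pi> (x - y) \<oplus>\<^bsub>R\<^esub> \<pi> y = \<pi> x"
    using ring_hom_add[OF \<pi>, of "x - y" y] by simp
  then have "\<pi> (x - y) = \<pi> x \<ominus>\<^bsub>R\<^esub> \<pi> y"
    using car[of x] car[of y] car[of "x - y"] by (metis R.add.inv_solve_right' R.minus_eq)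
  then show "K +>\<^bsub>R\<^esub> \<pi> x = K +>\<^bsub>R\<^esub> \<pi> y \<longleftrightarrow> \<pi> (x - y) \<in> K"
    using R.quotient_eq_iff_same_a_r_cos[OF K car car] by metis
qed

text \<open>Stated for any homomorphism whose fibres are the cosets of \<open>P\<close>, so as to
  cover both the first ring and its quotients.\<close>

lemma WLP_with_hom:
  fixes \<pi> :: "('n::finite, 'k::field) mpoly \<Rightarrow> 'b" and R :: "'b ring"
  assumes \<pi>: "\<pi> \<in> Ring.ring_hom class_ring R" and ker: "\<And>x y. \<pi> x = \<pi> y \<longleftrightarrow> x - y \<in> P"
    and h: "homogeneous 1 h"
  shows "WLP_with R (\<lambda>i. \<pi> ` standard_grading i) (\<pi> h) \<longleftrightarrow> (\<forall>i::nat. lefschetz P h (int i))"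
proof -
  have mult: "\<pi> h \<otimes>\<^bsub>R\<^esub> \<pi> x = \<pi> (h * x)" for x
    using ring_hom_mult[OF \<pi>, of h x] by simp
  have "full_rank (\<lambda>x. \<pi> h \<otimes>\<^bsub>R\<^esub> x) (\<pi> ` standard_grading i) (\<pi> ` standard_grading (i + 1))
      \<longleftrightarrow> lefschetz P h (int i)" for i
  proof -
    let ?V = "standard_grading i :: ('n, 'k) mpoly set"
    let ?W = "standard_grading (i + 1) :: ('n, 'k) mpoly set"
    have V: "x \<in> ?V \<longleftrightarrow> homogeneous (int i) x" and W: "x \<in> ?W \<longleftrightarrow> homogeneous (int i + 1) x" for x
      by (simp_all add: standard_grading_def add.commute)
    have "inj_on (\<lambda>x. \<pi> h \<otimes>\<^bsub>R\<^esub> x) (\<pi> ` ?V) \<longleftrightarrow> (\<forall>x\<in>?V. \<forall>y\<in>?V. h * x - h * y \<in> P \<longrightarrow> x - y \<in> P)"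
      unfolding inj_on_def by (simp add: mult ker)
    also have "\<dots> \<longleftrightarrow> (\<forall>x\<in>?V. h * x \<in> P \<longrightarrow> x \<in> P)"
    proof (intro iffI ballI impI)
      fix x assume *: "\<forall>x\<in>?V. \<forall>y\<in>?V. h * x - h * y \<in> P \<longrightarrow> x - y \<in> P" "x \<in> ?V" "h * x \<in> P"
      have "0 \<in> ?V" by (simp add: V)
      then have "h * x - h * 0 \<in> P \<longrightarrow> x - 0 \<in> P" using * by blast
      then show "x \<in> P" using *(3) by simp
    next
      fix x y assume *: "\<forall>x\<in>?V. h * x \<in> P \<longrightarrow> x \<in> P" "x \<in> ?V" "y \<in> ?V" "h * x - h * y \<in> P"
      have "x - y \<in> ?V" using *(2,3) by (simp add: V homogeneous_diff)
      then show "x - y \<in> P" using *(1,4) by (simp add: right_diff_distrib)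
    qed
    finally have inj: "inj_on (\<lambda>x. \<pi> h \<otimes>\<^bsub>R\<^esub> x) (\<pi> ` ?V) \<longleftrightarrow> (\<forall>x\<in>?V. h * x \<in> P \<longrightarrow> x \<in> P)" .
    have "(\<lambda>x. \<pi> h \<otimes>\<^bsub>R\<^esub> x) ` \<pi> ` ?V = (\<lambda>x. \<pi> (h * x)) ` ?V"
      unfolding image_image mult ..
    moreover have "h * x \<in> ?W" if "x \<in> ?V" for x
      using that homogeneous_mult_eq[OF h, of "int i" x] unfolding V W by (simp add: add.commute)
    then have "(\<lambda>x. \<pi> (h * x)) ` ?V \<subseteq> \<pi> ` ?W" by blast
    ultimately have "(\<lambda>x. \<pi> h \<otimes>\<^bsub>R\<^esub> x) ` \<pi> ` ?V = \<pi> ` ?W \<longleftrightarrow> \<pi> ` ?W \<subseteq> (\<lambda>x. \<pi> (h * x)) ` ?V"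
      by auto
    also have "\<dots> \<longleftrightarrow> (\<forall>y\<in>?W. \<exists>x\<in>?V. y - h * x \<in> P)"
      by (simp add: image_subset_iff image_iff ker)
    finally have surj: "(\<lambda>x. \<pi> h \<otimes>\<^bsub>R\<^esub> x) ` \<pi> ` ?V = \<pi> ` ?W \<longleftrightarrow> (\<forall>y\<in>?W. \<exists>x\<in>?V. y - h * x \<in> P)" .
    show ?thesis by (simp only: full_rank_def inj surj lefschetz_def Ball_def Bex_def V W)
  qed
  moreover have "\<pi> h \<in> \<pi> ` standard_grading 1" using h by (simp add: standard_grading_def)
  ultimately show ?thesis by (simp add: WLP_with_def)
qed

text \<open>The correspondence of ideals: the image of the span is an ideal of the quotient, and the
  preimage of the generated ideal is an ideal containing \<open>J\<close> and
  \<open>L\<close>.\<close>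

lemma genideal_quotient_iff:
  fixes J :: "'a::comm_ring_1 set" and L :: "'a set"
  assumes J: "ring_module.subspace J"
  defines "R \<equiv> (class_ring :: 'a ring) Quot J"
  defines "c \<equiv> (\<lambda>x. J +>\<^bsub>class_ring :: 'a ring\<^esub> x)"
  shows "ideal (genideal R (c ` L)) R" and "c x \<in> genideal R (c ` L) \<longleftrightarrow> x \<in> ring_module.span (J \<union> L)"
proof -
  have Ji: "ideal J (class_ring :: 'a ring)" using J by (simp add: ideal_class_ring_iff)
  interpret R: ring R unfolding R_def by (rule ideal.quotient_is_ring[OF Ji])
  have hom: "c \<in> Ring.ring_hom class_ring R"
    unfolding R_def c_def by (rule ideal.rcos_ring_hom[OF Ji])
  have car: "c z \<in> carrier R" for z using ring_hom_closed[OF hom] by simp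
  have carR: "carrier R = range c"
    unfolding R_def c_def FactRing_def A_RCOSETS_def' by auto
  have ceq: "c x = c y \<longleftrightarrow> x - y \<in> J" for x y
    using class_ring.ring_axioms quotient_hom(2)[OF class_ring.ring_axioms Ji, of "\<lambda>x. x" x y]
    unfolding c_def by (simp add: Ring.ring_hom_def)
  have add: "c x \<oplus>\<^bsub>R\<^esub> c y = c (x + y)" for x y using ring_hom_add[OF hom, of x y] by simp
  have mult: "c x \<otimes>\<^bsub>R\<^esub> c y = c (x * y)" for x y using ring_hom_mult[OF hom, of x y] by simp
  have zero: "\<zero>\<^bsub>R\<^esub> = c 0"
    using add[of 0 0] car[of 0] by (metis R.add.l_cancel_one' add_0)
  let ?K = "genideal R (c ` L)" and ?Q = "ring_module.span (J \<union> L)"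
  have Lcar: "c ` L \<subseteq> carrier R" using car by auto
  show K: "ideal ?K R" by (rule R.genideal_ideal[OF Lcar])
  interpret K: ideal ?K R by (rule K)
  have neg: "\<ominus>\<^bsub>R\<^esub> c x = c (- x)" for x
    using add[of "- x" x] car zero by (intro R.minus_equality) auto
  have "ideal (c ` ?Q) R"
  proof (rule idealI)
    show "ring R" by (rule R.ring_axioms)
    show "subgroup (c ` ?Q) (add_monoid R)"
    proof (rule subgroup.intro)
      show "c ` ?Q \<subseteq> carrier (add_monoid R)" using car by auto
      show "x \<otimes>\<^bsub>add_monoid R\<^esub> y \<in> c ` ?Q" if "x \<in> c ` ?Q" "y \<in> c ` ?Q" for x y
        using that by (auto simp: add intro!: imageI ring_module.span_add)
      show "\<one>\<^bsub>add_monoid R\<^esub> \<in> c ` ?Q" using zero by (auto intro!: imageI ring_module.span_zero)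
      show "inv\<^bsub>add_monoid R\<^esub> x \<in> c ` ?Q" if x: "x \<in> c ` ?Q" for x
      proof -
        obtain y where y: "x = c y" "y \<in> ?Q" using x by blast
        have "inv\<^bsub>add_monoid R\<^esub> x = c (- y)" using neg[of y] unfolding y(1) a_inv_def .
        then show ?thesis using ring_module.span_neg[OF y(2)] by simp
      qed
    qed
    show "x \<otimes>\<^bsub>R\<^esub> a \<in> c ` ?Q" if "a \<in> c ` ?Q" "x \<in> carrier R" for a x
      using that by (auto simp: carR mult intro!: imageI ring_module.span_scale)
    show "a \<otimes>\<^bsub>R\<^esub> x \<in> c ` ?Q" if "a \<in> c ` ?Q" "x \<in> carrier R" for a x
      using that by (auto simp: carR mult intro!: imageI subspace_mult_right)
  qed
  moreover have "c ` L \<subseteq> c ` ?Q" by (intro image_mono) (auto intro: ring_module.span_base)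
  ultimately have sub: "?K \<subseteq> c ` ?Q" by (rule R.genideal_minimal)
  show "c x \<in> ?K \<longleftrightarrow> x \<in> ?Q"
  proof
    assume "c x \<in> ?K"
    then obtain q where q: "q \<in> ?Q" "c x = c q" using sub by auto
    then have "x - q \<in> ?Q" by (intro ring_module.span_base) (simp add: ceq)
    then have "(x - q) + q \<in> ?Q" using q(1) by (rule ring_module.span_add)
    then show "x \<in> ?Q" by simp
  next
    assume x: "x \<in> ?Q"
    have "ring_module.subspace {x. c x \<in> ?K}"
    proof (rule ring_module.subspaceI)
      show "0 \<in> {x. c x \<in> ?K}" using K.zero_closed by (simp add: zero)
      show "x + y \<in> {x. c x \<in> ?K}" if "x \<in> {x. c x \<in> ?K}" "y \<in> {x. c x \<in> ?K}" for x y
        using that K.a_closed[of "c x" "c y"] by (simp add: add)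
      show "a * x \<in> {x. c x \<in> ?K}" if "x \<in> {x. c x \<in> ?K}" for a x
        using that K.I_l_closed[of "c x" "c a"] car by (simp add: mult)
    qed
    moreover have "J \<union> L \<subseteq> {x. c x \<in> ?K}"
    proof -
      have "c j = c 0" if "j \<in> J" for j using that by (simp add: ceq)
      then have "c j \<in> ?K" if "j \<in> J" for j using that K.zero_closed zero by simp
      moreover have "c x \<in> ?K" if "x \<in> L" for x using that R.genideal_self[OF Lcar] by blast
      ultimately show ?thesis by blast
    qed
    ultimately show "c x \<in> ?K" using x ring_module.span_minimal by blast
  qed
qed

text \<open>Residue classes are lifted to linear forms and the numbering is moved to start at 0, so
  that \<open>partial_ideal J l i\<close> contains exactly the forms before
  \<open>l i\<close>.\<close>

lemma quotient_k_WLP_iff: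
  fixes J :: "('n::finite, 'k::field) mpoly set"
  assumes J: "ring_module.subspace J" and k: "1 \<le> k"
  shows "quotient_k_WLP J k \<longleftrightarrow> (\<exists>l. (\<forall>i<k. homogeneous 1 (l i)) \<and>
    (\<forall>i<k. \<forall>e::nat. lefschetz (partial_ideal J l i) (l i) (int e)))"
proof -
  define R where "R = (class_ring :: ('n, 'k) mpoly ring) Quot J"
  define c where "c x = J +>\<^bsub>class_ring :: ('n, 'k) mpoly ring\<^esub> x" for x
  define G where "G i = c ` standard_grading i" for i
  have G: "quotient_grading (class_ring :: ('n, 'k) mpoly ring) standard_grading J = G"
    by (auto simp: quotient_grading_def G_def c_def fun_eq_iff)
  have Ji: "ideal J (class_ring :: ('n, 'k) mpoly ring)" using J by (simp add: ideal_class_ring_iff)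
  have id: "(\<lambda>x. x) \<in> Ring.ring_hom (class_ring :: ('n, 'k) mpoly ring) class_ring"
    by (simp add: Ring.ring_hom_def)
  have hom: "c \<in> Ring.ring_hom class_ring R" and ceq: "c x = c y \<longleftrightarrow> x - y \<in> J" for x y
    using quotient_hom[OF class_ring.ring_axioms Ji id] unfolding R_def c_def by auto
  have ringR: "ring R" unfolding R_def by (rule ideal.quotient_is_ring[OF Ji])
  let ?cond = "\<lambda>L. (\<forall>i\<in>{1..k}. L i \<in> G 1) \<and> WLP_with R G (L 1) \<and>
      (\<forall>i\<in>{2..k}. let K = genideal R (L ` {1..i - 1}) in
        WLP_with (R Quot K) (quotient_grading R G K) (K +>\<^bsub>R\<^esub> L i))"
  have equiv: "?cond L \<longleftrightarrow> (\<forall>i<k. \<forall>e::nat. lefschetz (partial_ideal J l i) (l i) (int e))"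
    if l: "\<And>i. i < k \<Longrightarrow> homogeneous 1 (l i)" and L: "\<And>i. i < k \<Longrightarrow> L (Suc i) = c (l i)" for l L
  proof -
    have "L i \<in> G 1" if "i \<in> {1..k}" for i
    proof -
      have "i = Suc (i - 1)" "i - 1 < k" using that by auto
      then obtain i' where i': "i = Suc i'" "i' < k" by blast
      then show ?thesis using l[of i'] by (simp add: L G_def standard_grading_def)
    qed
    moreover have "WLP_with R G (L 1) \<longleftrightarrow> (\<forall>e::nat. lefschetz (partial_ideal J l 0) (l 0) (int e))"
      using WLP_with_hom[OF hom ceq l[of 0]] L[of 0] k
      by (simp add: partial_ideal_0[OF J] G_def[abs_def])
    moreover have "(let K = genideal R (L ` {1..i}) in
        WLP_with (R Quot K) (quotient_grading R G K) (K +>\<^bsub>R\<^esub> L (Suc i))) \<longleftrightarrow>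
      (\<forall>e::nat. lefschetz (partial_ideal J l i) (l i) (int e))" if "i < k" for i
    proof -
      have "L ` {1..i} = L ` Suc ` {..<i}" by (simp add: image_Suc_lessThan)
      also have "\<dots> = c ` l ` {..<i}"
        unfolding image_image using that L by (intro image_cong) auto
      finally have img: "L ` {1..i} = c ` l ` {..<i}" .
      define K where "K = genideal R (c ` l ` {..<i})"
      have K: "ideal K R" "c x \<in> K \<longleftrightarrow> x \<in> partial_ideal J l i" for x
        using genideal_quotient_iff[OF J, where L = "l ` {..<i}"]
        unfolding K_def R_def c_def[abs_def] partial_ideal_def by auto
      note hom2 = quotient_hom[OF ringR K(1) hom]
      have "quotient_grading R G K = (\<lambda>i. (\<lambda>x. K +>\<^bsub>R\<^esub> c x) ` standard_grading i)"
        by (simp add: quotient_grading_def G_def fun_eq_iff image_image)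
      moreover have "WLP_with (R Quot K) (\<lambda>i. (\<lambda>x. K +>\<^bsub>R\<^esub> c x) ` standard_grading i) (K +>\<^bsub>R\<^esub> c (l i)) \<longleftrightarrow>
          (\<forall>e::nat. lefschetz (partial_ideal J l i) (l i) (int e))"
        by (rule WLP_with_hom[OF hom2(1)]) (use hom2(2) K(2) l that in auto)
      ultimately show ?thesis unfolding img K_def[symmetric] Let_def L[OF that] by simp
    qed
    moreover have "(\<forall>i\<in>{2..k}. P i) \<longleftrightarrow> (\<forall>i<k. i \<noteq> 0 \<longrightarrow> P (Suc i))" for P
    proof
      assume P: "\<forall>i<k. i \<noteq> 0 \<longrightarrow> P (Suc i)"
      show "\<forall>i\<in>{2..k}. P i"
      proof
        fix i assume "i \<in> {2..k}"
        then have "i - 1 < k" "i - 1 \<noteq> 0" "Suc (i - 1) = i" by auto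
        then show "P i" using P by metis
      qed
    qed auto
    ultimately have "?cond L \<longleftrightarrow> (\<forall>e::nat. lefschetz (partial_ideal J l 0) (l 0) (int e)) \<and>
        (\<forall>i<k. i \<noteq> 0 \<longrightarrow> (\<forall>e::nat. lefschetz (partial_ideal J l i) (l i) (int e)))"
      by simp
    also have "\<dots> \<longleftrightarrow> (\<forall>i<k. \<forall>e::nat. lefschetz (partial_ideal J l i) (l i) (int e))"
      using k by (metis One_nat_def Suc_le_lessD)
    finally show ?thesis .
  qed
  have "quotient_k_WLP J k \<longleftrightarrow> (\<exists>L. ?cond L)"
    unfolding quotient_k_WLP_def k_WLP_def G R_def[symmetric] ..
  also have "\<dots> \<longleftrightarrow> (\<exists>l. (\<forall>i<k. homogeneous 1 (l i)) \<and>
    (\<forall>i<k. \<forall>e::nat. lefschetz (partial_ideal J l i) (l i) (int e)))"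
  proof
    assume "\<exists>L. ?cond L"
    then obtain L where L: "?cond L" by (elim exE) (rule that)
    have "\<exists>x. homogeneous 1 x \<and> L (Suc i) = c x" if "i < k" for i
    proof -
      have "L (Suc i) \<in> G 1" using L that by simp
      then show ?thesis by (auto simp: G_def standard_grading_def)
    qed
    then obtain l where l: "\<And>i. i < k \<Longrightarrow> homogeneous 1 (l i) \<and> L (Suc i) = c (l i)" by metis
    then show "\<exists>l. (\<forall>i<k. homogeneous 1 (l i)) \<and>
        (\<forall>i<k. \<forall>e::nat. lefschetz (partial_ideal J l i) (l i) (int e))"
      using equiv[of l L] L by (intro exI[of _ l]) simp
  next
    assume "\<exists>l. (\<forall>i<k. homogeneous 1 (l i)) \<and>
        (\<forall>i<k. \<forall>e::nat. lefschetz (partial_ideal J l i) (l i) (int e))"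
    then obtain l where l: "\<forall>i<k. homogeneous 1 (l i)"
      "\<forall>i<k. \<forall>e::nat. lefschetz (partial_ideal J l i) (l i) (int e)" by blast
    then have "?cond (\<lambda>i. c (l (i - 1)))" by (subst equiv[of l]) auto
    then show "\<exists>L. ?cond L" by (intro exI[of ?cond "\<lambda>i. c (l (i - 1))"])
  qed
  finally show ?thesis .
qed

subsection \<open>The truncated ideal\<close>

lemma ideal_sum_subspace:
  fixes A B :: "'a::comm_ring_1 set"
  assumes "ring_module.subspace A" "ring_module.subspace B"
  shows "ring_module.subspace {a + b | a b. a \<in> A \<and> b \<in> B}"
proof -
  have "ring_module.span A = A" "ring_module.span B = B" using assms by simp_all
  then have "{a + b | a b. a \<in> A \<and> b \<in> B} = ring_module.span (A \<union> B)"
    by (simp only: ring_module.span_Un)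
  then show ?thesis by simp
qed

lemma irrelevant_power:
  "(irrelevant_ideal :: ('n::finite, 'k::field) mpoly set) [^]\<^bsub>ideals_set class_ring\<^esub> N =
     {p. \<forall>m\<in>keys p. N \<le> mono_degree m}"
proof (induction N)
  case 0
  show ?case by (simp add: ideals_set_def)
next
  case (Suc N)
  let ?D = "\<lambda>N. {p :: ('n, 'k) mpoly. \<forall>m\<in>keys p. N \<le> mono_degree m}"
  let ?P = "ideal_prod (class_ring :: ('n, 'k) mpoly ring) (?D N) irrelevant_ideal"
  have add: "p + q \<in> ?P" if "p \<in> ?P" "q \<in> ?P" for p q
    using ideal_prod.sum[OF that] by simp
  have irr: "p \<in> irrelevant_ideal \<longleftrightarrow> lookup p 0 = 0" for p :: "('n, 'k) mpoly"
    unfolding irrelevant_ideal_def genideal_class_ring by (rule irrelevant_iff)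
  have "?P \<subseteq> ?D (Suc N)"
  proof
    fix p assume "p \<in> ?P"
    then show "p \<in> ?D (Suc N)"
    proof (induction rule: ideal_prod.induct)
      case (prod i j)
      have "Suc N \<le> mono_degree m" if "m \<in> keys (i * j)" for m
      proof -
        obtain a b where ab: "m = a + b" "a \<in> keys i" "b \<in> keys j"
          using keys_mult[of i j] \<open>m \<in> _\<close> by blast
        have "b \<noteq> 0" using ab(3) prod(2) by (auto simp: irr in_keys_iff)
        then have "mono_degree b \<noteq> 0" by (simp add: mono_degree_eq_0_iff)
        moreover have "N \<le> mono_degree a" using prod(1) ab(2) by blast
        ultimately show ?thesis by (simp add: ab(1) mono_degree_add)
      qed
      then show ?case by simp
    next
      case (sum s t)
      then show ?case using keys_add[of s t] by auto
    qed
  qed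
  moreover have "?D (Suc N) \<subseteq> ?P"
  proof
    fix p assume p: "p \<in> ?D (Suc N)"
    have single: "single m c \<in> ?P" if m: "Suc N \<le> mono_degree m" for m and c :: 'k
    proof -
      have "m \<noteq> 0" using m by auto
      then obtain i where i: "lookup m i \<noteq> 0" by (metis poly_mapping_eqI lookup_zero)
      let ?m = "m - single i 1"
      have meq: "m = ?m + single i 1"
        using i by (intro poly_mapping_eqI) (auto simp: lookup_add lookup_minus lookup_single when_def)
      have "mono_degree m = mono_degree ?m + 1"
        by (subst meq) (simp only: mono_degree_add mono_degree_1_iff[THEN iffD2, OF exI, of _ i])
      then have "single ?m c \<in> ?D N" using m by simp
      moreover have "variable i \<in> (irrelevant_ideal :: ('n, 'k) mpoly set)"
        unfolding irrelevant_ideal_def genideal_class_ring by (intro ring_module.span_base) auto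
      ultimately have "single ?m c * variable i \<in> ?P"
        using ideal_prod.prod[of _ "?D N" _ irrelevant_ideal class_ring] by fastforce
      moreover have "single ?m c * variable i = single m c"
        by (subst (2) meq) (simp add: variable_def mult_single)
      ultimately show ?thesis by simp
    qed
    \<comment> \<open>The inductive product of ideals has no clause for zero, which is obtained here
      as a monomial of degree \<open>Suc N\<close> with coefficient 0.\<close>
    have "0 \<in> ?P"
      using single[of "single (undefined :: 'n) (Suc N)" 0]
      by (simp add: mono_degree_def lookup_single when_def)
    then have "(\<Sum>m\<in>K. single m (lookup p m)) \<in> ?P"
      if "K \<subseteq> keys p" for K
      using that
    proof (induction K rule: infinite_finite_induct)
      case (insert m K)
      then have "single m (lookup p m) \<in> ?P"
        using p by (intro single) auto
      moreover have "(\<Sum>m\<in>K. single m (lookup p m)) \<in> ?P"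
        using insert by blast
      ultimately show ?case unfolding sum.insert[OF insert.hyps] by (rule add)
    qed simp_all
    from this[OF order_refl]
    have "(\<Sum>m\<in>keys p. single m (lookup p m)) \<in> ?P" .
    then show "p \<in> ?P" by (simp only: sum_single_keys)
  qed
  ultimately show ?case using Suc.IH by (simp add: ideals_set_def)
qed

lemma truncated_ideal_eq:
  fixes I :: "('n::finite, 'k::field) mpoly set"
  shows "truncated_ideal I =
    {a + b | a b. a \<in> I \<and> (\<forall>m\<in>keys b. nat (regularity I + 1) \<le> mono_degree m)}"
  unfolding truncated_ideal_def irrelevant_power set_add_def' by auto

lemma high_degree_graded:
  "graded_ideal {p :: ('n::finite, 'k::field) mpoly. \<forall>m\<in>keys p. N \<le> mono_degree m}"
    (is "graded_ideal ?D")
  unfolding graded_ideal_def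
proof (intro conjI ballI allI)
  show "ring_module.subspace ?D"
  proof (rule ring_module.subspaceI)
    show "x + y \<in> ?D" if "x \<in> ?D" "y \<in> ?D" for x y using that keys_add[of x y] by auto
    show "c * x \<in> ?D" if "x \<in> ?D" for c x
      using that keys_mult[of c x] by (fastforce simp: mono_degree_add)
  qed simp
  show "hom_comp e p \<in> ?D" if "p \<in> ?D" for p e
    using that by (auto simp: in_keys_iff lookup_hom_comp split: if_splits)
qed

lemma truncated_ideal_subspace:
  assumes "graded_ideal I"
  shows "ring_module.subspace (truncated_ideal I)"
proof -
  let ?D = "{p. \<forall>m\<in>keys p. nat (regularity I + 1) \<le> mono_degree m}"
  have "truncated_ideal I = {a + b | a b. a \<in> I \<and> b \<in> ?D}" by (simp add: truncated_ideal_eq)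
  then show ?thesis
    using ideal_sum_subspace[OF graded_idealD(1)[OF assms] graded_idealD(1)[OF high_degree_graded]]
    by simp
qed

text \<open>Elements of the larger ideal differ from those of the smaller one by polynomials without
  terms below the truncation degree, and taking the component of degree \<open>e\<close> removes
  these.\<close>

lemma partial_truncated_ideal_low:
  fixes I :: "('n::finite, 'k::field) mpoly set"
  assumes I: "graded_ideal I" and l: "\<And>j. j < i \<Longrightarrow> homogeneous 1 (l j)"
    and x: "homogeneous e x" "e < int (nat (regularity I + 1))"
  shows "x \<in> partial_ideal (truncated_ideal I) l i \<longleftrightarrow> x \<in> partial_ideal I l i"
proof
  let ?D = "{p. \<forall>m\<in>keys p. nat (regularity I + 1) \<le> mono_degree m}"
  note gr = partial_ideal_graded[OF I l]
  have sum_in: "p \<in> {a + b | a b. a \<in> partial_ideal I l i \<and> b \<in> ?D}"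
    if "p \<in> partial_ideal (truncated_ideal I) l i" for p
  proof -
    let ?S = "{a + b | a b. a \<in> partial_ideal I l i \<and> b \<in> ?D}"
    have "ring_module.subspace ?S"
      by (rule ideal_sum_subspace[OF graded_idealD(1)[OF gr] graded_idealD(1)[OF high_degree_graded]])
    moreover have "truncated_ideal I \<union> l ` {..<i} \<subseteq> ?S"
    proof
      fix y assume "y \<in> truncated_ideal I \<union> l ` {..<i}"
      then consider a b where "y = a + b" "a \<in> I" "b \<in> ?D" | "y \<in> l ` {..<i}"
        unfolding truncated_ideal_eq by blast
      then show "y \<in> ?S"
      proof cases
        case 1
        have "a \<in> partial_ideal I l i" unfolding partial_ideal_def using 1 by (intro ring_module.span_base) auto
        then show ?thesis using 1 by blast
      next
        case 2
        then have "y \<in> partial_ideal I l i" unfolding partial_ideal_def by (intro ring_module.span_base) auto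
        moreover have "y = y + 0" "0 \<in> ?D" by auto
        ultimately show ?thesis by blast
      qed
    qed
    ultimately show ?thesis
      using that ring_module.span_minimal unfolding partial_ideal_def[of "truncated_ideal I"] by blast
  qed
  {
    assume "x \<in> partial_ideal (truncated_ideal I) l i"
    then obtain a b where ab: "x = a + b" "a \<in> partial_ideal I l i" "b \<in> ?D" using sum_in by blast
    have "hom_comp e b = 0"
    proof (rule poly_mapping_eqI)
      fix m
      have "lookup b m = 0" if "int (mono_degree m) = e"
      proof (rule ccontr)
        assume "lookup b m \<noteq> 0"
        then have "nat (regularity I + 1) \<le> mono_degree m" using ab(3) by (simp add: in_keys_iff)
        then show False using that x(2) by linarith
      qed
      then show "lookup (hom_comp e b) m = lookup 0 m"
        by (simp add: lookup_hom_comp)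
    qed
    then have "x = hom_comp e a" using x(1) hom_comp_add[of e a b] ab(1) by simp
    then show "x \<in> partial_ideal I l i" using graded_idealD(2)[OF gr ab(2)] by simp
  }
  assume "x \<in> partial_ideal I l i"
  moreover have "I \<subseteq> truncated_ideal I"
  proof
    fix a assume "a \<in> I"
    then have "a = a + 0" "a \<in> I" "0 \<in> ?D" by auto
    then show "a \<in> truncated_ideal I" unfolding truncated_ideal_eq by blast
  qed
  then have "partial_ideal I l i \<subseteq> partial_ideal (truncated_ideal I) l i"
    unfolding partial_ideal_def by (intro ring_module.span_mono) auto
  ultimately show "x \<in> partial_ideal (truncated_ideal I) l i" by blast
qed

lemma partial_truncated_ideal_high:
  fixes I :: "('n::finite, 'k::field) mpoly set"
  assumes I: "graded_ideal I" and x: "homogeneous e x" "e \<ge> int (nat (regularity I + 1))"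
  shows "x \<in> partial_ideal (truncated_ideal I) l i"
proof -
  have "\<forall>m\<in>keys x. nat (regularity I + 1) \<le> mono_degree m"
  proof
    fix m assume "m \<in> keys x"
    then have "int (mono_degree m) = e" using x(1) by (simp add: homogeneous_def)
    then show "nat (regularity I + 1) \<le> mono_degree m" using x(2) by linarith
  qed
  moreover have "0 \<in> I" "x = 0 + x" using ring_module.subspace_0[OF graded_idealD(1)[OF I]] by auto
  ultimately have "x \<in> truncated_ideal I" unfolding truncated_ideal_eq by blast
  then show ?thesis unfolding partial_ideal_def by (intro ring_module.span_base) auto
qed

text \<open>The condition involves degrees \<open>e\<close> and \<open>e + 1\<close>. If both lie
  below the truncation degree the quotients agree there; otherwise the target is zero and the map is
  surjective.\<close>

lemma lefschetz_truncated:
  fixes I :: "('n::finite, 'k::field) mpoly set"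
  assumes I: "graded_ideal I" and l: "\<And>j. j \<le> i \<Longrightarrow> homogeneous 1 (l j)"
  shows "lefschetz (partial_ideal (truncated_ideal I) l i) (l i) e \<longleftrightarrow>
    (e + 1 < int (nat (regularity I + 1)) \<longrightarrow> lefschetz (partial_ideal I l i) (l i) e)"
proof (cases "e + 1 < int (nat (regularity I + 1))")
  case True
  have l': "\<And>j. j < i \<Longrightarrow> homogeneous 1 (l j)" using l by simp
  have mem: "x \<in> partial_ideal (truncated_ideal I) l i \<longleftrightarrow> x \<in> partial_ideal I l i"
    if "homogeneous d x" "d \<le> e + 1" for d x
    using partial_truncated_ideal_low[OF I l' that(1)] that(2) True by auto
  have hx: "homogeneous (e + 1) (l i * x)" if "homogeneous e x" for x
    using that by (intro homogeneous_mult_eq[OF l]) auto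
  show ?thesis
    using True mem[of e] mem[OF hx] mem[OF homogeneous_diff[OF _ hx]]
    unfolding lefschetz_def by (auto simp: order_refl)
next
  case False
  have "y - l i * 0 \<in> partial_ideal (truncated_ideal I) l i" if "homogeneous (e + 1) y" for y
    using partial_truncated_ideal_high[OF I that] False by simp
  then show ?thesis using False homogeneous_0 unfolding lefschetz_def by blast
qed

subsection \<open>The regularity bound\<close>

lemma lefschetz_beyond_regularity:
  fixes I :: "('n::finite, 'k::field) mpoly set"
  assumes I: "graded_ideal I" and lin: "\<And>i. homogeneous 1 (l i)"
    and l: "\<And>i. i < CARD('n) \<Longrightarrow> l i \<notin> ring_module.span (l ` {..<i})"
      "\<And>i. i < CARD('n) \<Longrightarrow> \<exists>E. \<forall>e\<ge>E. \<forall>x. homogeneous e x \<longrightarrow>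
        l i * x \<in> partial_ideal I l i \<longrightarrow> x \<in> partial_ideal I l i"
    and i: "i < CARD('n)" and e: "e \<ge> regularity I"
  shows "lefschetz (partial_ideal I l i) (l i) e"
proof -
  define d where "d = resolution_shifts I"
  obtain A where res: "minimal_graded_free_resolution I d A"
    unfolding d_def resolution_shifts_def
    using someI_ex[OF minimal_graded_free_resolution_exists[OF I]] by blast
  \<comment> \<open>With the ring put in front, place \<open>Suc i\<close> carries the shifts of the
    \<open>i\<close>-th Betti numbers of \<open>I\<close>, so the definition of regularity becomes
    the bound \<open>regularity I + int i\<close> at that place.\<close>
  define G where "G i = (case i of 0 \<Rightarrow> [0] | Suc i \<Rightarrow> d i)" for i
  have GS: "G 0 = [0]" "G (Suc i) = d i" for i by (simp_all add: G_def)
  note res' = res[unfolded minimal_graded_free_resolution_def]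
  have A0: "A 0 \<in> carrier_mat 1 (length (d 0))" using res' by (elim conjE)
  have AS: "A (Suc i) \<in> carrier_mat (length (d i)) (length (d (Suc i)))" for i
    using res' by (elim conjE) (rule spec)
  have hom: "homogeneous_mat (G i) (G (Suc i)) (A i)" for i
  proof (cases i)
    case 0
    have "\<forall>b<length (d 0). homogeneous (d 0 ! b) (A 0 $$ (0, b))" using res' by (elim conjE)
    then show ?thesis using A0 by (simp add: homogeneous_mat_def 0 GS)
  next
    case (Suc i')
    have "\<forall>i. \<forall>a<length (d i). \<forall>b<length (d (Suc i)). homogeneous (d (Suc i) ! b - d i ! a) (A (Suc i) $$ (a, b))"
      using res' by (elim conjE)
    then show ?thesis using AS by (simp add: homogeneous_mat_def Suc GS)
  qed
  have car: "A i \<in> carrier_mat (length (G i)) (length (G (Suc i)))" for i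
    using hom by (simp add: homogeneous_mat_def)
  interpret reduced_resolution l "CARD('n)" I G A
  proof
    show "homogeneous 1 (l j)" for j by (rule lin)
    show "graded_ideal I" by (rule I)
    show "homogeneous_mat (G i) (G (Suc i)) (A i)" for i by (rule hom)
    show "G 0 = [0]" by (rule GS)
    have "(\<lambda>v. A 0 *\<^sub>v v) ` carrier_vec (length (d 0)) = {w \<in> carrier_vec 1. w $ 0 \<in> I}"
      using res' by (elim conjE)
    then have "mat_app (A 0) ` free_module (length (d 0)) = fun_of_vec ` {w \<in> carrier_vec 1. w $ 0 \<in> I}"
      by (intro image_eq_iff_fun_of_vec[OF A0, THEN iffD1]) blast
    then show "mat_app (A 0) ` free_module (length (G 1)) = {v \<in> free_module 1. v 0 \<in> I}"
      using GS(2)[of 0] unfolding fun_of_vec_singletons by simp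
    show "mat_app (A (Suc i)) ` free_module (length (G (Suc (Suc i)))) =
        {v \<in> free_module (length (G (Suc i))). mat_app (A i) v = 0}" for i
    proof -
      have all: "\<forall>i. (\<lambda>v. A (Suc i) *\<^sub>v v) ` carrier_vec (length (d (Suc i))) = mat_kernel (A i)"
        using res' by (elim conjE)
      have sub: "mat_kernel (A i) \<subseteq> carrier_vec (length (d i))"
        using mat_kernel_carrier[OF car[of i]] by (simp add: GS)
      have "mat_app (A (Suc i)) ` free_module (length (d (Suc i))) = fun_of_vec ` mat_kernel (A i)"
        by (rule image_eq_iff_fun_of_vec[OF AS sub, THEN iffD1, OF spec[OF all]])
      then show ?thesis using fun_of_vec_mat_kernel[OF car[of i]] by (simp add: GS)
    qed
    show "A (Suc i) $$ (a, b) \<in> variable_span"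
      if "a < length (G (Suc i))" "b < length (G (Suc (Suc i)))" for i a b
    proof -
      have "\<forall>i. \<forall>a<length (d i). \<forall>b<length (d (Suc i)). A (Suc i) $$ (a, b) \<in> irrelevant_ideal"
        using res' by (elim conjE)
      then show ?thesis
        using that by (simp add: GS irrelevant_ideal_def genideal_class_ring)
    qed
    have J: "linear_sequence.J l j = ring_module.span (l ` {..<j})" for j
      by (rule linear_sequence.J_def) (unfold_locales, rule lin)
    show "x \<in> linear_sequence.J l j" if "j < CARD('n)" "l j * x \<in> linear_sequence.J l j" for j x
      using that l(1) unfolding J by (intro linear_forms_regular[of j l x] lin) auto
    show "linear_sequence.J l CARD('n) = variable_span"
      unfolding J by (rule linear_forms_span_irrelevant) (use lin l(1) in auto)
  qed
  have shifts: "g \<le> regularity I + int i" if g: "g \<in> set (G (Suc i))" for g i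
  proof -
    have betti: "graded_betti I i j \<noteq> 0 \<longleftrightarrow> j \<in> set (d i)" for i j
      by (simp add: graded_betti_def d_def count_list_0_iff)
    let ?X = "{Max {j. graded_betti I i j \<noteq> 0} - int i | i. \<exists>j. graded_betti I i j \<noteq> 0}"
    have bound: "i < CARD('n)" if "j \<in> set (d i)" for i j
    proof (rule ccontr)
      assume "\<not> i < CARD('n)"
      \<comment> \<open>There is at least one variable, so \<open>i\<close> is positive as
        \<open>hilbert_syzygy\<close> demands.\<close>
      then have "G (Suc i) = []" using zero_less_card_finite[where 'a = 'n] by (intro hilbert_syzygy) linarith+
      then show False using that by (simp add: GS)
    qed
    have "?X \<subseteq> (\<lambda>i. Max {j. graded_betti I i j \<noteq> 0} - int i) ` {..<CARD('n)}"
      using bound unfolding betti by blast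
    then have fin: "finite ?X" using finite_subset by blast
    have "g \<in> set (d i)" using g by (simp add: GS)
    then have "Max {j. graded_betti I i j \<noteq> 0} - int i \<in> ?X" unfolding betti by blast
    then have "Max {j. graded_betti I i j \<noteq> 0} - int i \<le> regularity I"
      unfolding regularity_def by (rule Max_ge[OF fin])
    moreover have "g \<le> Max {j. graded_betti I i j \<noteq> 0}"
      using \<open>g \<in> set (d i)\<close> unfolding betti by simp
    ultimately show ?thesis by linarith
  qed
  have "x \<in> partial_ideal I l i" if "homogeneous e x" "l i * x \<in> partial_ideal I l i" for x
    using injective_from_regularity[OF l(2)[unfolded partial_ideal_def] shifts i e that(1)] that(2)
    unfolding partial_ideal_def by blast
  then show ?thesis unfolding lefschetz_def by blast
qed

lemma partial_ideal_cong:
  "(\<And>j. j < i \<Longrightarrow> l j = l' j) \<Longrightarrow> partial_ideal I l i = partial_ideal I l' i"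
  unfolding partial_ideal_def by (metis image_cong lessThan_iff)

theorem corollary5p5:
  fixes I :: "('n::finite, 'k::field_char_0) mpoly set" and k :: nat
  assumes "homogeneous_ideal I" and "I \<noteq> {0}"
    and "1 \<le> k" and "k \<le> CARD('n)"
  shows "quotient_k_WLP I k \<longleftrightarrow> quotient_k_WLP (truncated_ideal I) k"
proof -
  let ?N = "int (nat (regularity I + 1))"
  have I: "graded_ideal I" using assms(1) by (rule graded_ideal_homogeneous_ideal)
  note iff = quotient_k_WLP_iff[OF graded_idealD(1)[OF I] assms(3)]
  note iff' = quotient_k_WLP_iff[OF truncated_ideal_subspace[OF I] assms(3)]
  show ?thesis
    unfolding iff iff'
  proof
    assume "\<exists>l. (\<forall>i<k. homogeneous 1 (l i)) \<and>
      (\<forall>i<k. \<forall>e. lefschetz (partial_ideal I l i) (l i) (int e))"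
    \<comment> \<open>The same forms serve: passing to the truncation only drops conditions.\<close>
    then show "\<exists>l. (\<forall>i<k. homogeneous 1 (l i)) \<and>
      (\<forall>i<k. \<forall>e. lefschetz (partial_ideal (truncated_ideal I) l i) (l i) (int e))"
      by (elim exE, intro exI) (auto simp: lefschetz_truncated[OF I])
  next
    assume "\<exists>l. (\<forall>i<k. homogeneous 1 (l i)) \<and>
      (\<forall>i<k. \<forall>e. lefschetz (partial_ideal (truncated_ideal I) l i) (l i) (int e))"
    then obtain m where m: "\<And>i. i < k \<Longrightarrow> homogeneous 1 (m i)"
      "\<And>i e. i < k \<Longrightarrow> lefschetz (partial_ideal (truncated_ideal I) m i) (m i) (int e)" by blast
    \<comment> \<open>The sequence is continued by zero only to have a starting point; the first
      \<open>CARD('n)\<close> forms are replaced by generic ones.\<close>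
    define l0 where "l0 i = (if i < k then m i else 0)" for i
    have l0: "homogeneous 1 (l0 i)" for i using m(1) by (simp add: l0_def)
    have "lefschetz (partial_ideal I l0 i) (l0 i) e" if "i < k" "e + 1 < ?N" for i e
    proof (cases "e < 0")
      case True
      then show ?thesis by (intro lefschetz_negative) (simp_all add: partial_ideal_def)
    next
      case False
      then obtain n where n: "e = int n" by (metis not_less nonneg_int_cases)
      have "partial_ideal (truncated_ideal I) l0 i = partial_ideal (truncated_ideal I) m i"
        using that(1) by (intro partial_ideal_cong) (simp add: l0_def)
      then have "lefschetz (partial_ideal (truncated_ideal I) l0 i) (l0 i) e"
        using m(2)[OF that(1), of n] that(1) by (simp add: l0_def n)
      then show ?thesis using that(2) lefschetz_truncated[OF I, of i l0 e] l0 by blast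
    qed
    then have "\<exists>l. (\<forall>i. homogeneous 1 (l i)) \<and>
      (\<forall>i<CARD('n). l i \<notin> ring_module.span (l ` {..<i}) \<and>
        (\<exists>E. \<forall>e\<ge>E. \<forall>x. homogeneous e x \<longrightarrow> l i * x \<in> partial_ideal I l i \<longrightarrow> x \<in> partial_ideal I l i)) \<and>
      (\<forall>i<k. \<forall>e. e + 1 < ?N \<longrightarrow> lefschetz (partial_ideal I l i) (l i) e)"
      by (rule generic_linear_forms[OF I order_refl l0])
    then obtain l where l: "\<forall>i. homogeneous 1 (l i)"
      "\<forall>i<CARD('n). l i \<notin> ring_module.span (l ` {..<i}) \<and>
        (\<exists>E. \<forall>e\<ge>E. \<forall>x. homogeneous e x \<longrightarrow> l i * x \<in> partial_ideal I l i \<longrightarrow> x \<in> partial_ideal I l i)"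
      "\<forall>i<k. \<forall>e. e + 1 < ?N \<longrightarrow> lefschetz (partial_ideal I l i) (l i) e"
      by (elim exE conjE) (rule that)
    have "lefschetz (partial_ideal I l i) (l i) e" if "i < k" for i e
    proof (cases "e + 1 < ?N")
      case True
      then show ?thesis using l(3) that by blast
    next
      case False
      \<comment> \<open>The cutoff of \<open>nat\<close> does no harm, as \<open>?N\<close> is at
        least \<open>regularity I + 1\<close> in any case.\<close>
      then have "e \<ge> regularity I" by linarith
      then show ?thesis
        using l(1,2) that assms(4) by (intro lefschetz_beyond_regularity[OF I]) auto
    qed
    then show "\<exists>l. (\<forall>i<k. homogeneous 1 (l i)) \<and>
      (\<forall>i<k. \<forall>e. lefschetz (partial_ideal I l i) (l i) (int e))"
      using l(1) by blast
  qed
qed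

end
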